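(* Fix integers $k\ge 1$ and $N>4k$ (independent of $n$). There exist constants $c>0$ and $n_0$ such that for every $n\ge n_0$ there are orthogonal matrices $O^{(1)},\dots,O^{(N)}\in O(2n)$ with the following property: for every $S\in\mathcal S_{2k}$ there exist $r\in[N]$ and $R\in\mathcal D_{2k}$ with $|\det(O^{(r)}_{R,S})|\ge c\, n^{-k/2}$. Consequently the POVM $\mathsf G(r,\mathbf q,X)=\frac1N\mathsf G^{O^{(r)}}(\mathbf q,X)$ (outcomes $r\in[N]$, $\mathbf q\in\{\pm1\}^n$, $X\subseteq[2n]$) is a joint measurement (parent POVM) of all unsharp observables $\mathsf M^{\eta}_S$, $S\in\mathcal S_{2k}$, with a common sharpness $\eta=\Omega(n^{-k/2})$, i.e. $\eta_{2k}=\Omega(n^{-k/2})$. For $k=1$ the same conclusion holds already with $N=2$ orthogonal matrices.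
   Context: Fix $n\ge1$ and let $\gamma_1,\dots,\gamma_{2n}$ be Majorana operators on $\mathcal H=(\mathbb C^2)^{\otimes n}$: Hermitian operators with $\gamma_j\gamma_{j'}+\gamma_{j'}\gamma_j=2\delta_{jj'}I$. For $S=\{j_1<\dots<j_m\}\subseteq[2n]$ put $\gamma_S=i^{\binom m2}\gamma_{j_1}\cdots\gamma_{j_m}$ ($\gamma_\emptyset=I$); $\mathcal S_m=\{S\subseteq[2n]:|S|=m\}$. Let $\mathcal D_2=\{\{2j-1,2j\}:j\in[n]\}$ and $\mathcal D_{2k}$ the set of unions of $k$ distinct elements of $\mathcal D_2$; for $R=R_1\cup\dots\cup R_k\in\mathcal D_{2k}$ ($R_i\in\mathcal D_2$) and $\mathbf q=(q_{R'})_{R'\in\mathcal D_2}\in\{\pm1\}^n$ set $q_R=\prod_i q_{R_i}$. For $O\in O(2n)$ and equal-size index sets $R,S$, $O_{R,S}$ is the submatrix with rows $R$ and columns $S$ (in increasing order). For $X,S\subseteq[2n]$ let $x_S=(-1)^{|X||S|-|S\cap X|}$. For $R\in\mathcal D_{2k}$ let $\gamma_R^{O,X}=\sum_{S\in\mathcal S_{2k}}x_S\det(O_{R,S})\gamma_S$ and $\mathsf G^O_R(q,X)=2^{-2n-1}(I+q\gamma_R^{O,X})$, $q\in\{\pm1\}$. Define $\mathsf G^O(\mathbf q,X)=(2^{2n})^{n-1}\prod_{R\in\mathcal D_2}\mathsf G^O_R(q_R,X)$ for $\mathbf q\in\{\pm1\}^n$, $X\subseteq[2n]$ (the factors commute).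 Unsharp Majorana observable with sharpness $\eta\in[0,1]$: $\mathsf M^\eta_S(e)=\frac12(I+e\eta\gamma_S)$, $e\in\{\pm1\}$. A finite family of POVMs $\mathsf M_j$ is jointly measured by a POVM $\mathsf G$ with finite outcome set $\Lambda$ if there are stochastic maps $D(e|j,\lambda)\ge0$, $\sum_eD(e|j,\lambda)=1$, with $\mathsf M_j(e)=\sum_\lambda D(e|j,\lambda)\mathsf G(\lambda)$ for all $j,e$. $\eta_{2k}$ denotes the largest $\eta$ such that $\mathsf G$ jointly measures all $\mathsf M^{\eta}_S$, $S\in\mathcal S_{2k}$. *)

theory Defs
  imports "HOL-Analysis.Analysis" "Jordan_Normal_Form.Matrix" "Jordan_Normal_Form.Determinant"
    "Jordan_Normal_Form.DL_Submatrix"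
begin

text \<open>Conventions: the index set [2n] is rendered 0-based as {0..<2n}; the pairs
 {2j-1,2j} (j in [n]) become {2j,2j+1} (j < n). Operators on (C^2)^(tensor n) are
 complex 2^n x 2^n matrices.\<close>

definition msum :: "nat \<Rightarrow> ('x \<Rightarrow> complex mat) \<Rightarrow> 'x set \<Rightarrow> complex mat" where
  "msum d f A = mat d d (\<lambda>(i,j). \<Sum>x\<in>A. f x $$ (i,j))"

definition cadj :: "complex mat \<Rightarrow> complex mat" where
  "cadj A = mat (dim_col A) (dim_row A) (\<lambda>(i,j). cnj (A $$ (j,i)))"

definition hermitian_mat :: "complex mat \<Rightarrow> bool" where
  "hermitian_mat A \<longleftrightarrow> (\<exists>d. A \<in> carrier_mat d d) \<and> cadj A = A"

definition psd_mat :: "complex mat \<Rightarrow> bool" where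
  "psd_mat A \<longleftrightarrow> hermitian_mat A \<and>
     (\<forall>v \<in> carrier_vec (dim_row A). 0 \<le> Re (\<Sum>i<dim_row A. cnj (v $ i) * (A *\<^sub>v v) $ i))"

definition majorana :: "nat \<Rightarrow> (nat \<Rightarrow> complex mat) \<Rightarrow> bool" where
  "majorana n \<gamma> \<longleftrightarrow>
     (\<forall>j<2*n. \<gamma> j \<in> carrier_mat (2^n) (2^n) \<and> hermitian_mat (\<gamma> j)) \<and>
     (\<forall>j<2*n. \<forall>j'<2*n. \<gamma> j * \<gamma> j' + \<gamma> j' * \<gamma> j =
        (if j = j' then 2 \<cdot>\<^sub>m 1\<^sub>m (2^n) else 0\<^sub>m (2^n) (2^n)))"

definition gammaS :: "nat \<Rightarrow> (nat \<Rightarrow> complex mat) \<Rightarrow> nat set \<Rightarrow> complex mat" where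
  "gammaS n \<gamma> S = (\<i> ^ (card S choose 2)) \<cdot>\<^sub>m
     foldr (\<lambda>j B. \<gamma> j * B) (sorted_list_of_set S) (1\<^sub>m (2^n))"

definition Sm :: "nat \<Rightarrow> nat \<Rightarrow> nat set set" where
  "Sm n m = {S. S \<subseteq> {0..<2*n} \<and> card S = m}"

definition D2 :: "nat \<Rightarrow> nat set set" where
  "D2 n = {{2*j, 2*j+1} | j. j < n}"

definition D2k :: "nat \<Rightarrow> nat \<Rightarrow> nat set set" where
  "D2k n k = {\<Union>T | T. T \<subseteq> D2 n \<and> card T = k}"

definition orth_mat :: "nat \<Rightarrow> real mat \<Rightarrow> bool" where
  "orth_mat d Om \<longleftrightarrow> Om \<in> carrier_mat d d \<and> transpose_mat Om * Om = 1\<^sub>m d"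

definition minor :: "real mat \<Rightarrow> nat set \<Rightarrow> nat set \<Rightarrow> real" where
  "minor Om R S = det (submatrix Om R S)"

definition xsign :: "nat set \<Rightarrow> nat set \<Rightarrow> real" where
  "xsign X S = (-1) ^ (card X * card S - card (S \<inter> X))"

definition gammaOX :: "nat \<Rightarrow> (nat \<Rightarrow> complex mat) \<Rightarrow> real mat \<Rightarrow> nat set \<Rightarrow> nat set \<Rightarrow> complex mat" where
  "gammaOX n \<gamma> Om X R =
     msum (2^n) (\<lambda>S. complex_of_real (xsign X S * minor Om R S) \<cdot>\<^sub>m gammaS n \<gamma> S) (Sm n (card R))"

definition GR :: "nat \<Rightarrow> (nat \<Rightarrow> complex mat) \<Rightarrow> real mat \<Rightarrow> nat set \<Rightarrow> int \<Rightarrow> nat set \<Rightarrow> complex mat" where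
  "GR n \<gamma> Om R q X = complex_of_real (2 powr (- 2 * real n - 1)) \<cdot>\<^sub>m
     (1\<^sub>m (2^n) + complex_of_int q \<cdot>\<^sub>m gammaOX n \<gamma> Om X R)"

text \<open>Sign vectors q in {+-1}^n, indexed by j < n (the pair {2j,2j+1}); extensional.\<close>
definition signvecs :: "nat \<Rightarrow> (nat \<Rightarrow> int) set" where
  "signvecs n = {q. (\<forall>j<n. q j = 1 \<or> q j = -1) \<and> (\<forall>j\<ge>n. q j = 1)}"

definition GO :: "nat \<Rightarrow> (nat \<Rightarrow> complex mat) \<Rightarrow> real mat \<Rightarrow> (nat \<Rightarrow> int) \<Rightarrow> nat set \<Rightarrow> complex mat" where
  "GO n \<gamma> Om q X = complex_of_real ((2 ^ (2*n)) ^ (n - 1)) \<cdot>\<^sub>m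
     foldr (\<lambda>j B. GR n \<gamma> Om {2*j, 2*j+1} (q j) X * B) [0..<n] (1\<^sub>m (2^n))"

definition Mobs :: "nat \<Rightarrow> (nat \<Rightarrow> complex mat) \<Rightarrow> real \<Rightarrow> nat set \<Rightarrow> int \<Rightarrow> complex mat" where
  "Mobs n \<gamma> \<eta> S e = (1/2 :: complex) \<cdot>\<^sub>m
     (1\<^sub>m (2^n) + complex_of_real (real_of_int e * \<eta>) \<cdot>\<^sub>m gammaS n \<gamma> S)"

definition is_povm :: "nat \<Rightarrow> 'l set \<Rightarrow> ('l \<Rightarrow> complex mat) \<Rightarrow> bool" where
  "is_povm d \<Lambda> G \<longleftrightarrow> finite \<Lambda> \<and> (\<forall>l\<in>\<Lambda>. G l \<in> carrier_mat d d \<and> psd_mat (G l)) \<and>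
     msum d G \<Lambda> = 1\<^sub>m d"

definition jointly_measures :: "nat \<Rightarrow> 'l set \<Rightarrow> ('l \<Rightarrow> complex mat) \<Rightarrow> 'j set \<Rightarrow> 'e set \<Rightarrow> ('j \<Rightarrow> 'e \<Rightarrow> complex mat) \<Rightarrow> bool" where
  "jointly_measures d \<Lambda> G J E M \<longleftrightarrow> is_povm d \<Lambda> G \<and>
     (\<exists>D :: 'e \<Rightarrow> 'j \<Rightarrow> 'l \<Rightarrow> real.
        (\<forall>j\<in>J. \<forall>l\<in>\<Lambda>. (\<forall>e\<in>E. D e j l \<ge> 0) \<and> (\<Sum>e\<in>E. D e j l) = 1) \<and>
        (\<forall>j\<in>J. \<forall>e\<in>E. M j e = msum d (\<lambda>l. complex_of_real (D e j l) \<cdot>\<^sub>m G l) \<Lambda>))"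

definition LambdaN :: "nat \<Rightarrow> nat \<Rightarrow> (nat \<times> (nat \<Rightarrow> int) \<times> nat set) set" where
  "LambdaN N n = {(r, q, X). r < N \<and> q \<in> signvecs n \<and> X \<subseteq> {0..<2*n}}"

definition Gmix :: "nat \<Rightarrow> nat \<Rightarrow> (nat \<Rightarrow> complex mat) \<Rightarrow> (nat \<Rightarrow> real mat)
    \<Rightarrow> nat \<times> (nat \<Rightarrow> int) \<times> nat set \<Rightarrow> complex mat" where
  "Gmix N n \<gamma> Om = (\<lambda>(r, q, X). complex_of_real (1 / real N) \<cdot>\<^sub>m GO n \<gamma> (Om r) q X)"

end

theory Submission
  imports Defs
begin

text \<open>Twisting the Majorana operators by X and rotating them by an orthogonal matrix gives Majorana
  operators again, and each factor of the parent measurement is a projector onto an eigenspace of the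
  involution formed by two consecutive rotated operators. Hence the outcome statistics are those of
  commuting projectors, summing over the signs of the pairs in R leaves the product of the rotated
  operators with index in R, and summing over X against the character of S leaves the minor of R and S
  times the operator of S. A lower bound on these minors is therefore the whole problem.

  The matrices are sparse: the 2n columns are cut into p blocks, where p is a power of two of order
  the square root of n, each block carries the rows of a Hadamard matrix of order p (repeated columns
  sharing the weight), and for any two blocks there is a pair of rows, one supported on each of them.
  If the columns of S lie in distinct blocks, then suitable k pairs of rows have exactly one nonzero
  entry per row and column, each of order \<open>p\<^sup>-\<^sup>1\<^sup>/\<^sup>2\<close>, so the minor has order
  \<open>p\<^sup>-\<^sup>k\<close>. Cutting the columns along randomly shifted lines separates S
  with failure probability of order 1/p, and N independent shifts beat the \<open>n\<^sup>2\<^sup>k\<close>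
  choices of S as soon as N > 4k.\<close>

section \<open>Matrix sums, products and positivity\<close>

text \<open>The rows cannot be chosen freely: R has to be a union of the fixed pairs {2j, 2j+1}, so
  every two blocks need a pair of their own. With q blocks this takes about q^2/2 of the n pairs,
  which limits q to the order of sqrt n. On the other hand a unit row spread evenly over a block of
  2n/q columns has entries of order sqrt(q/n), so 2k of them multiply to the order of (q/n)^k, and
  more blocks are better. Both together fix p and the exponent k/2. Nothing is asked of the rows
  outside these pairs, so it is enough that the prescribed rows are orthonormal. A set S with two
  columns in one block is left to another shift; no single matrix is meant to serve all S. For k = 1
  two shifts leave only pairs of columns on which all Hadamard rows coincide, hence the one extra
  row per block. The constants come from p being a power of two: p^2 \<le> n < 4 p^2, so there are
  fewer than 8 p^2 columns and a Hadamard column is repeated at most 8 times. The mixture hits the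
  matrix suited to S only with weight 1/N, and this is the whole loss from the minor bound to the
  sharpness.\<close>

lemma msum_carrier [simp]: "msum d f A \<in> carrier_mat d d"
  by (simp add: msum_def)

lemma msum_dim [simp]: "dim_row (msum d f A) = d" "dim_col (msum d f A) = d"
  by (simp_all add: msum_def)

lemma msum_index [simp]: "i < d \<Longrightarrow> j < d \<Longrightarrow> msum d f A $$ (i, j) = (\<Sum>x\<in>A. f x $$ (i, j))"
  by (simp add: msum_def)

lemma mat_mult_index:
  assumes "A \<in> carrier_mat d d" "B \<in> carrier_mat d d" "i < d" "j < d"
  shows "(A * B) $$ (i, j) = (\<Sum>k<d. A $$ (i, k) * B $$ (k, j))"
  using assms by (auto simp: scalar_prod_def atLeast0LessThan)

lemma msum_mult:
  assumes f: "\<And>x. x \<in> A \<Longrightarrow> f x \<in> carrier_mat d d" and g: "\<And>y. y \<in> B \<Longrightarrow> g y \<in> carrier_mat d d"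
  shows "msum d f A * msum d g B = msum d (\<lambda>(x, y). f x * g y) (A \<times> B)"
proof (rule eq_matI)
  fix i j assume "i < dim_row (msum d (\<lambda>(x, y). f x * g y) (A \<times> B))"
    "j < dim_col (msum d (\<lambda>(x, y). f x * g y) (A \<times> B))"
  then have ij: "i < d" "j < d" by auto
  have "(msum d f A * msum d g B) $$ (i, j)
      = (\<Sum>k<d. \<Sum>x\<in>A. \<Sum>y\<in>B. f x $$ (i, k) * g y $$ (k, j))"
    using ij by (subst mat_mult_index[where d = d]) (auto simp: sum_product)
  also have "\<dots> = (\<Sum>x\<in>A. \<Sum>k<d. \<Sum>y\<in>B. f x $$ (i, k) * g y $$ (k, j))"
    by (rule sum.swap)
  also have "\<dots> = (\<Sum>x\<in>A. \<Sum>y\<in>B. \<Sum>k<d. f x $$ (i, k) * g y $$ (k, j))"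
    by (intro sum.cong refl sum.swap)
  also have "\<dots> = (\<Sum>x\<in>A. \<Sum>y\<in>B. (f x * g y) $$ (i, j))"
    using f g ij by (intro sum.cong refl mat_mult_index[symmetric]) auto
  finally show "(msum d f A * msum d g B) $$ (i, j) = msum d (\<lambda>(x, y). f x * g y) (A \<times> B) $$ (i, j)"
    using ij by (simp add: sum.cartesian_product case_prod_beta)
qed auto

lemma cadj_carrier [simp]: "A \<in> carrier_mat d e \<Longrightarrow> cadj A \<in> carrier_mat e d"
  by (simp add: cadj_def)

lemma cadj_index: "A \<in> carrier_mat d e \<Longrightarrow> i < e \<Longrightarrow> j < d \<Longrightarrow> cadj A $$ (i, j) = cnj (A $$ (j, i))"
  by (simp add: cadj_def)

lemma cadj_mult:
  assumes "A \<in> carrier_mat d d" "B \<in> carrier_mat d d"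
  shows "cadj (A * B) = cadj B * cadj A"
proof (rule eq_matI)
  fix i j assume "i < dim_row (cadj B * cadj A)" "j < dim_col (cadj B * cadj A)"
  then have "i < d" "j < d" using assms by (auto simp: cadj_def)
  then show "cadj (A * B) $$ (i, j) = (cadj B * cadj A) $$ (i, j)"
    using assms mult_carrier_mat[OF assms]
    by (simp add: cadj_index[where d = d and e = d] mat_mult_index[where d = d] mult.commute del: index_mult_mat)
qed (use assms in \<open>auto simp: cadj_def\<close>)

lemma cadj_smult: "cadj (c \<cdot>\<^sub>m A) = cnj c \<cdot>\<^sub>m cadj A"
  by (rule eq_matI) (auto simp: cadj_def)

lemma cadj_add: "A \<in> carrier_mat d d \<Longrightarrow> B \<in> carrier_mat d d \<Longrightarrow> cadj (A + B) = cadj A + cadj B"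
  by (rule eq_matI) (auto simp: cadj_def)

lemma cadj_one [simp]: "cadj (1\<^sub>m d) = 1\<^sub>m d"
  by (rule eq_matI) (auto simp: cadj_def)

text \<open>Since E equals its adjoint times itself, the quadratic form at v is the squared norm of
  \<open>E *\<^sub>v v\<close>.\<close>

lemma hermitian_idempotent_psd:
  assumes E: "E \<in> carrier_mat d d" and herm: "cadj E = E" and idem: "E * E = E"
  shows "psd_mat E"
proof -
  have "0 \<le> Re (\<Sum>i<d. cnj (v $ i) * (E *\<^sub>v v) $ i)" if v: "v \<in> carrier_vec d" for v
  proof -
    have Ev: "(E *\<^sub>v v) $ i = (\<Sum>j<d. E $$ (i, j) * v $ j)" if "i < d" for i
      using that E v by (auto simp: scalar_prod_def atLeast0LessThan)
    have herm': "E $$ (i, k) = cnj (E $$ (k, i))" if "i < d" "k < d" for i k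
      using cadj_index[OF E, of i k] herm that by simp
    have EE: "E $$ (i, j) = (\<Sum>k<d. cnj (E $$ (k, i)) * E $$ (k, j))" if "i < d" "j < d" for i j
    proof -
      have "E $$ (i, j) = (\<Sum>k<d. E $$ (i, k) * E $$ (k, j))"
        using mat_mult_index[OF E E that] by (simp only: idem)
      also have "\<dots> = (\<Sum>k<d. cnj (E $$ (k, i)) * E $$ (k, j))"
        using herm'[OF that(1)] by (intro sum.cong refl) (metis lessThan_iff)
      finally show ?thesis .
    qed
    have "(\<Sum>i<d. cnj (v $ i) * (E *\<^sub>v v) $ i)
        = (\<Sum>i<d. \<Sum>j<d. \<Sum>k<d. cnj (v $ i) * cnj (E $$ (k, i)) * (E $$ (k, j) * v $ j))"
    proof (intro sum.cong refl)
      fix i assume i: "i \<in> {..<d}"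
      have "(\<Sum>j<d. E $$ (i, j) * v $ j) = (\<Sum>j<d. \<Sum>k<d. cnj (E $$ (k, i)) * (E $$ (k, j) * v $ j))"
      proof (intro sum.cong refl)
        fix j assume "j \<in> {..<d}"
        with i have "E $$ (i, j) = (\<Sum>k<d. cnj (E $$ (k, i)) * E $$ (k, j))" by (intro EE) auto
        then show "E $$ (i, j) * v $ j = (\<Sum>k<d. cnj (E $$ (k, i)) * (E $$ (k, j) * v $ j))"
          by (simp only: sum_distrib_right mult.assoc)
      qed
      with i Ev[of i] show "cnj (v $ i) * (E *\<^sub>v v) $ i
          = (\<Sum>j<d. \<Sum>k<d. cnj (v $ i) * cnj (E $$ (k, i)) * (E $$ (k, j) * v $ j))"
        by (simp only: sum_distrib_left mult.assoc lessThan_iff)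
    qed
    also have "\<dots> = (\<Sum>i<d. \<Sum>k<d. \<Sum>j<d. cnj (v $ i) * cnj (E $$ (k, i)) * (E $$ (k, j) * v $ j))"
      by (intro sum.cong refl sum.swap)
    also have "\<dots> = (\<Sum>k<d. \<Sum>i<d. \<Sum>j<d. cnj (v $ i) * cnj (E $$ (k, i)) * (E $$ (k, j) * v $ j))"
      by (rule sum.swap)
    also have "\<dots> = (\<Sum>k<d. cnj ((E *\<^sub>v v) $ k) * (E *\<^sub>v v) $ k)"
    proof (intro sum.cong refl)
      fix k assume "k \<in> {..<d}"
      then have "cnj ((E *\<^sub>v v) $ k) * (E *\<^sub>v v) $ k
          = (\<Sum>i<d. \<Sum>j<d. cnj (E $$ (k, i) * v $ i) * (E $$ (k, j) * v $ j))"
        using Ev[of k] by (simp only: lessThan_iff cnj_sum sum_product)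
      also have "\<dots> = (\<Sum>i<d. \<Sum>j<d. cnj (v $ i) * cnj (E $$ (k, i)) * (E $$ (k, j) * v $ j))"
        by (intro sum.cong refl) (simp only: complex_cnj_mult mult_ac)
      finally show "(\<Sum>i<d. \<Sum>j<d. cnj (v $ i) * cnj (E $$ (k, i)) * (E $$ (k, j) * v $ j))
          = cnj ((E *\<^sub>v v) $ k) * (E *\<^sub>v v) $ k" by simp
    qed
    also have "\<dots> = (\<Sum>k<d. of_real ((cmod ((E *\<^sub>v v) $ k))\<^sup>2))"
      by (intro sum.cong refl) (metis complex_norm_square mult.commute)
    finally have "Re (\<Sum>i<d. cnj (v $ i) * (E *\<^sub>v v) $ i) = (\<Sum>k<d. (cmod ((E *\<^sub>v v) $ k))\<^sup>2)"
      by (simp only: Re_sum Re_complex_of_real)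
    then show ?thesis by (simp only: sum_nonneg zero_le_power2)
  qed
  then show ?thesis
    using E herm by (auto simp: psd_mat_def hermitian_mat_def)
qed

section \<open>Ordered products of square matrices\<close>

definition mprod :: "nat \<Rightarrow> complex mat list \<Rightarrow> complex mat" where
  "mprod d As = foldr times As (1\<^sub>m d)"

lemma mprod_simps [simp]: "mprod d [] = 1\<^sub>m d" "mprod d (A # As) = A * mprod d As"
  by (simp_all add: mprod_def)

lemma foldr_eq_mprod: "foldr (\<lambda>j B. f j * B) js (1\<^sub>m d) = mprod d (map f js)"
  by (induction js) auto

lemma mprod_carrier [simp]: "set As \<subseteq> carrier_mat d d \<Longrightarrow> mprod d As \<in> carrier_mat d d"
  by (induction As) auto

lemma mprod_append:
  assumes "set As \<subseteq> carrier_mat d d" "set Bs \<subseteq> carrier_mat d d"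
  shows "mprod d (As @ Bs) = mprod d As * mprod d Bs"
  using assms
proof (induction As)
  case (Cons A As)
  then show ?case
    using assoc_mult_mat[of A d d "mprod d As" d "mprod d Bs" d] by simp
qed (simp add: left_mult_one_mat[where nc = d])

lemma smult_smult_mat: "a \<cdot>\<^sub>m (b \<cdot>\<^sub>m A) = (a * b :: 'a :: semigroup_mult) \<cdot>\<^sub>m A"
  by (rule eq_matI) (auto simp: mult.assoc)

lemma mprod_smult:
  assumes "\<And>j. j \<in> set js \<Longrightarrow> A j \<in> carrier_mat d d"
  shows "mprod d (map (\<lambda>j. c j \<cdot>\<^sub>m A j) js) = (\<Prod>j\<leftarrow>js. c j) \<cdot>\<^sub>m mprod d (map A js)"
  using assms
proof (induction js)
  case (Cons j js)
  have "mprod d (map A js) \<in> carrier_mat d d" "A j \<in> carrier_mat d d"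
    using Cons.prems by (auto intro!: mprod_carrier)
  then show ?case
    using Cons by (simp add: mult_smult_assoc_mat[where nr = d and n = d and nc = d]
        mult_smult_distrib[where nr = d and n = d and nc = d] smult_smult_mat mult.commute)
qed (auto intro: eq_matI)

text \<open>Sign vectors take the default value 1 beyond their length, so the shorter ones are
  literally half of the longer ones. Flipping the last sign gives the other half, and sums over q
  can be treated one sign at a time.\<close>

lemma signvecs_iff_Suc: "q \<in> signvecs m \<longleftrightarrow> q \<in> signvecs (Suc m) \<and> q m = 1"
proof
  assume q: "q \<in> signvecs (Suc m) \<and> q m = 1"
  have "q j = 1" if "m \<le> j" for j
    using that q by (cases "j = m") (auto simp: signvecs_def)
  with q show "q \<in> signvecs m" by (auto simp: signvecs_def)
next
  assume q: "q \<in> signvecs m"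
  have "q j = 1 \<or> q j = -1" if "j < Suc m" for j
    using that q by (cases "j = m") (auto simp: signvecs_def)
  with q show "q \<in> signvecs (Suc m) \<and> q m = 1" by (auto simp: signvecs_def)
qed

lemma signvecs_Suc: "signvecs (Suc m) = signvecs m \<union> (\<lambda>q. q(m := -1)) ` signvecs m"
proof (intro equalityI subsetI)
  fix q assume q: "q \<in> signvecs (Suc m)"
  show "q \<in> signvecs m \<union> (\<lambda>q. q(m := -1)) ` signvecs m"
  proof (cases "q m = 1")
    case True
    then show ?thesis using q signvecs_iff_Suc by blast
  next
    case False
    then have "q m = -1" using q by (auto simp: signvecs_def)
    then have "q = (q(m := 1))(m := -1)" by auto
    moreover have "q(m := 1) \<in> signvecs m"
      unfolding signvecs_iff_Suc[of _ m] using q by (auto simp: signvecs_def)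
    ultimately show ?thesis by blast
  qed
next
  fix q assume "q \<in> signvecs m \<union> (\<lambda>q. q(m := -1)) ` signvecs m"
  then obtain q' where "q' \<in> signvecs m" "q = q' \<or> q = q'(m := -1)" by blast
  then show "q \<in> signvecs (Suc m)"
    unfolding signvecs_iff_Suc[of _ m] by (auto simp: signvecs_def less_Suc_eq)
qed

lemma signvecs_0: "signvecs 0 = {\<lambda>_. 1}"
  by (auto simp: signvecs_def)

lemma finite_signvecs [simp]: "finite (signvecs m)"
  by (induction m) (simp_all add: signvecs_0 signvecs_Suc)

lemma sum_signvecs_Suc:
  fixes f :: "(nat \<Rightarrow> int) \<Rightarrow> complex"
  shows "(\<Sum>q\<in>signvecs (Suc m). f q) = (\<Sum>q\<in>signvecs m. f (q(m := 1)) + f (q(m := -1)))"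
proof -
  have upd: "q(m := 1) = q" if "q \<in> signvecs m" for q
    using that by (auto simp: signvecs_def)
  have "inj_on (\<lambda>q. q(m := -1 :: int)) (signvecs m)"
  proof (rule inj_onI)
    fix q q' assume "q \<in> signvecs m" "q' \<in> signvecs m" "q(m := -1) = q'(m := -1)"
    then show "q = q'" by (metis upd fun_upd_upd)
  qed
  moreover have "signvecs m \<inter> (\<lambda>q. q(m := -1)) ` signvecs m = {}"
  proof -
    have False if "q \<in> signvecs m" "q(m := -1) \<in> signvecs m" for q
      using that(2) signvecs_iff_Suc[of "q(m := -1)" m] by simp
    then show ?thesis by blast
  qed
  ultimately show ?thesis
    by (simp add: signvecs_Suc sum.union_disjoint sum.reindex sum.distrib upd)
qed

section \<open>Products of Majorana operators\<close>

lemma one_smult_mat: "(1 :: 'a :: monoid_mult) \<cdot>\<^sub>m A = A"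
  by (rule eq_matI) auto

lemma sq_assoc: "A \<in> carrier_mat d d \<Longrightarrow> B \<in> carrier_mat d d \<Longrightarrow> C \<in> carrier_mat d d \<Longrightarrow>
    A * B * C = A * (B * C)"
  by (rule assoc_mult_mat)

lemma sq_mult: "A \<in> carrier_mat d d \<Longrightarrow> B \<in> carrier_mat d d \<Longrightarrow> A * B \<in> carrier_mat d d"
  by (rule mult_carrier_mat)

lemma sq_smult_left: "A \<in> carrier_mat d d \<Longrightarrow> B \<in> carrier_mat d d \<Longrightarrow>
    (k \<cdot>\<^sub>m A) * B = (k :: 'a :: comm_semiring_0) \<cdot>\<^sub>m (A * B)"
  by (rule mult_smult_assoc_mat)

lemma sq_smult_right: "A \<in> carrier_mat d d \<Longrightarrow> B \<in> carrier_mat d d \<Longrightarrow>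
    A * (k \<cdot>\<^sub>m B) = (k :: 'a :: comm_semiring_0) \<cdot>\<^sub>m (A * B)"
  by (rule mult_smult_distrib)

section \<open>Commutation up to a scalar\<close>

definition scomm :: "complex \<Rightarrow> complex mat \<Rightarrow> complex mat \<Rightarrow> bool" where
  "scomm s A C \<longleftrightarrow> A * C = s \<cdot>\<^sub>m (C * A)"

text \<open>Moving C past a product costs one scalar per factor, so for anticommuting factors only
  the parity of their number matters.\<close>

lemma scomm_mult:
  assumes "scomm s A C" "scomm t B C"
    and [simp]: "A \<in> carrier_mat d d" "B \<in> carrier_mat d d" "C \<in> carrier_mat d d"
  shows "scomm (s * t) (A * B) C"
proof -
  note [simp] = sq_mult[where d = d]
  have "(A * B) * C = A * (B * C)" by (rule sq_assoc[where d = d]) fact+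
  also have "\<dots> = t \<cdot>\<^sub>m (A * (C * B))"
    using assms(2) by (simp add: scomm_def sq_smult_right[where d = d])
  also have "A * (C * B) = (A * C) * B" by (rule sq_assoc[where d = d, symmetric]) fact+
  also have "\<dots> = s \<cdot>\<^sub>m ((C * A) * B)"
    using assms(1) by (simp add: scomm_def sq_smult_left[where d = d] del: assoc_mult_mat)
  also have "(C * A) * B = C * (A * B)" by (rule sq_assoc[where d = d]) fact+
  finally show ?thesis by (simp add: scomm_def smult_smult_mat mult.commute)
qed

lemma scomm_mprod:
  assumes "\<And>A. A \<in> set As \<Longrightarrow> A \<in> carrier_mat d d \<and> scomm s A C" and C: "C \<in> carrier_mat d d"
  shows "scomm (s ^ length As) (mprod d As) C"
  using assms(1)
proof (induction As)
  case Nil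
  then show ?case
    using C by (auto simp: scomm_def intro!: eq_matI)
next
  case (Cons A As)
  then show ?case
    using C by (auto intro!: scomm_mult mprod_carrier)
qed

text \<open>A locale because it is used for two families: the given operators and, by
  interpretation, their rotated and sign-twisted images. The pair involutions and projectors are
  developed once and then applied to the latter.\<close>

locale majorana_system =
  fixes n :: nat and \<gamma> :: "nat \<Rightarrow> complex mat"
  assumes majorana: "majorana n \<gamma>"
begin

abbreviation dim :: nat where "dim \<equiv> 2 ^ n"

abbreviation gprod :: "nat list \<Rightarrow> complex mat" where
  "gprod xs \<equiv> mprod dim (map \<gamma> xs)"

lemma carrier: "j < 2 * n \<Longrightarrow> \<gamma> j \<in> carrier_mat dim dim"
  using majorana by (simp add: majorana_def)

lemma gprod_carrier: "set xs \<subseteq> {0..<2 * n} \<Longrightarrow> gprod xs \<in> carrier_mat dim dim"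
  using carrier by (intro mprod_carrier) auto

lemma herm: "j < 2 * n \<Longrightarrow> cadj (\<gamma> j) = \<gamma> j"
  using majorana by (simp add: majorana_def hermitian_mat_def)

lemma anticomm: "a < 2 * n \<Longrightarrow> b < 2 * n \<Longrightarrow>
    \<gamma> a * \<gamma> b + \<gamma> b * \<gamma> a = (if a = b then 2 \<cdot>\<^sub>m 1\<^sub>m dim else 0\<^sub>m dim dim)"
  using majorana unfolding majorana_def by blast

lemma square: 
  assumes a: "a < 2 * n" shows "\<gamma> a * \<gamma> a = 1\<^sub>m dim"
proof (rule eq_matI)
  fix i j assume "i < dim_row (1\<^sub>m dim :: complex mat)" "j < dim_col (1\<^sub>m dim :: complex mat)"
  then have ij: "i < dim" "j < dim" by auto
  have c: "\<gamma> a * \<gamma> a \<in> carrier_mat dim dim" using carrier[OF a] by simp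
  have "(\<gamma> a * \<gamma> a + \<gamma> a * \<gamma> a) $$ (i, j) = (2 \<cdot>\<^sub>m 1\<^sub>m dim) $$ (i, j)"
    using anticomm[OF a a] by simp
  then have "2 * (\<gamma> a * \<gamma> a) $$ (i, j) = 2 * (1\<^sub>m dim :: complex mat) $$ (i, j)"
    using ij c by (simp only: index_add_mat index_smult_mat carrier_matD index_one_mat) auto
  then show "(\<gamma> a * \<gamma> a) $$ (i, j) = 1\<^sub>m dim $$ (i, j)" by simp
qed (use carrier[OF a] in auto)

lemma scomm_gamma:
  assumes "a < 2 * n" "b < 2 * n" "a \<noteq> b"
  shows "scomm (-1) (\<gamma> a) (\<gamma> b)"
  unfolding scomm_def
proof (rule eq_matI)
  have c: "\<gamma> a * \<gamma> b \<in> carrier_mat dim dim" "\<gamma> b * \<gamma> a \<in> carrier_mat dim dim"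
    using carrier assms by (auto intro!: sq_mult)
  fix i j assume "i < dim_row (-1 \<cdot>\<^sub>m (\<gamma> b * \<gamma> a))" "j < dim_col (-1 \<cdot>\<^sub>m (\<gamma> b * \<gamma> a))"
  then have ij: "i < dim" "j < dim" using carrier[OF assms(1)] carrier[OF assms(2)] by auto
  have "(\<gamma> a * \<gamma> b + \<gamma> b * \<gamma> a) $$ (i, j) = 0"
    using anticomm[OF assms(1,2)] assms(3) ij by simp
  then show "(\<gamma> a * \<gamma> b) $$ (i, j) = (-1 \<cdot>\<^sub>m (\<gamma> b * \<gamma> a)) $$ (i, j)"
    using ij c by (simp only: index_add_mat index_smult_mat carrier_matD) (simp add: add_eq_0_iff)
qed (use carrier[OF assms(1)] carrier[OF assms(2)] in auto)

lemma scomm_gprod: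
  assumes "set zs \<subseteq> {0..<2 * n}" "x < 2 * n" "x \<notin> set zs"
  shows "scomm ((-1) ^ length zs) (gprod zs) (\<gamma> x)"
proof -
  have "A \<in> carrier_mat dim dim \<and> scomm (-1) A (\<gamma> x)" if A: "A \<in> set (map \<gamma> zs)" for A
  proof -
    obtain z where z: "z \<in> set zs" "A = \<gamma> z" using A by auto
    moreover have "z < 2 * n" "z \<noteq> x" using z assms by auto
    ultimately show ?thesis using carrier scomm_gamma assms(2) by simp
  qed
  from scomm_mprod[of "map \<gamma> zs" dim "-1" "\<gamma> x", OF this carrier[OF assms(2)]]
  show ?thesis by simp
qed

lemma gprod_append:
  assumes "set xs \<subseteq> {0..<2 * n}" "set ys \<subseteq> {0..<2 * n}"
  shows "gprod (xs @ ys) = gprod xs * gprod ys"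
  using assms carrier by (subst map_append, intro mprod_append) auto

text \<open>Exchanging x and y makes each of them cross \<open>zs\<close> once, with equal signs
  that cancel; what survives is the single sign from x crossing y.\<close>

lemma gprod_swap:
  assumes d: "distinct (ys @ x # zs @ y # ws)" and sub: "set (ys @ x # zs @ y # ws) \<subseteq> {0..<2 * n}"
  shows "gprod (ys @ x # zs @ y # ws) = (-1) \<cdot>\<^sub>m gprod (ys @ y # zs @ x # ws)"
proof -
  note [simp] = sq_mult[where d = dim] and [simp del] = assoc_mult_mat
  note L = sq_smult_left[where d = dim] and Rt = sq_smult_right[where d = dim]
    and assoc = sq_assoc[where d = dim]
  let ?Z = "gprod zs" and ?W = "gprod ws" and ?Y = "gprod ys"
  have c [simp]: "\<gamma> x \<in> carrier_mat dim dim" "\<gamma> y \<in> carrier_mat dim dim" "?Z \<in> carrier_mat dim dim"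
    "?W \<in> carrier_mat dim dim" "?Y \<in> carrier_mat dim dim"
    using sub carrier by (auto intro!: gprod_carrier)
  have s: "(-1 :: complex) ^ length zs * (-1) ^ length zs = 1"
    by (simp flip: power_mult_distrib)
  have e: "(-1) ^ length zs * ((-1) * (-1) ^ length zs) = (-1 :: complex)"
    by (cases "even (length zs)") simp_all
  have zx: "?Z * \<gamma> x = (-1) ^ length zs \<cdot>\<^sub>m (\<gamma> x * ?Z)" and zy: "?Z * \<gamma> y = (-1) ^ length zs \<cdot>\<^sub>m (\<gamma> y * ?Z)"
    using scomm_gprod[of zs x] scomm_gprod[of zs y] d sub by (auto simp: scomm_def)
  have xy: "\<gamma> x * \<gamma> y = (-1) \<cdot>\<^sub>m (\<gamma> y * \<gamma> x)"
    using scomm_gamma[of x y] d sub by (auto simp: scomm_def)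
  have "\<gamma> x * (?Z * \<gamma> y) = (-1) ^ length zs \<cdot>\<^sub>m (\<gamma> x * (\<gamma> y * ?Z))"
    by (simp add: zy Rt)
  also have "\<gamma> x * (\<gamma> y * ?Z) = (-1) \<cdot>\<^sub>m (\<gamma> y * (\<gamma> x * ?Z))"
  proof -
    have "\<gamma> x * (\<gamma> y * ?Z) = (\<gamma> x * \<gamma> y) * ?Z" by (rule assoc[symmetric]) simp_all
    also have "\<dots> = (-1) \<cdot>\<^sub>m ((\<gamma> y * \<gamma> x) * ?Z)" unfolding xy by (rule L) simp_all
    also have "(\<gamma> y * \<gamma> x) * ?Z = \<gamma> y * (\<gamma> x * ?Z)" by (rule assoc) simp_all
    finally show ?thesis .
  qed
  also have "\<gamma> x * ?Z = (-1) ^ length zs \<cdot>\<^sub>m (?Z * \<gamma> x)"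
    by (simp only: zx smult_smult_mat s one_smult_mat)
  also have "\<gamma> y * ((-1) ^ length zs \<cdot>\<^sub>m (?Z * \<gamma> x)) = (-1) ^ length zs \<cdot>\<^sub>m (\<gamma> y * (?Z * \<gamma> x))"
    by (rule Rt) simp_all
  finally have "\<gamma> x * (?Z * \<gamma> y)
      = ((-1) ^ length zs * ((-1) * (-1) ^ length zs)) \<cdot>\<^sub>m (\<gamma> y * (?Z * \<gamma> x))"
    by (simp only: smult_smult_mat)
  then have swap: "\<gamma> x * (?Z * \<gamma> y) = (-1) \<cdot>\<^sub>m (\<gamma> y * (?Z * \<gamma> x))"
    by (simp only: e)
  have mid: "gprod (ys @ a # zs @ b # ws) = ?Y * ((\<gamma> a * (?Z * \<gamma> b)) * ?W)"
    if "a < 2 * n" "b < 2 * n" for a b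
  proof -
    have [simp]: "\<gamma> a \<in> carrier_mat dim dim" "\<gamma> b \<in> carrier_mat dim dim"
      using that carrier by simp_all
    have "gprod (zs @ b # ws) = ?Z * (\<gamma> b * ?W)"
      using sub that by (subst gprod_append) auto
    moreover have "gprod (ys @ a # zs @ b # ws) = ?Y * (\<gamma> a * gprod (zs @ b # ws))"
      using sub that by (subst gprod_append) auto
    ultimately show ?thesis by (simp add: assoc)
  qed
  have xy2: "x < 2 * n" "y < 2 * n" using sub by auto
  have "gprod (ys @ x # zs @ y # ws) = ?Y * ((-1 \<cdot>\<^sub>m (\<gamma> y * (?Z * \<gamma> x))) * ?W)"
    using mid[OF xy2] by (simp only: swap)
  also have "(-1 \<cdot>\<^sub>m (\<gamma> y * (?Z * \<gamma> x))) * ?W = -1 \<cdot>\<^sub>m ((\<gamma> y * (?Z * \<gamma> x)) * ?W)"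
    by (rule L) simp_all
  also have "?Y * \<dots> = -1 \<cdot>\<^sub>m (?Y * ((\<gamma> y * (?Z * \<gamma> x)) * ?W))"
    by (rule Rt) simp_all
  finally show ?thesis by (simp only: mid[OF xy2(2,1)])
qed

text \<open>Transpositions generate all permutations, and each costs one sign by
  \<open>gprod_swap\<close>. This antisymmetry is what later turns a sum over assignments of columns
  to rows into a determinant.\<close>

lemma gprod_permute:
  assumes p: "p permutes {..<length xs}" and "distinct xs" "set xs \<subseteq> {0..<2 * n}"
  shows "gprod (permute_list p xs) = of_int (sign p) \<cdot>\<^sub>m gprod xs"
proof -
  define m where "m = length xs"
  have tr: "gprod (permute_list (Transposition.transpose a b) xs) = (-1) \<cdot>\<^sub>m gprod xs"
    if ab: "a < b" "b < length xs" and d: "distinct xs" "set xs \<subseteq> {0..<2 * n}" for a b xs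
  proof -
    define ys zs ws where "ys = take a xs" and "zs = take (b - Suc a) (drop (Suc a) xs)"
      and "ws = drop (Suc b) xs"
    have "xs = ys @ xs ! a # drop (Suc a) xs"
      unfolding ys_def by (rule id_take_nth_drop) (use ab in simp)
    moreover have "drop (Suc a) xs = zs @ drop (Suc a) xs ! (b - Suc a) # drop (Suc (b - Suc a)) (drop (Suc a) xs)"
      unfolding zs_def by (rule id_take_nth_drop) (use ab in simp)
    moreover have "drop (Suc a) xs ! (b - Suc a) = xs ! b" "drop (Suc (b - Suc a)) (drop (Suc a) xs) = ws"
      using ab by (simp_all add: ws_def)
    ultimately have xs: "xs = ys @ xs ! a # zs @ xs ! b # ws" by metis
    have len: "length ys = a" "length zs = b - Suc a" using ab by (auto simp: ys_def zs_def)
    have tperm: "Transposition.transpose a b permutes {..<length xs}"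
      using ab by (intro permutes_swap_id) auto
    have perm: "permute_list (Transposition.transpose a b) xs = ys @ xs ! b # zs @ xs ! a # ws"
    proof (rule nth_equalityI)
      show "length (permute_list (Transposition.transpose a b) xs) = length (ys @ xs ! b # zs @ xs ! a # ws)"
        using arg_cong[OF xs, of length] by simp
      fix i assume "i < length (permute_list (Transposition.transpose a b) xs)"
      then have i: "i < length xs" by simp
      have "permute_list (Transposition.transpose a b) xs ! i = xs ! Transposition.transpose a b i"
        by (rule permute_list_nth[OF tperm i])
      also have "\<dots> = (ys @ xs ! b # zs @ xs ! a # ws) ! i"
      proof (cases "i = a \<or> i = b")
        case True
        then show ?thesis
          using ab len by (auto simp: nth_append)
      next
        case False
        then have "xs ! Transposition.transpose a b i = (ys @ xs ! a # zs @ xs ! b # ws) ! i"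
          using arg_cong[OF xs, of "\<lambda>l. l ! i"] transpose_apply_other[of i a b] by metis
        also have "\<dots> = (ys @ xs ! b # zs @ xs ! a # ws) ! i"
          using False ab len by (cases "i < a"; cases "i < b") (auto simp: nth_append nth_Cons')
        finally show ?thesis .
      qed
      finally show "permute_list (Transposition.transpose a b) xs ! i = (ys @ xs ! b # zs @ xs ! a # ws) ! i" .
    qed
    have *: "distinct (ys @ xs ! b # zs @ xs ! a # ws)" "set (ys @ xs ! b # zs @ xs ! a # ws) \<subseteq> {0..<2 * n}"
      using d distinct_permute_list[OF tperm] set_permute_list[OF tperm] perm by simp_all
    show ?thesis
      by (simp only: perm gprod_swap[OF *] xs[symmetric])
  qed
  \<comment> \<open>The list is quantified inside the induction: the transposition is applied to the
    list first, and the induction hypothesis is needed for the list so obtained.\<close>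
  have "\<forall>xs. length xs = m \<longrightarrow> distinct xs \<longrightarrow> set xs \<subseteq> {0..<2 * n} \<longrightarrow>
      gprod (permute_list p xs) = of_int (sign p) \<cdot>\<^sub>m gprod xs"
    using p[folded m_def] finite_lessThan
  proof (induction p rule: permutes_induct)
    case id
    then show ?case by (auto intro!: eq_matI)
  next
    case (swap a b p)
    show ?case
    proof (intro allI impI)
      fix xs :: "nat list" assume xs: "length xs = m" "distinct xs" "set xs \<subseteq> {0..<2 * n}"
      let ?t = "Transposition.transpose a b"
      have t: "?t permutes {..<length xs}"
        using swap xs by (intro permutes_swap_id) auto
      have "gprod (permute_list (?t \<circ> p) xs) = gprod (permute_list p (permute_list ?t xs))"
        using swap xs by (simp add: permute_list_compose)
      also have "\<dots> = of_int (sign p) \<cdot>\<^sub>m gprod (permute_list ?t xs)"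
        using swap.IH xs distinct_permute_list[OF t] set_permute_list[OF t] by simp
      also have "gprod (permute_list ?t xs) = (-1) \<cdot>\<^sub>m gprod xs"
      proof (cases "a < b")
        case True
        then show ?thesis using tr[of a b xs] swap.hyps xs by simp
      next
        case False
        with swap.hyps have "b < a" by simp
        then show ?thesis
          using tr[of b a xs] swap.hyps xs by (simp add: transpose_commute[of a b])
      qed
      finally have g: "gprod (permute_list (?t \<circ> p) xs) = of_int (sign p) \<cdot>\<^sub>m ((-1) \<cdot>\<^sub>m gprod xs)" .
      have "sign (?t \<circ> p) = - sign p"
        using swap.hyps permutes_imp_permutation[OF finite_lessThan swap.hyps(4)]
        by (simp add: sign_compose permutation_swap_id sign_swap_id)
      then have "of_int (sign p) \<cdot>\<^sub>m ((-1) \<cdot>\<^sub>m gprod xs) = of_int (sign (?t \<circ> p)) \<cdot>\<^sub>m gprod xs"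
        by (simp add: smult_smult_mat)
      with g show "gprod (permute_list (?t \<circ> p) xs) = of_int (sign (?t \<circ> p)) \<cdot>\<^sub>m gprod xs"
        by (simp only:)
    qed
  qed
  with assms show ?thesis by (simp add: m_def)
qed

end

section \<open>Minors and sign characters\<close>

text \<open>\<open>submatrix\<close> addresses its rows and columns through \<open>pick\<close>,
  whereas \<open>gammaS\<close> orders its factors by \<open>sorted_list_of_set\<close>. The two
  orders must agree for the signs of minors and of operator products to match.\<close>

lemma sorted_list_of_set_eq_pick:
  assumes "finite S"
  shows "sorted_list_of_set S = map (pick S) [0..<card S]"
proof (rule sorted_distinct_set_unique)
  have mono: "pick S i < pick S j" if "i < j" "j < card S" for i j
    using that pick_mono by blast
  then have inj: "inj_on (pick S) {0..<card S}"
    by (intro linorder_inj_onI) (auto dest: less_imp_neq)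
  show "sorted (map (pick S) [0..<card S])"
  proof -
    have "pick S i \<le> pick S j" if "i \<le> j" "j < card S" for i j
      using mono[of i j] that by (cases "i = j") auto
    then show ?thesis by (simp add: sorted_iff_nth_mono)
  qed
  show "distinct (map (pick S) [0..<card S])"
    using inj by (simp add: distinct_map)
  have "pick S ` {0..<card S} \<subseteq> S"
    using pick_in_set by auto
  then show "set (sorted_list_of_set S) = set (map (pick S) [0..<card S])"
    using card_image[OF inj] assms card_subset_eq[of S "pick S ` {0..<card S}"] by simp
qed (use assms in auto)

lemma pick_eq_nth: "finite S \<Longrightarrow> i < card S \<Longrightarrow> pick S i = sorted_list_of_set S ! i"
  by (simp add: sorted_list_of_set_eq_pick)

lemma submatrix_carrier:
  assumes "A \<in> carrier_mat d e" "R \<subseteq> {0..<d}" "S \<subseteq> {0..<e}"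
  shows "submatrix A R S \<in> carrier_mat (card R) (card S)"
proof -
  have "{i. i < d \<and> i \<in> R} = R" "{j. j < e \<and> j \<in> S} = S" using assms by auto
  then show ?thesis
    by (intro carrier_matI) (simp_all only: dim_submatrix carrier_matD[OF assms(1)])
qed

lemma submatrix_nth:
  assumes "A \<in> carrier_mat d e" "R \<subseteq> {0..<d}" "S \<subseteq> {0..<e}" "i < card R" "j < card S"
  shows "submatrix A R S $$ (i, j) = A $$ (sorted_list_of_set R ! i, sorted_list_of_set S ! j)"
proof -
  have "{i. i < d \<and> i \<in> R} = R" "{j. j < e \<and> j \<in> S} = S" using assms by auto
  moreover have "finite R" "finite S"
    using assms(2,3) by (auto intro: finite_subset)
  ultimately show ?thesis
    using submatrix_index[of i A R j S] assms(4,5) carrier_matD[OF assms(1)]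
    by (simp only: pick_eq_nth)
qed

lemma minor_eq_sum_permutes:
  assumes "A \<in> carrier_mat d d" "R \<subseteq> {0..<d}" "S \<subseteq> {0..<d}" "card S = card R"
  shows "minor A R S = (\<Sum>p | p permutes {..<card R}. of_int (sign p) *
           (\<Prod>i<card R. A $$ (sorted_list_of_set R ! i, sorted_list_of_set S ! p i)))"
proof -
  have c: "submatrix A R S \<in> carrier_mat (card R) (card R)"
    using submatrix_carrier[OF assms(1-3)] assms(4) by simp
  have "(\<Prod>i<card R. submatrix A R S $$ (i, p i))
      = (\<Prod>i<card R. A $$ (sorted_list_of_set R ! i, sorted_list_of_set S ! p i))"
    if "p permutes {..<card R}" for p
    using that assms permutes_in_image[OF that] by (intro prod.cong refl submatrix_nth) auto
  then show ?thesis
    unfolding minor_def det_def'[OF c] atLeast0LessThan by (intro sum.cong refl) auto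
qed

text \<open>A list as long as \<open>ys\<close> with the same set of entries cannot repeat any of
  them, so it is a rearrangement. This converts sums over lists of columns into the permutation sum
  of the Leibniz formula.\<close>

lemma bij_betw_permute_list:
  assumes "distinct ys" "length ys = m"
  shows "bij_betw (\<lambda>p. permute_list p ys) {p. p permutes {..<m}} {xs. length xs = m \<and> set xs = set ys}"
  unfolding bij_betw_def
proof
  show "inj_on (\<lambda>p. permute_list p ys) {p. p permutes {..<m}}"
  proof (rule inj_onI, rule ext)
    fix p q i
    assume pq: "p \<in> {p. p permutes {..<m}}" "q \<in> {p. p permutes {..<m}}"
      and eq: "permute_list p ys = permute_list q ys"
    show "p i = q i"
    proof (cases "i < m")
      case True
      then have "ys ! p i = ys ! q i"
        using arg_cong[OF eq, of "\<lambda>l. l ! i"] pq assms by (simp add: permute_list_nth)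
      moreover have "p i < m" "q i < m"
        using True pq permutes_in_image[of _ "{..<m}" i] by auto
      ultimately show ?thesis using assms by (simp add: nth_eq_iff_index_eq)
    next
      case False
      then show ?thesis
        using pq permutes_not_in[of p "{..<m}" i] permutes_not_in[of q "{..<m}" i] by simp
    qed
  qed
  show "(\<lambda>p. permute_list p ys) ` {p. p permutes {..<m}} = {xs. length xs = m \<and> set xs = set ys}"
  proof (intro equalityI subsetI)
    fix xs assume "xs \<in> {xs. length xs = m \<and> set xs = set ys}"
    then have xs: "length xs = m" "set xs = set ys" by auto
    then have "distinct xs"
      using assms by (metis card_distinct distinct_card)
    then have "mset xs = mset ys"
      using xs assms set_eq_iff_mset_eq_distinct by blast
    then show "xs \<in> (\<lambda>p. permute_list p ys) ` {p. p permutes {..<m}}"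
      using assms by (metis (mono_tags, lifting) imageI mem_Collect_eq mset_eq_permutation)
  qed (use assms set_permute_list in auto)
qed

text \<open>The contribution of one index to \<open>xsign\<close>, without the sign (-1)^|X| that
  each index also carries there; the latter cancels over an even number of indices.\<close>

definition chi :: "nat set \<Rightarrow> nat \<Rightarrow> real" where
  "chi X a = (if a \<in> X then -1 else 1)"

lemma xsign_eq_prod_chi:
  assumes "finite S" "even (card S)" "finite X"
  shows "xsign X S = (\<Prod>a\<in>S. chi X a)"
proof -
  \<comment> \<open>The exponent in \<open>xsign\<close> is a truncated subtraction; this bound
    makes its parity the sum of the parities of the two terms.\<close>
  have le: "card (S \<inter> X) \<le> card X * card S"
  proof (cases "S = {}")
    case False
    have "card (S \<inter> X) \<le> card X" using assms by (simp add: card_mono)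
    also have "\<dots> \<le> card X * card S" using False assms by (simp add: card_gt_0_iff Suc_leI)
    finally show ?thesis .
  qed simp
  have "xsign X S = (-1) ^ card (S \<inter> X)"
    using le assms(2) by (auto simp: xsign_def minus_one_power_iff)
  also have "\<dots> = (\<Prod>a\<in>S \<inter> X. chi X a)"
    by (simp add: chi_def)
  also have "\<dots> = (\<Prod>a\<in>S. chi X a)"
    using assms by (intro prod.mono_neutral_left) (auto simp: chi_def)
  finally show ?thesis .
qed

lemma xsign_cases: "xsign X S = 1 \<or> xsign X S = -1"
  by (auto simp: xsign_def minus_one_power_iff)

lemma chi_flip:
  "chi (if a \<in> X then X - {a} else insert a X) b = (if b = a then - chi X b else chi X b)"
  by (cases "a \<in> X"; cases "b = a") (simp_all add: chi_def)

text \<open>A list with as many entries as S has elements, but not exhausting S, misses some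
  element of S; toggling that element in X flips the sign of the summand.\<close>
lemma sum_chi_list:
  assumes "finite U" "S \<subseteq> U" "length xs = card S"
  shows "(\<Sum>X\<in>Pow U. (\<Prod>a\<in>S. chi X a) * (\<Prod>x\<leftarrow>xs. chi X x)) = (if set xs = S then 2 ^ card U else 0)"
proof (cases "set xs = S")
  case True
  have fin: "finite S" using assms finite_subset by blast
  have d: "distinct xs" using True assms by (simp add: card_distinct)
  have "(\<Prod>a\<in>S. chi X a) * (\<Prod>x\<leftarrow>xs. chi X x) = 1" for X
  proof -
    have "(\<Prod>x\<leftarrow>xs. chi X x) = (\<Prod>a\<in>S. chi X a)"
      using prod.distinct_set_conv_list[OF d, of "chi X"] True by simp
    then show ?thesis
      by (simp flip: prod.distrib) (simp add: chi_def prod.neutral)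
  qed
  then show ?thesis using True assms by (simp add: card_Pow)
next
  case False
  have fin: "finite S" using assms finite_subset by blast
  obtain a where a: "a \<in> S" "a \<notin> set xs"
  proof -
    have "\<not> S \<subseteq> set xs"
    proof
      assume sub: "S \<subseteq> set xs"
      then have "card S \<le> card (set xs)" by (intro card_mono) auto
      moreover have "card (set xs) \<le> card S" using assms card_length[of xs] by simp
      ultimately show False using sub False card_seteq[of "set xs" S] by auto
    qed
    then show ?thesis using that by auto
  qed
  define f where "f X = (\<Prod>a\<in>S. chi X a) * (\<Prod>x\<leftarrow>xs. chi X x)" for X
  define t where "t X = (if a \<in> X then X - {a} else insert a X)" for X
  have flip: "f (t X) = - f X" for X
  proof -
    have "(\<Prod>b\<in>S. chi (t X) b) = - (\<Prod>b\<in>S. chi X b)"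
    proof -
      have "(\<Prod>b\<in>S - {a}. chi (t X) b) = (\<Prod>b\<in>S - {a}. chi X b)"
        by (intro prod.cong refl) (simp add: t_def chi_flip)
      then show ?thesis
        using prod.remove[OF fin a(1), of "chi (t X)"] prod.remove[OF fin a(1), of "chi X"]
        by (simp add: t_def chi_flip)
    qed
    moreover have "(\<Prod>x\<leftarrow>xs. chi (t X) x) = (\<Prod>x\<leftarrow>xs. chi X x)"
      by (intro arg_cong[of _ _ prod_list] map_cong refl) (use a in \<open>auto simp: t_def chi_flip\<close>)
    ultimately show ?thesis unfolding f_def by simp
  qed
  have "bij_betw t (Pow U) (Pow U)"
    by (rule bij_betw_byWitness[where f' = t]) (use a assms in \<open>auto simp: t_def split: if_splits\<close>)
  then have "sum f (Pow U) = sum (\<lambda>X. f (t X)) (Pow U)"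
    by (rule sum.reindex_bij_betw[symmetric])
  then have "sum f (Pow U) = 0"
    by (simp add: flip sum_negf)
  then show ?thesis using False by (simp add: f_def)
qed

section \<open>Commuting projectors\<close>

text \<open>\<open>orth_mat\<close> speaks of the columns. For a square matrix a one-sided inverse
  is two-sided, which gives the same for the rows.\<close>

lemma orth_rows:
  assumes "orth_mat d Om" "i < d" "j < d"
  shows "(\<Sum>a<d. Om $$ (i, a) * Om $$ (j, a)) = (if i = j then 1 else 0)"
proof -
  have c: "Om \<in> carrier_mat d d" "transpose_mat Om \<in> carrier_mat d d" "transpose_mat Om * Om = 1\<^sub>m d"
    using assms by (auto simp: orth_mat_def)
  then have "Om * transpose_mat Om = 1\<^sub>m d"
    using mat_mult_left_right_inverse by blast
  then have "(Om * transpose_mat Om) $$ (i, j) = (if i = j then 1 else 0)"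
    using assms by simp
  moreover have "(Om * transpose_mat Om) $$ (i, j) = (\<Sum>a<d. Om $$ (i, a) * Om $$ (j, a))"
    using c(1) assms by (auto simp: scalar_prod_def atLeast0LessThan)
  ultimately show ?thesis by simp
qed

lemma hermitian_idempotent_mprod:
  assumes "\<And>A. A \<in> set As \<Longrightarrow> A \<in> carrier_mat d d \<and> cadj A = A \<and> A * A = A"
    and "pairwise (scomm 1) (set As)"
  shows "cadj (mprod d As) = mprod d As \<and> mprod d As * mprod d As = mprod d As"
  using assms
proof (induction As)
  case (Cons A As)
  let ?P = "mprod d As"
  have c: "A \<in> carrier_mat d d" "?P \<in> carrier_mat d d"
    using Cons.prems(1) by (auto intro!: mprod_carrier)
  have IH: "cadj ?P = ?P" "?P * ?P = ?P"
    using Cons by (auto simp: pairwise_insert)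
  have A: "cadj A = A" "A * A = A" using Cons.prems(1) by auto
  \<comment> \<open>\<open>pairwise\<close> is silent about equal factors, which commute trivially;
    the list may contain repetitions.\<close>
  have "scomm 1 B A" if "B \<in> set As" for B
  proof (cases "B = A")
    case True
    then show ?thesis by (simp add: scomm_def one_smult_mat)
  next
    case False
    then show ?thesis using Cons.prems(2) that by (auto simp: pairwise_def)
  qed
  then have "scomm (1 ^ length As) ?P A"
    using Cons.prems(1) by (intro scomm_mprod[where d = d]) auto
  then have comm: "?P * A = A * ?P"
    by (simp add: scomm_def one_smult_mat)
  have "(A * ?P) * (A * ?P) = A * ((?P * A) * ?P)"
    using c by (simp add: sq_assoc[where d = d] sq_mult[where d = d])
  also have "\<dots> = (A * A) * (?P * ?P)"
    unfolding comm using c by (simp add: sq_assoc[where d = d] sq_mult[where d = d])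
  finally show ?case
    using IH A c comm by (simp add: cadj_mult[where d = d])
qed auto

lemma mprod_snoc:
  assumes "set As \<subseteq> carrier_mat d d" "A \<in> carrier_mat d d"
  shows "mprod d (As @ [A]) = mprod d As * A"
  using mprod_append[OF assms(1), of "[A]"] assms right_mult_one_mat[OF assms(2)] by simp

context majorana_system
begin

text \<open>The product of two anticommuting Hermitian involutions is skew-Hermitian with square -1;
  the factor \<open>\<i>\<close> makes it a Hermitian involution, and \<open>half\<close> gives its
  two spectral projectors.\<close>

definition bil :: "nat \<Rightarrow> complex mat" where
  "bil j = \<i> \<cdot>\<^sub>m (\<gamma> (2 * j) * \<gamma> (2 * j + 1))"

definition half :: "nat \<Rightarrow> int \<Rightarrow> complex mat" where
  "half j s = (1 / 2) \<cdot>\<^sub>m (1\<^sub>m dim + of_int s \<cdot>\<^sub>m bil j)"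

lemma pair_carrier:
  assumes "j < n"
  shows "\<gamma> (2 * j) \<in> carrier_mat dim dim" "\<gamma> (2 * j + 1) \<in> carrier_mat dim dim"
  using assms by (auto intro: carrier)

lemma bil_carrier: "j < n \<Longrightarrow> bil j \<in> carrier_mat dim dim"
  using pair_carrier by (simp add: bil_def sq_mult)

lemma half_carrier: "j < n \<Longrightarrow> half j s \<in> carrier_mat dim dim"
  using bil_carrier by (simp add: half_def)

lemma bil_herm:
  assumes j: "j < n"
  shows "cadj (bil j) = bil j"
proof -
  note c = pair_carrier[OF j]
  have "cadj (bil j) = (- \<i>) \<cdot>\<^sub>m (\<gamma> (2 * j + 1) * \<gamma> (2 * j))"
    using j by (simp add: bil_def cadj_smult cadj_mult[OF c] herm del: One_nat_def)
  also have "\<gamma> (2 * j + 1) * \<gamma> (2 * j) = (-1) \<cdot>\<^sub>m (\<gamma> (2 * j) * \<gamma> (2 * j + 1))"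
    using scomm_gamma[of "2 * j + 1" "2 * j"] j by (simp add: scomm_def)
  finally show ?thesis by (simp add: bil_def smult_smult_mat)
qed

lemma bil_square:
  assumes j: "j < n"
  shows "bil j * bil j = 1\<^sub>m dim"
proof -
  let ?a = "\<gamma> (2 * j)" and ?b = "\<gamma> (2 * j + 1)"
  note c = pair_carrier[OF j]
  note ab = sq_mult[OF c]
  have "bil j * bil j = (\<i> * \<i>) \<cdot>\<^sub>m ((?a * ?b) * (?a * ?b))"
    unfolding bil_def
    by (simp only: sq_smult_left[OF ab smult_carrier_mat[OF ab]] sq_smult_right[OF ab ab] smult_smult_mat)
  also have "(?a * ?b) * (?a * ?b) = ?a * ((?b * ?a) * ?b)"
    using c by (simp add: sq_assoc[where d = dim] sq_mult[where d = dim])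
  also have "?b * ?a = (-1) \<cdot>\<^sub>m (?a * ?b)"
    using scomm_gamma[of "2 * j + 1" "2 * j"] j by (simp add: scomm_def)
  also have "(-1 \<cdot>\<^sub>m (?a * ?b)) * ?b = (-1) \<cdot>\<^sub>m (?a * (?b * ?b))"
    by (simp only: sq_smult_left[OF ab c(2)] sq_assoc[OF c c(2)])
  also have "?b * ?b = 1\<^sub>m dim" using j by (intro square) simp
  also have "?a * 1\<^sub>m dim = ?a" using c by simp
  also have "?a * (-1 \<cdot>\<^sub>m ?a) = (-1) \<cdot>\<^sub>m 1\<^sub>m dim"
    using sq_smult_right[OF c(1) c(1), of "-1"] square[of "2 * j"] j by simp
  finally show ?thesis by (simp add: smult_smult_mat one_smult_mat)
qed

text \<open>An operator of pair k anticommutes with both operators of pair j, hence passes their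
  product without a sign.\<close>

lemma bil_comm:
  assumes "j < n" "k < n" "j \<noteq> k"
  shows "bil j * bil k = bil k * bil j"
proof -
  note cj = pair_carrier[OF assms(1)] and ck = pair_carrier[OF assms(2)]
  note abj = sq_mult[OF cj] and abk = sq_mult[OF ck]
  have one: "scomm ((-1) * (-1)) (\<gamma> (2 * j) * \<gamma> (2 * j + 1)) (\<gamma> l)" if "l = 2 * k \<or> l = 2 * k + 1" for l
  proof -
    have "l < 2 * n" "2 * j < 2 * n" "2 * j + 1 < 2 * n" using that assms by auto
    moreover have "2 * j \<noteq> l" "2 * j + 1 \<noteq> l" using that assms by presburger+
    ultimately show ?thesis
      by (intro scomm_mult[where d = dim] scomm_gamma cj carrier)
  qed
  have swap: "scomm 1 B A" if "scomm 1 A B" for A B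
    using that by (simp add: scomm_def one_smult_mat)
  have "scomm 1 (\<gamma> (2 * j) * \<gamma> (2 * j + 1)) (\<gamma> (2 * k))"
    "scomm 1 (\<gamma> (2 * j) * \<gamma> (2 * j + 1)) (\<gamma> (2 * k + 1))"
    using one[of "2 * k"] one[of "2 * k + 1"] by simp_all
  then have "scomm (1 * 1) (\<gamma> (2 * k) * \<gamma> (2 * k + 1)) (\<gamma> (2 * j) * \<gamma> (2 * j + 1))"
    by (rule scomm_mult[OF swap swap ck abj])
  then have "(\<gamma> (2 * j) * \<gamma> (2 * j + 1)) * (\<gamma> (2 * k) * \<gamma> (2 * k + 1))
      = (\<gamma> (2 * k) * \<gamma> (2 * k + 1)) * (\<gamma> (2 * j) * \<gamma> (2 * j + 1))"
    by (simp only: scomm_def one_smult_mat mult_1)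
  then show ?thesis
    unfolding bil_def
    by (simp only: sq_smult_left[OF abj smult_carrier_mat[OF abk]] sq_smult_right[OF abj abk]
        sq_smult_left[OF abk smult_carrier_mat[OF abj]] sq_smult_right[OF abk abj])
qed

text \<open>One expansion for two purposes: j = k and \<open>bil_square\<close> give idempotence,
  while its symmetry under exchanging the factors gives commutation.\<close>

lemma half_mult:
  assumes "j < n" "k < n"
  shows "half j s * half k t = (1 / 4) \<cdot>\<^sub>m (1\<^sub>m dim + of_int s \<cdot>\<^sub>m bil j + of_int t \<cdot>\<^sub>m bil k
      + of_int (s * t) \<cdot>\<^sub>m (bil j * bil k))"
proof -
  note c = bil_carrier[OF assms(1)] bil_carrier[OF assms(2)]
  let ?A = "of_int s \<cdot>\<^sub>m bil j" and ?B = "of_int t \<cdot>\<^sub>m bil k"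
  have cA: "?A \<in> carrier_mat dim dim" "?B \<in> carrier_mat dim dim" using c by auto
  have "(1\<^sub>m dim + ?A) * (1\<^sub>m dim + ?B) = (1\<^sub>m dim + ?A) * 1\<^sub>m dim + (1\<^sub>m dim + ?A) * ?B"
    by (rule mult_add_distrib_mat[where nr = dim and n = dim and nc = dim]) (use cA in auto)
  also have "(1\<^sub>m dim + ?A) * 1\<^sub>m dim = 1\<^sub>m dim + ?A"
    using cA by (intro right_mult_one_mat[where nr = dim]) auto
  also have "(1\<^sub>m dim + ?A) * ?B = 1\<^sub>m dim * ?B + ?A * ?B"
    by (rule add_mult_distrib_mat[where nr = dim and n = dim and nc = dim]) (use cA in auto)
  also have "1\<^sub>m dim * ?B = ?B" using cA by (intro left_mult_one_mat[where nc = dim]) auto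
  also have "?A * ?B = of_int (s * t) \<cdot>\<^sub>m (bil j * bil k)"
    by (simp only: sq_smult_left[OF c(1) cA(2)] sq_smult_right[OF c] smult_smult_mat of_int_mult)
  finally have e: "(1\<^sub>m dim + ?A) * (1\<^sub>m dim + ?B)
      = 1\<^sub>m dim + ?A + (?B + of_int (s * t) \<cdot>\<^sub>m (bil j * bil k))" .
  have cc: "1\<^sub>m dim + ?A \<in> carrier_mat dim dim" "1\<^sub>m dim + ?B \<in> carrier_mat dim dim"
    using cA by auto
  have "half j s * half k t = (1 / 4) \<cdot>\<^sub>m ((1\<^sub>m dim + ?A) * (1\<^sub>m dim + ?B))"
    unfolding half_def
    by (simp only: sq_smult_left[OF cc(1) smult_carrier_mat[OF cc(2)]] sq_smult_right[OF cc] smult_smult_mat) simp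
  also have "1\<^sub>m dim + ?A + (?B + of_int (s * t) \<cdot>\<^sub>m (bil j * bil k))
      = 1\<^sub>m dim + ?A + ?B + of_int (s * t) \<cdot>\<^sub>m (bil j * bil k)"
    by (rule assoc_add_mat[symmetric]) (use cA c sq_mult[OF c] in auto)
  ultimately show ?thesis using e by simp
qed

lemma half_idem:
  assumes "j < n" "s = 1 \<or> s = -1"
  shows "half j s * half j s = half j s"
  unfolding half_mult[OF assms(1) assms(1)] bil_square[OF assms(1)] unfolding half_def
  using assms(2) bil_carrier[OF assms(1)] by (auto intro!: eq_matI)

lemma half_herm: "j < n \<Longrightarrow> cadj (half j s) = half j s"
  using bil_carrier[of j] by (simp add: half_def cadj_smult cadj_add[where d = dim] bil_herm)

lemma half_comm: "j < n \<Longrightarrow> k < n \<Longrightarrow> j \<noteq> k \<Longrightarrow> scomm 1 (half j s) (half k t)"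
  using bil_carrier[of j] bil_carrier[of k] bil_comm[of j k] sq_mult[of "bil j" dim "bil k"]
  by (auto simp: scomm_def half_mult one_smult_mat mult.commute intro!: eq_matI)

lemma half_mprod_psd:
  assumes "\<And>j. j < n \<Longrightarrow> q j = 1 \<or> q j = -1"
  shows "psd_mat (mprod dim (map (\<lambda>j. half j (q j)) [0..<n]))"
proof (rule hermitian_idempotent_psd)
  let ?As = "map (\<lambda>j. half j (q j)) [0..<n]"
  show "mprod dim ?As \<in> carrier_mat dim dim"
    by (intro mprod_carrier) (auto intro: half_carrier)
  have "cadj (mprod dim ?As) = mprod dim ?As \<and> mprod dim ?As * mprod dim ?As = mprod dim ?As"
  proof (rule hermitian_idempotent_mprod)
    show "A \<in> carrier_mat dim dim \<and> cadj A = A \<and> A * A = A" if A: "A \<in> set ?As" for A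
    proof -
      obtain j where j: "j < n" "A = half j (q j)" using A by auto
      then show ?thesis using half_carrier half_herm half_idem[OF j(1) assms[OF j(1)]] by simp
    qed
    show "pairwise (scomm 1) (set ?As)"
    proof (rule pairwiseI)
      fix A B assume "A \<in> set ?As" "B \<in> set ?As" "A \<noteq> B"
      then obtain j k where "j < n" "k < n" "A = half j (q j)" "B = half k (q k)" by auto
      with \<open>A \<noteq> B\<close> show "scomm 1 A B" by (cases "j = k") (auto intro: half_comm)
    qed
  qed
  then show "cadj (mprod dim ?As) = mprod dim ?As" "mprod dim ?As * mprod dim ?As = mprod dim ?As"
    by auto
qed

lemma half_index:
  "j < n \<Longrightarrow> a < dim \<Longrightarrow> b < dim \<Longrightarrow>
    half j s $$ (a, b) = ((if a = b then 1 else 0) + of_int s * bil j $$ (a, b)) / 2"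
  using bil_carrier[of j] by (simp add: half_def)

text \<open>The sum over q factorises over the pairs: the two projectors of a pair add up to the
  identity, and to \<open>bil j\<close> when weighted by their signs. The last factor is split off
  on the right, so the column index becomes an intermediate one and has to be arbitrary in the
  induction.\<close>

lemma sum_signvecs_half:
  assumes "m \<le> n" "a < dim" "b < dim"
  shows "(\<Sum>q\<in>signvecs m. of_int (\<Prod>j\<in>T \<inter> {..<m}. q j) * mprod dim (map (\<lambda>j. half j (q j)) [0..<m]) $$ (a, b))
      = mprod dim (map (\<lambda>j. if j \<in> T then bil j else 1\<^sub>m dim) [0..<m]) $$ (a, b)"
  using assms
proof (induction m arbitrary: b)
  case 0
  then show ?case by (simp add: signvecs_0)
next
  case (Suc m)
  let ?H = "\<lambda>q m. mprod dim (map (\<lambda>j. half j (q j)) [0..<m])"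
  let ?B = "\<lambda>j. if j \<in> T then bil j else 1\<^sub>m dim"
  let ?w = "\<lambda>q m. of_int (\<Prod>j\<in>T \<inter> {..<m}. q j) :: complex"
  have m: "m < n" using Suc.prems by simp
  have Hc: "?H q m \<in> carrier_mat dim dim" for q
    using m by (intro mprod_carrier) (auto intro: half_carrier)
  have Bc: "mprod dim (map ?B [0..<m]) \<in> carrier_mat dim dim"
    using m by (intro mprod_carrier) (auto intro: bil_carrier)
  have snocH: "?H q (Suc m) $$ (a, b) = (\<Sum>k<dim. ?H q m $$ (a, k) * half m (q m) $$ (k, b))" for q
  proof -
    have "?H q (Suc m) = ?H q m * half m (q m)"
      using m by (simp only: upt_Suc_append[OF le0] map_append list.map)
        (intro mprod_snoc, auto intro: half_carrier)
    then show ?thesis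
      using mat_mult_index[OF Hc half_carrier[OF m]] Suc.prems by simp
  qed
  have snocB: "mprod dim (map ?B [0..<Suc m]) $$ (a, b)
      = (\<Sum>k<dim. mprod dim (map ?B [0..<m]) $$ (a, k) * ?B m $$ (k, b))"
  proof -
    have Bm: "?B m \<in> carrier_mat dim dim" using m bil_carrier by simp
    then have "mprod dim (map ?B [0..<Suc m]) = mprod dim (map ?B [0..<m]) * ?B m"
      using m by (simp only: upt_Suc_append[OF le0] map_append list.map)
        (intro mprod_snoc, auto intro: bil_carrier)
    then show ?thesis
      using mat_mult_index[OF Bc Bm] Suc.prems by simp
  qed
  have updH: "?H (q(m := s)) m = ?H q m" for q s
    by (intro arg_cong[of _ _ "mprod dim"] map_cong refl) auto
  have updw: "?w (q(m := s)) (Suc m) = ?w q m * (if m \<in> T then of_int s else 1)" for q s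
  proof -
    have "T \<inter> {..<Suc m} = (if m \<in> T then insert m (T \<inter> {..<m}) else T \<inter> {..<m})"
      by (auto simp: less_Suc_eq)
    moreover have "(\<Prod>j\<in>T \<inter> {..<m}. (q(m := s)) j) = (\<Prod>j\<in>T \<inter> {..<m}. q j)"
      by (intro prod.cong refl) auto
    ultimately show ?thesis by (simp add: mult.commute)
  qed
  have pm: "(if m \<in> T then of_int 1 else 1) * half m 1 $$ (k, b)
      + (if m \<in> T then of_int (-1) else 1) * half m (-1) $$ (k, b) = ?B m $$ (k, b)" if "k < dim" for k
    using that m Suc.prems by (simp add: half_index field_simps)
  have "(\<Sum>q\<in>signvecs (Suc m). ?w q (Suc m) * ?H q (Suc m) $$ (a, b))
      = (\<Sum>q\<in>signvecs m. ?w q m * (\<Sum>k<dim. ?H q m $$ (a, k) * ?B m $$ (k, b)))"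
    unfolding sum_signvecs_Suc
  proof (intro sum.cong refl)
    fix q
    have "?w (q(m := s)) (Suc m) * ?H (q(m := s)) (Suc m) $$ (a, b)
      = ?w q m * (\<Sum>k<dim. ?H q m $$ (a, k) * ((if m \<in> T then of_int s else 1) * half m s $$ (k, b)))" for s
      unfolding snocH updH updw fun_upd_same by (simp only: sum_distrib_left mult_ac)
    then show "?w (q(m := 1)) (Suc m) * ?H (q(m := 1)) (Suc m) $$ (a, b)
        + ?w (q(m := -1)) (Suc m) * ?H (q(m := -1)) (Suc m) $$ (a, b)
        = ?w q m * (\<Sum>k<dim. ?H q m $$ (a, k) * ?B m $$ (k, b))"
      by (simp only: distrib_left[symmetric] sum.distrib[symmetric])
        (intro arg_cong2[of _ _ _ _ times] sum.cong refl, simp only: pm lessThan_iff)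
  qed
  also have "\<dots> = (\<Sum>k<dim. (\<Sum>q\<in>signvecs m. ?w q m * ?H q m $$ (a, k)) * ?B m $$ (k, b))"
    unfolding sum_distrib_left sum_distrib_right by (subst sum.swap) (simp only: mult.assoc)
  also have "\<dots> = (\<Sum>k<dim. mprod dim (map ?B [0..<m]) $$ (a, k) * ?B m $$ (k, b))"
    by (intro sum.cong refl arg_cong2[of _ _ _ _ times] Suc.IH) (use Suc.prems in auto)
  also have "\<dots> = mprod dim (map ?B [0..<Suc m]) $$ (a, b)"
    by (rule snocB[symmetric])
  finally show ?case .
qed

text \<open>The filtered list runs through the union of the pairs in T in increasing order. Thus the
  product of pair involutions is already a sorted product of Majorana operators, with one factor
  \<open>\<i>\<close> per pair and no reordering sign.\<close>

lemma mprod_bil_eq_gprod: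
  assumes "m \<le> n" "T \<subseteq> {..<n}"
  shows "mprod dim (map (\<lambda>j. if j \<in> T then bil j else 1\<^sub>m dim) [0..<m])
      = \<i> ^ card (T \<inter> {..<m}) \<cdot>\<^sub>m gprod (filter (\<lambda>i. i div 2 \<in> T) [0..<2 * m])"
  using assms(1)
proof (induction m)
  case 0
  then show ?case by (simp add: one_smult_mat)
next
  case (Suc m)
  let ?B = "\<lambda>j. if j \<in> T then bil j else 1\<^sub>m dim" and ?g = "gprod (filter (\<lambda>i. i div 2 \<in> T) [0..<2 * m])"
  have m: "m < n" using Suc.prems by simp
  have Bm: "?B m \<in> carrier_mat dim dim" using m bil_carrier by simp
  have gc: "?g \<in> carrier_mat dim dim" using m by (intro gprod_carrier) auto
  have "mprod dim (map ?B [0..<Suc m]) = mprod dim (map ?B [0..<m]) * ?B m"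
    using m Bm by (simp only: upt_Suc_append[OF le0] map_append list.map)
      (intro mprod_snoc, auto intro: bil_carrier)
  also have "\<dots> = (\<i> ^ card (T \<inter> {..<m}) \<cdot>\<^sub>m ?g) * ?B m"
    using Suc by simp
  also have "\<dots> = \<i> ^ card (T \<inter> {..<Suc m}) \<cdot>\<^sub>m gprod (filter (\<lambda>i. i div 2 \<in> T) [0..<2 * Suc m])"
  proof (cases "m \<in> T")
    case True
    have "T \<inter> {..<Suc m} = insert m (T \<inter> {..<m})" using True by auto
    then have card: "card (T \<inter> {..<Suc m}) = Suc (card (T \<inter> {..<m}))" by simp
    have "filter (\<lambda>i. i div 2 \<in> T) [0..<2 * Suc m] = filter (\<lambda>i. i div 2 \<in> T) [0..<2 * m] @ [2 * m, 2 * m + 1]"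
      using True by simp
    then have "gprod (filter (\<lambda>i. i div 2 \<in> T) [0..<2 * Suc m]) = ?g * gprod [2 * m, 2 * m + 1]"
      using m by (simp only:) (rule gprod_append, auto)
    also have "gprod [2 * m, 2 * m + 1] = \<gamma> (2 * m) * \<gamma> (2 * m + 1)"
      using pair_carrier[OF m] by simp
    finally have g: "gprod (filter (\<lambda>i. i div 2 \<in> T) [0..<2 * Suc m]) = ?g * (\<gamma> (2 * m) * \<gamma> (2 * m + 1))" .
    note ab = sq_mult[OF pair_carrier[OF m]]
    show ?thesis
      unfolding g card using True
      by (simp only: if_True bil_def sq_smult_left[OF gc smult_carrier_mat[OF ab]] sq_smult_right[OF gc ab]
          smult_smult_mat power_Suc2)
  next
    case False
    have "T \<inter> {..<Suc m} = T \<inter> {..<m}" using False by (auto simp: less_Suc_eq)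
    moreover have "filter (\<lambda>i. i div 2 \<in> T) [0..<2 * Suc m] = filter (\<lambda>i. i div 2 \<in> T) [0..<2 * m]"
      using False by simp
    ultimately show ?thesis using False gc by (simp only: if_False) simp
  qed
  finally show ?case .
qed

end

section \<open>Rotated Majorana operators\<close>

lemma sum_pairs_split:
  fixes F :: "nat \<Rightarrow> nat \<Rightarrow> complex"
  shows "(\<Sum>a<m. \<Sum>b<m. F a b) = (\<Sum>b<m. \<Sum>a<b. F a b + F b a) + (\<Sum>a<m. F a a)"
  by (induction m) (simp_all add: sum.distrib)

lemma Sm_2_eq: "Sm n 2 = (\<lambda>(b, a). {a, b}) ` (SIGMA b:{..<2 * n}. {..<b})"
proof (intro equalityI subsetI)
  fix S assume "S \<in> Sm n 2"
  then have S: "S \<subseteq> {0..<2 * n}" "card S = 2" by (auto simp: Sm_def)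
  then obtain x y where "S = {x, y}" "x \<noteq> y" by (meson card_2_iff)
  then have "S = {min x y, max x y}" "min x y < max x y" "max x y < 2 * n"
    using S by (auto simp: min_def max_def)
  then show "S \<in> (\<lambda>(b, a). {a, b}) ` (SIGMA b:{..<2 * n}. {..<b})" by force
qed (auto simp: Sm_def)

lemma inj_on_pair_set: "inj_on (\<lambda>(b, a). {a, b}) (SIGMA b:{..<m}. {..<b :: nat})"
  by (rule inj_onI) (auto simp: doubleton_eq_iff)

lemma sorted_list_of_set_pair: "a < b \<Longrightarrow> sorted_list_of_set {a, b :: nat} = [a, b]"
  by (simp add: sorted_list_of_set_insert_remove)

lemma minor_pair:
  assumes "A \<in> carrier_mat d d" "r < s" "s < d" "a < b" "b < d"
  shows "minor A {r, s} {a, b} = A $$ (r, a) * A $$ (s, b) - A $$ (r, b) * A $$ (s, a)"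
proof -
  have two: "{..<Suc (Suc 0)} = {0, Suc 0}" by auto
  have "minor A {r, s} {a, b} = (\<Sum>p | p permutes {0, 1 :: nat}. of_int (sign p) *
           (\<Prod>i\<in>{0, 1}. A $$ ([r, s] ! i, [a, b] ! p i)))"
    using assms minor_eq_sum_permutes[of A d "{r, s}" "{a, b}"]
    by (simp add: sorted_list_of_set_pair two)
  also have "{p. p permutes {0, 1 :: nat}} = {id, Transposition.transpose 0 1}"
    by (auto simp: permutes_doubleton_iff)
  also have "(\<Sum>p\<in>{id, Transposition.transpose 0 1}. of_int (sign p) *
           (\<Prod>i\<in>{0, 1}. A $$ ([r, s] ! i, [a, b] ! p i)))
       = A $$ (r, a) * A $$ (s, b) - A $$ (r, b) * A $$ (s, a)"
  proof -
    have "id \<noteq> Transposition.transpose 0 (1 :: nat)"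
      by (metis id_apply transpose_apply_first zero_neq_one)
    then show ?thesis by (simp add: sign_swap_id)
  qed
  finally show ?thesis .
qed

lemma psd_smult:
  assumes "psd_mat A" "0 \<le> c"
  shows "psd_mat (of_real c \<cdot>\<^sub>m A)"
proof -
  have A: "hermitian_mat A" "\<And>v. v \<in> carrier_vec (dim_row A) \<Longrightarrow>
      0 \<le> Re (\<Sum>i<dim_row A. cnj (v $ i) * (A *\<^sub>v v) $ i)"
    using assms(1) by (auto simp: psd_mat_def)
  obtain d where d: "A \<in> carrier_mat d d" and herm: "cadj A = A"
    using A(1) by (auto simp: hermitian_mat_def)
  have "Re (\<Sum>i<d. cnj (v $ i) * ((of_real c \<cdot>\<^sub>m A) *\<^sub>v v) $ i)
      = c * Re (\<Sum>i<d. cnj (v $ i) * (A *\<^sub>v v) $ i)" if "v \<in> carrier_vec d" for v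
  proof -
    have "((of_real c \<cdot>\<^sub>m A) *\<^sub>v v) $ i = of_real c * (A *\<^sub>v v) $ i" if "i < d" for i
      using that d \<open>v \<in> carrier_vec d\<close> by (simp add: scalar_prod_def sum_distrib_left mult.assoc)
    then have "(\<Sum>i<d. cnj (v $ i) * ((of_real c \<cdot>\<^sub>m A) *\<^sub>v v) $ i)
        = of_real c * (\<Sum>i<d. cnj (v $ i) * (A *\<^sub>v v) $ i)"
      unfolding sum_distrib_left by (intro sum.cong refl) (simp only: lessThan_iff mult.left_commute)
    then show ?thesis by simp
  qed
  moreover have "hermitian_mat (of_real c \<cdot>\<^sub>m A)"
    using d herm by (auto simp: hermitian_mat_def cadj_smult intro!: exI[of _ d])
  ultimately show ?thesis
    using A(2) d assms(2) by (auto simp: psd_mat_def)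
qed

lemma D2k_obtain:
  assumes "R \<in> D2k n k"
  obtains T where "T \<subseteq> {..<n}" "card T = k" "R = (\<Union>j\<in>T. {2 * j, 2 * j + 1})"
proof -
  obtain \<T> where \<T>: "\<T> \<subseteq> D2 n" "card \<T> = k" "R = \<Union>\<T>"
    using assms by (auto simp: D2k_def)
  have D2: "D2 n = (\<lambda>j. {2 * j, 2 * j + 1}) ` {..<n}" by (auto simp: D2_def)
  have "\<exists>T\<subseteq>{..<n}. inj_on (\<lambda>j. {2 * j, 2 * j + 1}) T \<and> \<T> = (\<lambda>j. {2 * j, 2 * j + 1}) ` T"
    using \<T>(1) unfolding D2 by (simp only: subset_image_inj)
  then obtain T where T: "T \<subseteq> {..<n}" "inj_on (\<lambda>j. {2 * j, 2 * j + 1}) T" "\<T> = (\<lambda>j. {2 * j, 2 * j + 1}) ` T"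
    by blast
  then show ?thesis using that[of T] \<T> by (simp add: card_image)
qed

lemma pair_union_card:
  assumes "finite T"
  shows "card (\<Union>j\<in>T. {2 * j, 2 * j + 1 :: nat}) = 2 * card T"
proof -
  have "card (\<Union>j\<in>T. {2 * j, 2 * j + 1}) = (\<Sum>j\<in>T. card {2 * j, 2 * j + 1})"
    using assms by (intro card_UN_disjoint) (auto; presburger)+
  then show ?thesis by simp
qed

lemma sorted_list_of_pair_union:
  assumes "T \<subseteq> {..<n}"
  shows "sorted_list_of_set (\<Union>j\<in>T. {2 * j, 2 * j + 1}) = filter (\<lambda>i. i div 2 \<in> T) [0..<2 * n]"
proof (rule sorted_distinct_set_unique)
  have fin: "finite T" using assms finite_subset by blast
  have "i \<in> (\<Union>j\<in>T. {2 * j, 2 * j + 1}) \<longleftrightarrow> i div 2 \<in> T \<and> i < 2 * n" for i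
  proof
    assume "i \<in> (\<Union>j\<in>T. {2 * j, 2 * j + 1})"
    then obtain j where "j \<in> T" "i = 2 * j \<or> i = 2 * j + 1" by auto
    moreover from this have "j < n" using assms by auto
    ultimately show "i div 2 \<in> T \<and> i < 2 * n" by auto
  next
    assume "i div 2 \<in> T \<and> i < 2 * n"
    moreover have "i = 2 * (i div 2) \<or> i = 2 * (i div 2) + 1" by presburger
    ultimately show "i \<in> (\<Union>j\<in>T. {2 * j, 2 * j + 1})" by blast
  qed
  then show "set (sorted_list_of_set (\<Union>j\<in>T. {2 * j, 2 * j + 1})) = set (filter (\<lambda>i. i div 2 \<in> T) [0..<2 * n])"
    using fin by auto
qed (auto simp: sorted_wrt_filter)

lemma LambdaN_eq: "LambdaN N n = {..<N} \<times> signvecs n \<times> Pow {0..<2 * n}"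
  by (auto simp: LambdaN_def)

lemma sum_LambdaN: "(\<Sum>l\<in>LambdaN N n. f l) = (\<Sum>r<N. \<Sum>X\<in>Pow {0..<2 * n}. \<Sum>q\<in>signvecs n. f (r, q, X))"
proof -
  have "(\<Sum>l\<in>LambdaN N n. f l) = (\<Sum>r<N. \<Sum>q\<in>signvecs n. \<Sum>X\<in>Pow {0..<2 * n}. f (r, q, X))"
    by (simp add: LambdaN_eq sum.cartesian_product case_prod_beta)
  then show ?thesis
    by (simp only:) (intro sum.cong refl sum.swap)
qed

text \<open>The phase that \<open>gammaS\<close> attaches to 2k indices equals the k factors
  \<open>\<i>\<close> of a product of k pair involutions. From k to k + 1 the binomial grows by 4k +
  1, and the fourth power of \<open>\<i>\<close> is 1.\<close>

lemma i_power_choose_2: "\<i> ^ ((2 * k) choose 2) = \<i> ^ k"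
proof (induction k)
  case (Suc k)
  have "(2 * Suc k) choose 2 = ((2 * k) choose 2) + 4 * k + 1"
    by (simp add: numeral_2_eq_2)
  then have "\<i> ^ ((2 * Suc k) choose 2) = \<i> ^ ((2 * k) choose 2) * (\<i> ^ 4) ^ k * \<i>"
    by (simp only: power_add power_mult power_one_right)
  then show ?case using Suc by simp
qed (simp add: numeral_2_eq_2)

context majorana_system
begin

definition rot :: "real mat \<Rightarrow> nat set \<Rightarrow> nat \<Rightarrow> complex mat" where
  "rot Om X \<rho> = msum dim (\<lambda>a. of_real (Om $$ (\<rho>, a) * chi X a) \<cdot>\<^sub>m \<gamma> a) {..<2 * n}"

lemma rot_carrier [simp]: "rot Om X \<rho> \<in> carrier_mat dim dim"
  by (simp add: rot_def)

lemma rot_mult_index: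
  assumes "i < dim" "j < dim"
  shows "(rot Om X \<rho> * rot Om X \<sigma>) $$ (i, j) = (\<Sum>a<2 * n. \<Sum>b<2 * n.
    of_real (Om $$ (\<rho>, a) * chi X a * (Om $$ (\<sigma>, b) * chi X b)) * (\<gamma> a * \<gamma> b) $$ (i, j))"
proof -
  have "rot Om X \<rho> * rot Om X \<sigma> = msum dim (\<lambda>(a, b). (of_real (Om $$ (\<rho>, a) * chi X a) \<cdot>\<^sub>m \<gamma> a) *
      (of_real (Om $$ (\<sigma>, b) * chi X b) \<cdot>\<^sub>m \<gamma> b)) ({..<2 * n} \<times> {..<2 * n})"
    unfolding rot_def by (intro msum_mult smult_carrier_mat carrier) simp_all
  then have "(rot Om X \<rho> * rot Om X \<sigma>) $$ (i, j) = (\<Sum>a<2 * n. \<Sum>b<2 * n.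
      ((of_real (Om $$ (\<rho>, a) * chi X a) \<cdot>\<^sub>m \<gamma> a) * (of_real (Om $$ (\<sigma>, b) * chi X b) \<cdot>\<^sub>m \<gamma> b)) $$ (i, j))"
    using assms by (simp only: msum_index sum.cartesian_product split_def)
  also have "\<dots> = (\<Sum>a<2 * n. \<Sum>b<2 * n.
    of_real (Om $$ (\<rho>, a) * chi X a * (Om $$ (\<sigma>, b) * chi X b)) * (\<gamma> a * \<gamma> b) $$ (i, j))"
  proof (intro sum.cong refl)
    fix a b assume "a \<in> {..<2 * n}" "b \<in> {..<2 * n}"
    then have c: "\<gamma> a \<in> carrier_mat dim dim" "\<gamma> b \<in> carrier_mat dim dim" by (auto intro: carrier)
    show "((of_real (Om $$ (\<rho>, a) * chi X a) \<cdot>\<^sub>m \<gamma> a) * (of_real (Om $$ (\<sigma>, b) * chi X b) \<cdot>\<^sub>m \<gamma> b)) $$ (i, j)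
      = of_real (Om $$ (\<rho>, a) * chi X a * (Om $$ (\<sigma>, b) * chi X b)) * (\<gamma> a * \<gamma> b) $$ (i, j)"
      unfolding sq_smult_left[OF c(1) smult_carrier_mat[OF c(2)]] sq_smult_right[OF c] smult_smult_mat
      using sq_mult[OF c] assms by (simp del: index_mult_mat)
  qed
  finally show ?thesis .
qed

lemma chi_square [simp]: "chi X a * chi X a = 1"
  by (simp add: chi_def)

text \<open>By bilinearity the anticommutator of two rotated operators is twice the inner product of
  the two rows times the identity: only equal columns contribute, and there the signs
  \<open>chi X\<close> square to 1.\<close>

lemma rot_majorana:
  assumes O: "orth_mat (2 * n) Om"
  shows "majorana n (rot Om X)"
  unfolding majorana_def
proof (intro conjI allI impI)
  fix \<rho>
  show "rot Om X \<rho> \<in> carrier_mat dim dim" by simp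
  have "cadj (rot Om X \<rho>) = rot Om X \<rho>"
  proof (rule eq_matI)
    fix i j assume "i < dim_row (rot Om X \<rho>)" "j < dim_col (rot Om X \<rho>)"
    then have ij: "i < dim" "j < dim" by (auto simp: rot_def)
    have "cnj (\<gamma> a $$ (j, i)) = \<gamma> a $$ (i, j)" if "a < 2 * n" for a
      using cadj_index[OF carrier[OF that] ij] herm[OF that] by simp
    moreover have "\<gamma> a \<in> carrier_mat dim dim" if "a < 2 * n" for a
      using carrier[OF that] .
    ultimately show "cadj (rot Om X \<rho>) $$ (i, j) = rot Om X \<rho> $$ (i, j)"
      using ij unfolding cadj_index[OF rot_carrier ij]
      by (simp add: rot_def carrier_matD[OF carrier])
  qed (simp_all add: rot_def cadj_def)
  then show "hermitian_mat (rot Om X \<rho>)"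
    unfolding hermitian_mat_def using rot_carrier by blast
next
  fix \<rho> \<sigma> assume \<rho>\<sigma>: "\<rho> < 2 * n" "\<sigma> < 2 * n"
  let ?c = "\<lambda>\<rho> a. Om $$ (\<rho>, a) * chi X a"
  show "rot Om X \<rho> * rot Om X \<sigma> + rot Om X \<sigma> * rot Om X \<rho>
      = (if \<rho> = \<sigma> then 2 \<cdot>\<^sub>m 1\<^sub>m dim else 0\<^sub>m dim dim)" (is "?L = ?R")
  proof (rule eq_matI)
    fix i j assume "i < dim_row ?R" "j < dim_col ?R"
    then have ij: "i < dim" "j < dim" by (auto split: if_splits)
    have "?L $$ (i, j) = (rot Om X \<rho> * rot Om X \<sigma>) $$ (i, j) + (rot Om X \<sigma> * rot Om X \<rho>) $$ (i, j)"
      using ij carrier_matD[OF sq_mult[OF rot_carrier rot_carrier]] by (simp only: index_add_mat)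
    also have "(rot Om X \<sigma> * rot Om X \<rho>) $$ (i, j) = (\<Sum>a<2 * n. \<Sum>b<2 * n.
        of_real (?c \<sigma> b * ?c \<rho> a) * (\<gamma> b * \<gamma> a) $$ (i, j))"
      unfolding rot_mult_index[OF ij] by (rule sum.swap)
    also have "(rot Om X \<rho> * rot Om X \<sigma>) $$ (i, j) + \<dots> = (\<Sum>a<2 * n. \<Sum>b<2 * n.
        of_real (?c \<rho> a * ?c \<sigma> b) * ((\<gamma> a * \<gamma> b) $$ (i, j) + (\<gamma> b * \<gamma> a) $$ (i, j)))"
      unfolding rot_mult_index[OF ij] sum.distrib[symmetric]
      by (intro sum.cong refl) (simp add: algebra_simps del: index_mult_mat)
    also have "\<dots> = (\<Sum>a<2 * n. \<Sum>b<2 * n.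
        if b = a then of_real (?c \<rho> a * ?c \<sigma> a) * (if i = j then 2 else 0) else 0)"
    proof (intro sum.cong refl)
      fix a b assume "a \<in> {..<2 * n}" "b \<in> {..<2 * n}"
      then have ab: "a < 2 * n" "b < 2 * n" by auto
      have "(\<gamma> a * \<gamma> b) $$ (i, j) + (\<gamma> b * \<gamma> a) $$ (i, j) = (\<gamma> a * \<gamma> b + \<gamma> b * \<gamma> a) $$ (i, j)"
        using ij carrier_matD[OF sq_mult[OF carrier[OF ab(2)] carrier[OF ab(1)]]] by (simp only: index_add_mat)
      also have "\<dots> = (if a = b then if i = j then 2 else 0 else 0)"
        using ij by (simp add: anticomm[OF ab])
      finally show "of_real (?c \<rho> a * ?c \<sigma> b) * ((\<gamma> a * \<gamma> b) $$ (i, j) + (\<gamma> b * \<gamma> a) $$ (i, j))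
          = (if b = a then of_real (?c \<rho> a * ?c \<sigma> a) * (if i = j then 2 else 0) else 0)"
        by simp
    qed
    also have "\<dots> = of_real (\<Sum>a<2 * n. ?c \<rho> a * ?c \<sigma> a) * (if i = j then 2 else 0)"
      by (simp add: sum_distrib_right)
    also have "(\<Sum>a<2 * n. ?c \<rho> a * ?c \<sigma> a) = (\<Sum>a<2 * n. Om $$ (\<rho>, a) * Om $$ (\<sigma>, a) * (chi X a * chi X a))"
      by (intro sum.cong refl) (simp only: mult_ac)
    also have "\<dots> = (if \<rho> = \<sigma> then 1 else 0)"
      using orth_rows[OF O \<rho>\<sigma>] by simp
    finally show "?L $$ (i, j) = ?R $$ (i, j)" using ij by simp
  qed (simp_all add: rot_def)
qed

lemma gammaS_eq: "gammaS n \<gamma> S = \<i> ^ (card S choose 2) \<cdot>\<^sub>m gprod (sorted_list_of_set S)"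
  by (simp add: gammaS_def foldr_eq_mprod)

text \<open>In the product of the two rotated operators the terms (a, b) and (b, a) combine to a 2
  by 2 minor times \<open>\<gamma> a * \<gamma> b\<close>. The diagonal terms add up to the inner
  product of two different rows, which is 0.\<close>

lemma gammaOX_eq_bil:
  assumes O: "orth_mat (2 * n) Om" and j: "j < n" and X: "finite X"
  shows "gammaOX n \<gamma> Om X {2 * j, 2 * j + 1} = \<i> \<cdot>\<^sub>m (rot Om X (2 * j) * rot Om X (2 * j + 1))"
proof (rule eq_matI)
  let ?r = "2 * j" and ?s = "2 * j + 1"
  let ?c = "\<lambda>\<rho> a. Om $$ (\<rho>, a) * chi X a"
  have Oc: "Om \<in> carrier_mat (2 * n) (2 * n)" using O by (simp add: orth_mat_def)
  note rr = sq_mult[OF rot_carrier rot_carrier, of Om X ?r Om X ?s]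
  fix x y assume "x < dim_row (\<i> \<cdot>\<^sub>m (rot Om X ?r * rot Om X ?s))" "y < dim_col (\<i> \<cdot>\<^sub>m (rot Om X ?r * rot Om X ?s))"
  then have xy: "x < dim" "y < dim" using rr by auto
  have card_pair: "card {?r, ?s} = 2" by simp
  define F where "F a b = of_real (?c ?r a * ?c ?s b) * (\<gamma> a * \<gamma> b) $$ (x, y)" for a b
  have "gammaOX n \<gamma> Om X {?r, ?s} $$ (x, y)
      = (\<Sum>S\<in>Sm n 2. (of_real (xsign X S * minor Om {?r, ?s} S) \<cdot>\<^sub>m gammaS n \<gamma> S) $$ (x, y))"
    unfolding gammaOX_def card_pair using xy by (simp only: msum_index)
  also have "\<dots> = (\<Sum>b<2 * n. \<Sum>a<b. (of_real (xsign X {a, b} * minor Om {?r, ?s} {a, b}) \<cdot>\<^sub>m gammaS n \<gamma> {a, b}) $$ (x, y))"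
    unfolding Sm_2_eq by (subst sum.reindex[OF inj_on_pair_set]) (simp add: sum.Sigma case_prod_beta)
  also have "\<dots> = (\<Sum>b<2 * n. \<Sum>a<b. \<i> * (F a b + F b a))"
  proof (intro sum.cong refl)
    fix b a assume "b \<in> {..<2 * n}" "a \<in> {..<b}"
    then have ab: "a < b" "a < 2 * n" "b < 2 * n" by auto
    have c: "\<gamma> a * \<gamma> b \<in> carrier_mat dim dim" using ab by (intro sq_mult carrier)
    have "gprod [a, b] = \<gamma> a * \<gamma> b"
      using carrier[OF ab(3)] by simp
    then have g: "gammaS n \<gamma> {a, b} = \<i> \<cdot>\<^sub>m (\<gamma> a * \<gamma> b)"
      using ab by (simp add: gammaS_eq sorted_list_of_set_pair numeral_2_eq_2 del: list.map)
    have "\<gamma> b * \<gamma> a = (-1) \<cdot>\<^sub>m (\<gamma> a * \<gamma> b)"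
      using scomm_gamma[OF ab(3,2)] ab(1) by (simp add: scomm_def)
    then have ba: "(\<gamma> b * \<gamma> a) $$ (x, y) = - (\<gamma> a * \<gamma> b) $$ (x, y)"
      using c xy by (simp del: index_mult_mat)
    have xs: "xsign X {a, b} = chi X a * chi X b"
      using ab X by (subst xsign_eq_prod_chi) auto
    have mn: "minor Om {?r, ?s} {a, b} = Om $$ (?r, a) * Om $$ (?s, b) - Om $$ (?r, b) * Om $$ (?s, a)"
      by (rule minor_pair[OF Oc]) (use ab j in auto)
    show "(of_real (xsign X {a, b} * minor Om {?r, ?s} {a, b}) \<cdot>\<^sub>m gammaS n \<gamma> {a, b}) $$ (x, y)
        = \<i> * (F a b + F b a)"
      unfolding g smult_smult_mat F_def ba xs mn using c xy
      by (simp add: algebra_simps del: index_mult_mat)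
  qed
  also have "\<dots> = \<i> * (\<Sum>b<2 * n. \<Sum>a<b. F a b + F b a)"
    by (simp only: sum_distrib_left)
  also have "(\<Sum>b<2 * n. \<Sum>a<b. F a b + F b a) = (\<Sum>a<2 * n. \<Sum>b<2 * n. F a b) - (\<Sum>a<2 * n. F a a)"
    by (simp add: sum_pairs_split)
  also have "(\<Sum>a<2 * n. F a a) = of_real (\<Sum>a<2 * n. Om $$ (?r, a) * Om $$ (?s, a)) * (1\<^sub>m dim) $$ (x, y)"
    unfolding of_real_sum sum_distrib_right F_def
  proof (intro sum.cong refl)
    fix a assume "a \<in> {..<2 * n}"
    then have "\<gamma> a * \<gamma> a = 1\<^sub>m dim" by (intro square) simp
    moreover have "?c ?r a * ?c ?s a = Om $$ (?r, a) * Om $$ (?s, a) * (chi X a * chi X a)"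
      by (simp only: mult_ac)
    ultimately show "of_real (?c ?r a * ?c ?s a) * (\<gamma> a * \<gamma> a) $$ (x, y)
        = of_real (Om $$ (?r, a) * Om $$ (?s, a)) * (1\<^sub>m dim) $$ (x, y)"
      by (simp only: chi_square mult_1_right)
  qed
  also have "(\<Sum>a<2 * n. Om $$ (?r, a) * Om $$ (?s, a)) = 0"
    using orth_rows[OF O, of ?r ?s] j by simp
  also have "(\<Sum>a<2 * n. \<Sum>b<2 * n. F a b) = (rot Om X ?r * rot Om X ?s) $$ (x, y)"
    unfolding rot_mult_index[OF xy] F_def ..
  finally show "gammaOX n \<gamma> Om X {?r, ?s} $$ (x, y) = (\<i> \<cdot>\<^sub>m (rot Om X ?r * rot Om X ?s)) $$ (x, y)"
    using xy rr by (simp del: index_mult_mat)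
qed (simp_all add: gammaOX_def rot_def)

end

section \<open>The parent measurement\<close>

lemma sum_lists_Suc:
  "(\<Sum>xs | set xs \<subseteq> A \<and> length xs = Suc m. f xs) = (\<Sum>x\<in>A. \<Sum>xs | set xs \<subseteq> A \<and> length xs = m. f (x # xs))"
proof -
  have "inj_on (\<lambda>(xs, x). x # xs) ({xs. set xs \<subseteq> A \<and> length xs = m} \<times> A)"
    by (auto simp: inj_on_def)
  then have "(\<Sum>xs | set xs \<subseteq> A \<and> length xs = Suc m. f xs)
      = (\<Sum>(xs, x)\<in>{xs. set xs \<subseteq> A \<and> length xs = m} \<times> A. f (x # xs))"
    unfolding lists_length_Suc_eq by (subst sum.reindex) (simp_all add: split_def)
  also have "\<dots> = (\<Sum>xs | set xs \<subseteq> A \<and> length xs = m. \<Sum>x\<in>A. f (x # xs))"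
    by (rule sum.cartesian_product[symmetric])
  also have "\<dots> = (\<Sum>x\<in>A. \<Sum>xs | set xs \<subseteq> A \<and> length xs = m. f (x # xs))"
    by (rule sum.swap)
  finally show ?thesis .
qed

context majorana_system
begin

text \<open>Multiplying out chooses one column for each row. Lists with repeated columns occur here
  and are removed only by the later sum over X.\<close>

lemma rot_mprod_index:
  assumes "i < dim" "j < dim"
  shows "mprod dim (map (rot Om X) \<rho>s) $$ (i, j)
    = (\<Sum>xs | set xs \<subseteq> {0..<2 * n} \<and> length xs = length \<rho>s.
        of_real (\<Prod>l<length \<rho>s. Om $$ (\<rho>s ! l, xs ! l) * chi X (xs ! l)) * gprod xs $$ (i, j))"
  using assms(1)
proof (induction \<rho>s arbitrary: i)
  case Nil
  have "{xs. set xs \<subseteq> {0..<2 * n} \<and> length xs = length ([] :: nat list)} = {[]}" by auto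
  then show ?case by simp
next
  case (Cons \<rho> \<rho>s)
  let ?c = "\<lambda>\<rho> a. Om $$ (\<rho>, a) * chi X a" and ?L = "{xs. set xs \<subseteq> {0..<2 * n} \<and> length xs = length \<rho>s}"
  let ?C = "\<lambda>xs. \<Prod>l<length \<rho>s. ?c (\<rho>s ! l) (xs ! l)"
  have cc: "mprod dim (map (rot Om X) \<rho>s) \<in> carrier_mat dim dim"
    by (intro mprod_carrier) auto
  have "mprod dim (map (rot Om X) (\<rho> # \<rho>s)) $$ (i, j)
      = (\<Sum>k<dim. rot Om X \<rho> $$ (i, k) * mprod dim (map (rot Om X) \<rho>s) $$ (k, j))"
    using mat_mult_index[OF rot_carrier cc Cons.prems assms(2)] by simp
  also have "\<dots> = (\<Sum>k<dim. (\<Sum>a\<in>{0..<2 * n}. of_real (?c \<rho> a) * \<gamma> a $$ (i, k))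
      * (\<Sum>xs\<in>?L. of_real (?C xs) * gprod xs $$ (k, j)))"
  proof (intro sum.cong refl arg_cong2[of _ _ _ _ times])
    fix k assume "k \<in> {..<dim}"
    then have k: "k < dim" by simp
    show "mprod dim (map (rot Om X) \<rho>s) $$ (k, j) = (\<Sum>xs\<in>?L. of_real (?C xs) * gprod xs $$ (k, j))"
      by (rule Cons.IH[OF k])
    show "rot Om X \<rho> $$ (i, k) = (\<Sum>a\<in>{0..<2 * n}. of_real (?c \<rho> a) * \<gamma> a $$ (i, k))"
      unfolding rot_def msum_index[OF Cons.prems k] atLeast0LessThan
      using Cons.prems k by (intro sum.cong refl) (simp add: carrier_matD[OF carrier])
  qed
  also have "\<dots> = (\<Sum>k<dim. \<Sum>a\<in>{0..<2 * n}. \<Sum>xs\<in>?L.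
      of_real (?c \<rho> a * ?C xs) * (\<gamma> a $$ (i, k) * gprod xs $$ (k, j)))"
    by (simp add: sum_product mult_ac)
  also have "\<dots> = (\<Sum>a\<in>{0..<2 * n}. \<Sum>k<dim. \<Sum>xs\<in>?L.
      of_real (?c \<rho> a * ?C xs) * (\<gamma> a $$ (i, k) * gprod xs $$ (k, j)))"
    by (rule sum.swap)
  also have "\<dots> = (\<Sum>a\<in>{0..<2 * n}. \<Sum>xs\<in>?L. \<Sum>k<dim.
      of_real (?c \<rho> a * ?C xs) * (\<gamma> a $$ (i, k) * gprod xs $$ (k, j)))"
    by (intro sum.cong refl sum.swap)
  also have "\<dots> = (\<Sum>a\<in>{0..<2 * n}. \<Sum>xs\<in>?L. of_real (?c \<rho> a * ?C xs) * gprod (a # xs) $$ (i, j))"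
  proof (intro sum.cong refl)
    fix a xs assume "a \<in> {0..<2 * n}" "xs \<in> ?L"
    then have c: "\<gamma> a \<in> carrier_mat dim dim" "gprod xs \<in> carrier_mat dim dim"
      by (auto intro: carrier gprod_carrier)
    show "(\<Sum>k<dim. of_real (?c \<rho> a * ?C xs) * (\<gamma> a $$ (i, k) * gprod xs $$ (k, j)))
        = of_real (?c \<rho> a * ?C xs) * gprod (a # xs) $$ (i, j)"
      using mat_mult_index[OF c Cons.prems assms(2)] by (simp only: sum_distrib_left[symmetric] list.map mprod_simps)
  qed
  also have "\<dots> = (\<Sum>a\<in>{0..<2 * n}. \<Sum>xs\<in>?L.
      of_real (\<Prod>l<length (\<rho> # \<rho>s). ?c ((\<rho> # \<rho>s) ! l) ((a # xs) ! l)) * gprod (a # xs) $$ (i, j))"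
    by (simp only: list.size(4) One_nat_def add_0_right add_Suc_right prod.lessThan_Suc_shift nth_Cons_0 nth_Cons_Suc)
  finally show ?case by (simp only: sum_lists_Suc list.size(4) One_nat_def add_0_right add_Suc_right)
qed

text \<open>Summing over X with the weight of S leaves exactly the bijections from the rows R to the
  columns S, whose signed products form the Leibniz expansion of the minor.\<close>
lemma sum_xsign_rot_mprod:
  assumes Om: "Om \<in> carrier_mat (2 * n) (2 * n)" and S: "S \<subseteq> {0..<2 * n}" and R: "R \<subseteq> {0..<2 * n}"
    and card: "card S = card R" "even (card S)" and ij: "i < dim" "j < dim"
  shows "(\<Sum>X\<in>Pow {0..<2 * n}. of_real (xsign X S) * mprod dim (map (rot Om X) (sorted_list_of_set R)) $$ (i, j))
    = of_real (2 ^ (2 * n) * minor Om R S) * gprod (sorted_list_of_set S) $$ (i, j)"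
proof -
  let ?U = "{0..<2 * n}" and ?Rs = "sorted_list_of_set R" and ?Ss = "sorted_list_of_set S"
  define m where "m = card R"
  have fin: "finite S" "finite R" using S R finite_subset by blast+
  have len: "length ?Rs = m" "length ?Ss = m" using card fin by (auto simp: m_def)
  let ?L = "{xs. set xs \<subseteq> ?U \<and> length xs = m}"
  let ?P = "\<lambda>xs. \<Prod>l<m. Om $$ (?Rs ! l, xs ! l)"
  have finL: "finite ?L" by (intro finite_lists_length_eq) simp
  have "(\<Sum>X\<in>Pow ?U. of_real (xsign X S) * mprod dim (map (rot Om X) ?Rs) $$ (i, j))
      = (\<Sum>X\<in>Pow ?U. \<Sum>xs\<in>?L. of_real (?P xs * ((\<Prod>a\<in>S. chi X a) * (\<Prod>x\<leftarrow>xs. chi X x))) * gprod xs $$ (i, j))"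
  proof (intro sum.cong refl)
    fix X assume "X \<in> Pow ?U"
    then have "finite X" using finite_subset by auto
    then have xs: "xsign X S = (\<Prod>a\<in>S. chi X a)"
      using fin card by (intro xsign_eq_prod_chi) auto
    have chil: "(\<Prod>x\<leftarrow>xs. chi X x) = (\<Prod>l<m. chi X (xs ! l))" if "xs \<in> ?L" for xs
      using that by (simp add: prod.list_conv_set_nth atLeast0LessThan)
    have "of_real (xsign X S) * mprod dim (map (rot Om X) ?Rs) $$ (i, j)
      = (\<Sum>xs\<in>?L. of_real (xsign X S) * (of_real (\<Prod>l<m. Om $$ (?Rs ! l, xs ! l) * chi X (xs ! l)) * gprod xs $$ (i, j)))"
      unfolding rot_mprod_index[OF ij] len sum_distrib_left ..
    also have "\<dots> = (\<Sum>xs\<in>?L. of_real (?P xs * ((\<Prod>a\<in>S. chi X a) * (\<Prod>x\<leftarrow>xs. chi X x))) * gprod xs $$ (i, j))"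
      by (intro sum.cong refl) (simp add: chil xs prod.distrib)
    finally show "of_real (xsign X S) * mprod dim (map (rot Om X) ?Rs) $$ (i, j)
      = (\<Sum>xs\<in>?L. of_real (?P xs * ((\<Prod>a\<in>S. chi X a) * (\<Prod>x\<leftarrow>xs. chi X x))) * gprod xs $$ (i, j))" .
  qed
  also have "\<dots> = (\<Sum>xs\<in>?L. \<Sum>X\<in>Pow ?U. of_real (?P xs * ((\<Prod>a\<in>S. chi X a) * (\<Prod>x\<leftarrow>xs. chi X x))) * gprod xs $$ (i, j))"
    by (rule sum.swap)
  also have "\<dots> = (\<Sum>xs\<in>?L. of_real (?P xs * (\<Sum>X\<in>Pow ?U. (\<Prod>a\<in>S. chi X a) * (\<Prod>x\<leftarrow>xs. chi X x))) * gprod xs $$ (i, j))"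
    by (intro sum.cong refl) (simp only: sum_distrib_left sum_distrib_right of_real_sum)
  also have "\<dots> = (\<Sum>xs\<in>?L. if set xs = S then of_real (?P xs * 2 ^ (2 * n)) * gprod xs $$ (i, j) else 0)"
  proof (intro sum.cong refl)
    fix xs assume "xs \<in> ?L"
    then have "length xs = card S" using card by (simp add: m_def)
    from sum_chi_list[OF finite_atLeastLessThan S this]
    show "of_real (?P xs * (\<Sum>X\<in>Pow ?U. (\<Prod>a\<in>S. chi X a) * (\<Prod>x\<leftarrow>xs. chi X x))) * gprod xs $$ (i, j)
        = (if set xs = S then of_real (?P xs * 2 ^ (2 * n)) * gprod xs $$ (i, j) else 0)"
      by simp
  qed
  also have "\<dots> = (\<Sum>xs | length xs = m \<and> set xs = set ?Ss. of_real (?P xs * 2 ^ (2 * n)) * gprod xs $$ (i, j))"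
    unfolding sum.inter_filter[OF finL, symmetric] using S fin by (intro sum.cong) auto
  \<comment> \<open>The surviving lists have the length of S and exhaust it, so each is a unique
    rearrangement of the sorted list of S; sorting the operators back then supplies the sign of the
    permutation.\<close>
  also have "\<dots> = (\<Sum>p | p permutes {..<m}. of_real (?P (permute_list p ?Ss) * 2 ^ (2 * n)) * gprod (permute_list p ?Ss) $$ (i, j))"
    by (rule sum.reindex_bij_betw[OF bij_betw_permute_list, symmetric]) (use len in auto)
  also have "\<dots> = (\<Sum>p | p permutes {..<m}. of_real (2 ^ (2 * n) * (of_int (sign p) * (\<Prod>l<m. Om $$ (?Rs ! l, ?Ss ! p l))))
      * gprod ?Ss $$ (i, j))"
  proof (intro sum.cong refl)
    fix p assume "p \<in> {p. p permutes {..<m}}"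
    then have p: "p permutes {..<length ?Ss}" using len by simp
    have "gprod (permute_list p ?Ss) = of_int (sign p) \<cdot>\<^sub>m gprod ?Ss"
      by (rule gprod_permute[OF p]) (use fin S in auto)
    moreover have "gprod ?Ss \<in> carrier_mat dim dim" using S fin by (intro gprod_carrier) auto
    ultimately have g: "gprod (permute_list p ?Ss) $$ (i, j) = of_int (sign p) * gprod ?Ss $$ (i, j)"
      using ij by simp
    have "?P (permute_list p ?Ss) = (\<Prod>l<m. Om $$ (?Rs ! l, ?Ss ! p l))"
      using len by (intro prod.cong refl) (simp add: permute_list_nth[OF p])
    with g show "of_real (?P (permute_list p ?Ss) * 2 ^ (2 * n)) * gprod (permute_list p ?Ss) $$ (i, j)
      = of_real (2 ^ (2 * n) * (of_int (sign p) * (\<Prod>l<m. Om $$ (?Rs ! l, ?Ss ! p l)))) * gprod ?Ss $$ (i, j)"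
      by simp
  qed
  also have "\<dots> = of_real (2 ^ (2 * n) * minor Om R S) * gprod ?Ss $$ (i, j)"
    unfolding minor_eq_sum_permutes[OF Om R S card(1)] m_def[symmetric]
    by (simp only: sum_distrib_left sum_distrib_right of_real_sum)
  finally show ?thesis .
qed

text \<open>Each factor is \<open>1 / 4 ^ n\<close> times a projector, because 2^(-2n-1) is half of
  4^(-n); the prefactor in \<open>GO\<close> removes all but one of these n weights.\<close>

lemma GO_eq_half:
  assumes Om: "orth_mat (2 * n) Om" and n: "n \<ge> 1" and X: "finite X"
  shows "GO n \<gamma> Om q X = of_real (1 / 4 ^ n) \<cdot>\<^sub>m
    mprod dim (map (\<lambda>j. majorana_system.half n (rot Om X) j (q j)) [0..<n])"
proof -
  interpret r: majorana_system n "rot Om X"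
    by unfold_locales (rule rot_majorana[OF Om])
  have GR: "GR n \<gamma> Om {2 * j, 2 * j + 1} (q j) X = of_real (1 / 4 ^ n) \<cdot>\<^sub>m r.half j (q j)" if "j < n" for j
  proof -
    have pw: "2 powr (- 2 * real n - 1) = 1 / 4 ^ n / 2"
    proof -
      have "2 powr (- 2 * real n - 1) = 2 powr (- (2 * real n)) / 2"
        by (simp add: powr_diff)
      also have "2 powr (- (2 * real n)) = 1 / 2 powr (real (2 * n))"
        by (simp add: powr_minus_divide)
      also have "2 powr (real (2 * n)) = 4 ^ n"
        by (subst powr_realpow) (simp_all add: power_mult)
      finally show ?thesis .
    qed
    show ?thesis
      unfolding GR_def pw gammaOX_eq_bil[OF Om that X] r.half_def r.bil_def smult_smult_mat[of "of_real (1 / 4 ^ n)"]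
      by simp
  qed
  have "GO n \<gamma> Om q X = of_real ((2 ^ (2 * n)) ^ (n - 1)) \<cdot>\<^sub>m
      mprod dim (map (\<lambda>j. GR n \<gamma> Om {2 * j, 2 * j + 1} (q j) X) [0..<n])"
    by (simp only: GO_def foldr_eq_mprod)
  also have "map (\<lambda>j. GR n \<gamma> Om {2 * j, 2 * j + 1} (q j) X) [0..<n]
      = map (\<lambda>j. of_real (1 / 4 ^ n) \<cdot>\<^sub>m r.half j (q j)) [0..<n]"
    by (intro map_cong refl GR) simp
  also have "mprod dim \<dots> = of_real (1 / 4 ^ n) ^ n \<cdot>\<^sub>m mprod dim (map (\<lambda>j. r.half j (q j)) [0..<n])"
  proof -
    have "(\<Prod>j\<leftarrow>[0..<n]. of_real (1 / 4 ^ n) :: complex) = of_real (1 / 4 ^ n) ^ n"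
      by (simp only: map_replicate_const prod_list_replicate length_upt diff_zero)
    then show ?thesis
      by (subst mprod_smult) (auto intro: r.half_carrier)
  qed
  also have "of_real ((2 ^ (2 * n)) ^ (n - 1)) \<cdot>\<^sub>m (of_real (1 / 4 ^ n) ^ n \<cdot>\<^sub>m A) = of_real (1 / 4 ^ n) \<cdot>\<^sub>m A" for A :: "complex mat"
  proof -
    \<comment> \<open>The exponent \<open>n - 1\<close> is truncated; n \<ge> 1 makes it one less
      than the number of factors.\<close>
    obtain k where k: "n = Suc k" using n by (cases n) auto
    have "(2 ^ (2 * n)) ^ (n - 1) * (1 / 4 ^ n) ^ n = (1 / 4 ^ n :: real)"
      by (simp add: k power_mult power_divide flip: power_mult) (simp add: power_mult)
    then have "of_real ((2 ^ (2 * n)) ^ (n - 1)) * of_real (1 / 4 ^ n) ^ n = (of_real (1 / 4 ^ n) :: complex)"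
      by (metis of_real_mult of_real_power)
    then show ?thesis by (simp only: smult_smult_mat)
  qed
  finally show ?thesis .
qed

text \<open>Weighting by the signs of the pairs in T extracts the product of the rotated operators
  on these pairs. The empty T gives the normalisation of the measurement, a general T its
  correlations.\<close>

lemma sum_signvecs_GO:
  assumes Om: "orth_mat (2 * n) Om" and n: "n \<ge> 1" and X: "finite X" and T: "T \<subseteq> {..<n}" and ij: "i < dim" "j < dim"
  shows "(\<Sum>q\<in>signvecs n. of_int (\<Prod>j\<in>T. q j) * GO n \<gamma> Om q X $$ (i, j))
    = of_real (1 / 4 ^ n) * (\<i> ^ card T * mprod dim (map (rot Om X) (sorted_list_of_set (\<Union>j\<in>T. {2 * j, 2 * j + 1}))) $$ (i, j))"
proof -
  interpret r: majorana_system n "rot Om X"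
    by unfold_locales (rule rot_majorana[OF Om])
  let ?H = "\<lambda>q. mprod dim (map (\<lambda>j. r.half j (q j)) [0..<n])"
  have H: "?H q \<in> carrier_mat dim dim" for q by (intro mprod_carrier) (auto intro: r.half_carrier)
  have TI: "T \<inter> {..<n} = T" using T by auto
  have "(\<Sum>q\<in>signvecs n. of_int (\<Prod>j\<in>T. q j) * GO n \<gamma> Om q X $$ (i, j))
      = (\<Sum>q\<in>signvecs n. of_real (1 / 4 ^ n) * (of_int (\<Prod>j\<in>T. q j) * ?H q $$ (i, j)))"
    using ij carrier_matD[OF H] by (intro sum.cong refl) (simp add: GO_eq_half[OF Om n X])
  also have "\<dots> = of_real (1 / 4 ^ n) * (\<Sum>q\<in>signvecs n. of_int (\<Prod>j\<in>T \<inter> {..<n}. q j) * ?H q $$ (i, j))"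
    by (simp only: sum_distrib_left TI)
  also have "\<dots> = of_real (1 / 4 ^ n) * (\<i> ^ card T \<cdot>\<^sub>m r.gprod (filter (\<lambda>i. i div 2 \<in> T) [0..<2 * n])) $$ (i, j)"
    using r.sum_signvecs_half[OF order_refl ij, of T] r.mprod_bil_eq_gprod[OF order_refl T] by (simp only: TI)
  also have "r.gprod (filter (\<lambda>i. i div 2 \<in> T) [0..<2 * n]) \<in> carrier_mat dim dim"
    by (intro r.gprod_carrier) auto
  then have "(\<i> ^ card T \<cdot>\<^sub>m r.gprod (filter (\<lambda>i. i div 2 \<in> T) [0..<2 * n])) $$ (i, j)
      = \<i> ^ card T * r.gprod (filter (\<lambda>i. i div 2 \<in> T) [0..<2 * n]) $$ (i, j)"
    using ij by simp
  finally show ?thesis by (simp only: sorted_list_of_pair_union[OF T])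
qed

text \<open>Classical post-processing: every S is assigned one matrix and one R with a large minor.
  If the outcome comes from that matrix, the answer is biased by the signs of R and X; otherwise it
  is a fair coin, which costs the factor 1/N in the sharpness.\<close>

lemma parent_jointly_measures:
  assumes n: "n \<ge> 1" and N: "N \<ge> 1" and Om: "\<And>r. r < N \<Longrightarrow> orth_mat (2 * n) (Om r)" and \<eta>: "0 < \<eta>"
    and minor: "\<And>S. S \<in> Sm n (2 * k) \<Longrightarrow> \<exists>r<N. \<exists>R\<in>D2k n k. \<eta> \<le> \<bar>minor (Om r) R S\<bar>"
  shows "jointly_measures (2 ^ n) (LambdaN N n) (Gmix N n \<gamma> Om) (Sm n (2 * k)) {1, -1} (Mobs n \<gamma> (\<eta> / N))"
proof -
  let ?G = "Gmix N n \<gamma> Om" and ?\<Lambda> = "LambdaN N n" and ?U = "{0..<2 * n}"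
  have finX: "finite X" if "X \<in> Pow ?U" for X using that finite_subset by auto
  have GOc: "GO n \<gamma> (Om r) q X \<in> carrier_mat dim dim \<and> psd_mat (GO n \<gamma> (Om r) q X)"
    if "r < N" "q \<in> signvecs n" "X \<in> Pow ?U" for r q X
  proof -
    interpret r: majorana_system n "rot (Om r) X"
      by unfold_locales (rule rot_majorana[OF Om[OF that(1)]])
    have "psd_mat (mprod dim (map (\<lambda>j. r.half j (q j)) [0..<n]))"
      using that(2) by (intro r.half_mprod_psd) (auto simp: signvecs_def)
    moreover have "mprod dim (map (\<lambda>j. r.half j (q j)) [0..<n]) \<in> carrier_mat dim dim"
      by (intro mprod_carrier) (auto intro: r.half_carrier)
    ultimately show ?thesis
      unfolding GO_eq_half[OF Om[OF that(1)] n finX[OF that(3)]]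
      by (intro conjI smult_carrier_mat psd_smult) auto
  qed
  have Gc: "?G l \<in> carrier_mat dim dim \<and> psd_mat (?G l)" if "l \<in> ?\<Lambda>" for l
    using that GOc psd_smult[of _ "1 / real N"] by (auto simp: LambdaN_eq Gmix_def)
  have Gi: "?G (r, q, X) $$ (i, j) = of_real (1 / N) * GO n \<gamma> (Om r) q X $$ (i, j)"
    if "r < N" "q \<in> signvecs n" "X \<in> Pow ?U" "i < dim" "j < dim" for r q X i j
    using carrier_matD[OF conjunct1[OF GOc[OF that(1-3)]]] that(4,5) by (simp add: Gmix_def)
  \<comment> \<open>Empty T: the weight is 1 and the operator product is the identity. The remaining
    \<open>1 / 4 ^ n\<close> is the inverse of the number of sets X.\<close>
  have total: "(\<Sum>q\<in>signvecs n. GO n \<gamma> (Om r) q X $$ (i, j)) = of_real (1 / 4 ^ n) * (1\<^sub>m dim) $$ (i, j)"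
    if "r < N" "X \<in> Pow ?U" "i < dim" "j < dim" for r X i j
    using sum_signvecs_GO[OF Om[OF that(1)] n finX[OF that(2)], of "{}" i j] that by simp
  have sumG: "(\<Sum>l\<in>?\<Lambda>. ?G l $$ (i, j)) = (1\<^sub>m dim) $$ (i, j)" if ij: "i < dim" "j < dim" for i j
  proof -
    have "(\<Sum>l\<in>?\<Lambda>. ?G l $$ (i, j)) = (\<Sum>r<N. \<Sum>X\<in>Pow ?U. of_real (1 / N) * (of_real (1 / 4 ^ n) * (1\<^sub>m dim) $$ (i, j)))"
      unfolding sum_LambdaN
    proof (intro sum.cong refl)
      fix r X assume rX: "r \<in> {..<N}" "X \<in> Pow ?U"
      then have "(\<Sum>q\<in>signvecs n. ?G (r, q, X) $$ (i, j)) = of_real (1 / N) * (\<Sum>q\<in>signvecs n. GO n \<gamma> (Om r) q X $$ (i, j))"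
        unfolding sum_distrib_left using ij by (intro sum.cong refl Gi) auto
      also have "\<dots> = of_real (1 / N) * (of_real (1 / 4 ^ n) * (1\<^sub>m dim) $$ (i, j))"
        using rX ij by (simp only: total lessThan_iff)
      finally show "(\<Sum>q\<in>signvecs n. ?G (r, q, X) $$ (i, j)) = of_real (1 / N) * (of_real (1 / 4 ^ n) * (1\<^sub>m dim) $$ (i, j))" .
    qed
    also have "\<dots> = (1\<^sub>m dim) $$ (i, j)"
      using N by (simp add: card_Pow power_mult)
    finally show ?thesis .
  qed
  have povm: "is_povm dim ?\<Lambda> ?G"
    unfolding is_povm_def
  proof (intro conjI ballI)
    show "finite ?\<Lambda>" by (simp add: LambdaN_eq)
    show "msum dim ?G ?\<Lambda> = 1\<^sub>m dim"
      by (rule eq_matI) (auto simp: sumG)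
  qed (use Gc in auto)
  \<comment> \<open>R is recorded by the set of numbers of its pairs, since its sign is the product
    of q over that set.\<close>
  define ok where "ok S p \<longleftrightarrow> fst p < N \<and> snd p \<subseteq> {..<n} \<and> card (snd p) = k \<and>
      \<eta> \<le> \<bar>minor (Om (fst p)) (\<Union>j\<in>snd p. {2 * j, 2 * j + 1}) S\<bar>" for S p
  have "\<exists>p. ok S p" if S: "S \<in> Sm n (2 * k)" for S
  proof -
    obtain r R where "r < N" "R \<in> D2k n k" "\<eta> \<le> \<bar>minor (Om r) R S\<bar>"
      using minor[OF S] by blast
    moreover from this obtain T where "T \<subseteq> {..<n}" "card T = k" "R = (\<Union>j\<in>T. {2 * j, 2 * j + 1})"
      by (elim D2k_obtain)
    ultimately have "ok S (r, T)" by (simp add: ok_def)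
    then show ?thesis ..
  qed
  then have "\<forall>S\<in>Sm n (2 * k). \<exists>p. ok S p" by blast
  from bchoice[OF this] obtain f where f: "\<forall>S\<in>Sm n (2 * k). ok S (f S)" ..
  define r T where "r S = fst (f S)" and "T S = snd (f S)" for S
  have rT: "r S < N" "T S \<subseteq> {..<n}" "card (T S) = k"
      "\<eta> \<le> \<bar>minor (Om (r S)) (\<Union>j\<in>T S. {2 * j, 2 * j + 1}) S\<bar>" if "S \<in> Sm n (2 * k)" for S
    using bspec[OF f that] by (auto simp: ok_def r_def T_def)
  \<comment> \<open>Damping by \<eta> over the minor gives all S the same sharpness and absorbs the
    sign of the minor; the lower bound on the minor keeps the bias within [-1, 1].\<close>
  define \<mu> where "\<mu> S = \<eta> / minor (Om (r S)) (\<Union>j\<in>T S. {2 * j, 2 * j + 1}) S" for S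
  define b where "b S l = (case l of (r', q, X) \<Rightarrow> if r' = r S then \<mu> S * (of_int (\<Prod>j\<in>T S. q j) * xsign X S) else 0)" for S l
  \<comment> \<open>\<open>b S l\<close> is the mean of the answer given l, and D is the
    distribution on the two signs with this mean.\<close>
  define D where "D e S l = (1 + of_int e * b S l) / 2" for e :: int and S and l :: "nat \<times> (nat \<Rightarrow> int) \<times> nat set"
  have b: "\<bar>b S l\<bar> \<le> 1" if S: "S \<in> Sm n (2 * k)" and l: "l \<in> ?\<Lambda>" for S l
  proof -
    obtain r' q X where l': "l = (r', q, X)" "q \<in> signvecs n" using l by (auto simp: LambdaN_eq)
    have "\<bar>\<Prod>j\<in>T S. q j\<bar> = 1"
      using l'(2) rT(2)[OF S] by (auto simp: abs_prod signvecs_def intro!: prod.neutral)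
    then have "\<bar>of_int (\<Prod>j\<in>T S. q j) :: real\<bar> = 1" by (metis of_int_1 of_int_abs)
    moreover have "\<bar>xsign X S\<bar> = 1" using xsign_cases[of X S] by auto
    moreover have "\<bar>\<mu> S\<bar> \<le> 1" using rT(4)[OF S] \<eta> by (simp add: \<mu>_def)
    ultimately show ?thesis by (simp add: b_def l' abs_mult)
  qed
  have sumb: "(\<Sum>l\<in>?\<Lambda>. of_real (b S l) * ?G l $$ (i, j)) = of_real (\<eta> / N) * gammaS n \<gamma> S $$ (i, j)"
    if S: "S \<in> Sm n (2 * k)" and ij: "i < dim" "j < dim" for S i j
  proof -
    let ?R = "\<Union>j\<in>T S. {2 * j, 2 * j + 1}" and ?c = "of_real (1 / N) * (of_real (\<mu> S) * (of_real (1 / 4 ^ n) * \<i> ^ k)) :: complex"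
    have SU: "S \<subseteq> ?U" "card S = 2 * k" using S by (auto simp: Sm_def)
    have finT: "finite (T S)" using rT(2)[OF S] finite_subset by blast
    have RU: "?R \<subseteq> ?U" using rT(2)[OF S] by auto
    have Omc: "Om (r S) \<in> carrier_mat (2 * n) (2 * n)"
      using Om[OF rT(1)[OF S]] by (simp add: orth_mat_def)
    have "(\<Sum>l\<in>?\<Lambda>. of_real (b S l) * ?G l $$ (i, j))
        = (\<Sum>r'<N. if r' = r S then \<Sum>X\<in>Pow ?U. \<Sum>q\<in>signvecs n. of_real (b S (r S, q, X)) * ?G (r S, q, X) $$ (i, j) else 0)"
      unfolding sum_LambdaN by (intro sum.cong refl) (simp add: b_def)
    also have "\<dots> = (\<Sum>X\<in>Pow ?U. \<Sum>q\<in>signvecs n. of_real (b S (r S, q, X)) * ?G (r S, q, X) $$ (i, j))"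
      using rT(1)[OF S] by simp
    also have "\<dots> = (\<Sum>X\<in>Pow ?U. of_real (1 / N) * (of_real (\<mu> S) * (of_real (xsign X S)
        * (\<Sum>q\<in>signvecs n. of_int (\<Prod>j\<in>T S. q j) * GO n \<gamma> (Om (r S)) q X $$ (i, j)))))"
      unfolding sum_distrib_left
      using rT(1)[OF S] ij by (intro sum.cong refl) (simp add: b_def Gi mult_ac)
    also have "\<dots> = (\<Sum>X\<in>Pow ?U. ?c * (of_real (xsign X S)
        * mprod dim (map (rot (Om (r S)) X) (sorted_list_of_set ?R)) $$ (i, j)))"
    proof (intro sum.cong refl)
      fix X assume "X \<in> Pow ?U"
      from sum_signvecs_GO[OF Om[OF rT(1)[OF S]] n finX[OF this] rT(2)[OF S] ij]
      show "of_real (1 / N) * (of_real (\<mu> S) * (of_real (xsign X S)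
          * (\<Sum>q\<in>signvecs n. of_int (\<Prod>j\<in>T S. q j) * GO n \<gamma> (Om (r S)) q X $$ (i, j))))
        = ?c * (of_real (xsign X S) * mprod dim (map (rot (Om (r S)) X) (sorted_list_of_set ?R)) $$ (i, j))"
        by (simp only: rT(3)[OF S] mult_ac)
    qed
    also have "\<dots> = ?c * (of_real (2 ^ (2 * n) * minor (Om (r S)) ?R S) * gprod (sorted_list_of_set S) $$ (i, j))"
      unfolding sum_distrib_left[symmetric]
      by (subst sum_xsign_rot_mprod[OF Omc SU(1) RU _ _ ij])
        (simp_all add: SU pair_union_card[OF finT, simplified] rT(3)[OF S])
    also have "\<dots> = of_real (1 / N * (\<mu> S * minor (Om (r S)) ?R S) * (2 ^ (2 * n) / 4 ^ n)) * (\<i> ^ k * gprod (sorted_list_of_set S) $$ (i, j))"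
      by simp
    also have "\<mu> S * minor (Om (r S)) ?R S = \<eta>"
      using rT(4)[OF S] \<eta> by (auto simp: \<mu>_def)
    also have "2 ^ (2 * n) / 4 ^ n = (1 :: real)" by (simp add: power_mult)
    also have "\<i> ^ k * gprod (sorted_list_of_set S) $$ (i, j) = gammaS n \<gamma> S $$ (i, j)"
      using ij SU finite_subset[OF SU(1)]
      by (simp add: gammaS_eq i_power_choose_2 carrier_matD[OF gprod_carrier])
    finally show ?thesis by simp
  qed
  have gS: "gammaS n \<gamma> S \<in> carrier_mat dim dim" if "S \<in> Sm n (2 * k)" for S
    using that finite_subset[of S ?U] by (auto simp: gammaS_eq Sm_def intro!: smult_carrier_mat gprod_carrier)
  have "Mobs n \<gamma> (\<eta> / N) S e = msum dim (\<lambda>l. of_real (D e S l) \<cdot>\<^sub>m ?G l) ?\<Lambda>"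
    if S: "S \<in> Sm n (2 * k)" for S e
  proof (rule eq_matI)
    fix i j assume "i < dim_row (msum dim (\<lambda>l. of_real (D e S l) \<cdot>\<^sub>m ?G l) ?\<Lambda>)"
      "j < dim_col (msum dim (\<lambda>l. of_real (D e S l) \<cdot>\<^sub>m ?G l) ?\<Lambda>)"
    then have ij: "i < dim" "j < dim" by auto
    have "msum dim (\<lambda>l. of_real (D e S l) \<cdot>\<^sub>m ?G l) ?\<Lambda> $$ (i, j) = (\<Sum>l\<in>?\<Lambda>. of_real (D e S l) * ?G l $$ (i, j))"
      unfolding msum_index[OF ij]
    proof (intro sum.cong refl)
      fix l assume "l \<in> ?\<Lambda>"
      then show "(of_real (D e S l) \<cdot>\<^sub>m ?G l) $$ (i, j) = of_real (D e S l) * ?G l $$ (i, j)"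
        using carrier_matD[OF conjunct1[OF Gc]] ij by simp
    qed
    also have "\<dots> = (\<Sum>l\<in>?\<Lambda>. (1 / 2) * ?G l $$ (i, j) + (of_int e / 2) * (of_real (b S l) * ?G l $$ (i, j)))"
      by (intro sum.cong refl) (simp add: D_def field_simps)
    also have "\<dots> = (1 / 2) * (1\<^sub>m dim) $$ (i, j) + (of_int e / 2) * (of_real (\<eta> / N) * gammaS n \<gamma> S $$ (i, j))"
      by (simp only: sum.distrib sum_distrib_left[symmetric] sumG[OF ij] sumb[OF S ij])
    also have "\<dots> = Mobs n \<gamma> (\<eta> / N) S e $$ (i, j)"
      using gS[OF S] ij by (simp add: Mobs_def field_simps)
    finally show "Mobs n \<gamma> (\<eta> / N) S e $$ (i, j) = msum dim (\<lambda>l. of_real (D e S l) \<cdot>\<^sub>m ?G l) ?\<Lambda> $$ (i, j)" by simp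
  qed (use gS[OF S] in \<open>auto simp: Mobs_def\<close>)
  moreover have "D e S l \<ge> 0" if "S \<in> Sm n (2 * k)" "l \<in> ?\<Lambda>" "e \<in> {1, -1}" for e S l
    using b[OF that(1,2)] that(3) by (auto simp: D_def)
  moreover have "(\<Sum>e\<in>{1, -1}. D e S l) = 1" for S l
    by (simp add: D_def field_simps)
  ultimately show ?thesis
    unfolding jointly_measures_def using povm by blast
qed

end

section \<open>Hadamard rows, orthonormal completion, generalised permutations\<close>

text \<open>Sylvester's Hadamard matrix: for i, j < 2^a the entry is -1 to the number of binary
  digits equal to 1 in both i and j. This is why p is taken to be a power of two.\<close>

fun had :: "nat \<Rightarrow> nat \<Rightarrow> nat \<Rightarrow> real" where
  "had 0 i j = 1"
| "had (Suc a) i j = (if 2 ^ a \<le> i \<and> 2 ^ a \<le> j then -1 else 1) * had a (i mod 2 ^ a) (j mod 2 ^ a)"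

lemma abs_had [simp]: "\<bar>had a i j\<bar> = 1"
  by (induction a arbitrary: i j) (auto simp: abs_mult)

lemma sum_lessThan_add: "(\<Sum>j<m + k. f j) = (\<Sum>j<m. f j) + (\<Sum>j<k. f (m + j :: nat) :: real)"
  by (induction k) (simp_all add: add.assoc)

text \<open>The right half of the columns repeats the left half up to the sign \<open>s i\<close> of
  the row, so the inner product is that of the previous order times \<open>1 + s i * s i'\<close>.
  This factor kills rows with different top digits; otherwise the rows are equal exactly if their
  remainders are.\<close>

lemma had_orth:
  assumes "i < 2 ^ a" "i' < 2 ^ a"
  shows "(\<Sum>j<2 ^ a. had a i j * had a i' j) = (if i = i' then 2 ^ a else 0)"
  using assms
proof (induction a arbitrary: i i')
  case (Suc a)
  define m :: nat where "m = 2 ^ a"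
  have m: "m > 0" by (simp add: m_def)
  define s :: "nat \<Rightarrow> real" where "s i = (if m \<le> i then -1 else 1)" for i
  have IH: "(\<Sum>j<m. had a (i mod m) j * had a (i' mod m) j) = (if i mod m = i' mod m then m else 0)"
    using Suc.IH[of "i mod m" "i' mod m"] m by (simp add: m_def)
  have low: "had (Suc a) l j = had a (l mod m) j" if "j < m" for l j
    using that by (simp add: m_def)
  have high: "had (Suc a) l (m + j) = s l * had a (l mod m) j" if "j < m" for l j
    using that by (simp add: m_def s_def)
  have "(\<Sum>j<2 ^ Suc a. had (Suc a) i j * had (Suc a) i' j)
      = (\<Sum>j<m + m. had (Suc a) i j * had (Suc a) i' j)"
    by (simp add: m_def mult_2)
  also have "\<dots> = (\<Sum>j<m. had a (i mod m) j * had a (i' mod m) j)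
      + s i * s i' * (\<Sum>j<m. had a (i mod m) j * had a (i' mod m) j)"
    unfolding sum_lessThan_add sum_distrib_left
    by (intro arg_cong2[of _ _ _ _ "(+)"] sum.cong refl) (simp_all add: low high mult_ac del: had.simps)
  also have "\<dots> = (1 + s i * s i') * (if i mod m = i' mod m then m else 0)"
    by (simp only: IH distrib_right mult_1)
  also have "\<dots> = (if i = i' then 2 ^ Suc a else 0)"
  proof -
    have lt: "i < 2 * m" "i' < 2 * m" using Suc.prems by (simp_all add: m_def)
    have md: "l mod m = (if m \<le> l then l - m else l)" if "l < 2 * m" for l
      using that by (auto simp: mod_if)
    have pow: "2 ^ Suc a = 2 * real m" by (simp add: m_def)
    show ?thesis
      unfolding md[OF lt(1)] md[OF lt(2)] s_def pow using lt by auto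
  qed
  finally show ?case .
qed simp

text \<open>A missing row is found in the kernel of the matrix whose unassigned rows are set to zero.\<close>
lemma orthonormal_rows_completion:
  fixes v :: "nat \<Rightarrow> nat \<Rightarrow> real"
  assumes "I \<subseteq> {..<d}"
    and "\<And>i j. i \<in> I \<Longrightarrow> j \<in> I \<Longrightarrow> (\<Sum>a<d. v i a * v j a) = (if i = j then 1 else 0)"
  shows "\<exists>Om. orth_mat d Om \<and> (\<forall>i\<in>I. \<forall>a<d. Om $$ (i, a) = v i a)"
  using assms
proof (induction "card ({..<d} - I)" arbitrary: I v)
  case 0
  then have I: "I = {..<d}" by auto
  define Om where "Om = mat d d (\<lambda>(i, a). v i a)"
  have c: "Om \<in> carrier_mat d d" "transpose_mat Om \<in> carrier_mat d d" by (simp_all add: Om_def)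
  have "Om * transpose_mat Om = 1\<^sub>m d"
    by (rule eq_matI) (use 0 I in \<open>auto simp: Om_def scalar_prod_def atLeast0LessThan\<close>)
  then have "transpose_mat Om * Om = 1\<^sub>m d"
    using mat_mult_left_right_inverse c by blast
  then show ?case using c(1) I by (auto simp: orth_mat_def Om_def intro!: exI[of _ Om])
next
  case (Suc c)
  then obtain i0 where i0: "i0 < d" "i0 \<notin> I"
    by (metis DiffE all_not_in_conv card.empty lessThan_iff nat.distinct(1))
  define A where "A = mat d d (\<lambda>(i, a). if i \<in> I then v i a else 0)"
  have A: "A \<in> carrier_mat d d" by (simp add: A_def)
  have "det A = 0"
    unfolding det_def'[OF A]
  proof (rule sum.neutral, rule ballI)
    fix q assume "q \<in> {p. p permutes {0..<d}}"
    then have "q i0 < d" using i0 permutes_in_image[of q "{0..<d}" i0] by simp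
    then have "A $$ (i0, q i0) = 0" using i0 by (simp add: A_def)
    then have "(\<Prod>i = 0..<d. A $$ (i, q i)) = 0" using i0 by (intro prod_zero) auto
    then show "signof q * (\<Prod>i = 0..<d. A $$ (i, q i)) = 0" by simp
  qed
  then obtain w where w: "w \<in> carrier_vec d" "w \<noteq> 0\<^sub>v d" "A *\<^sub>v w = 0\<^sub>v d"
    using det_0_iff_vec_prod_zero[OF A] by blast
  have orth: "(\<Sum>a<d. v i a * w $ a) = 0" if "i \<in> I" for i
  proof -
    have i: "i < d" using that Suc.prems by auto
    then have "(A *\<^sub>v w) $ i = (\<Sum>a<d. A $$ (i, a) * w $ a)"
      using A w(1) by (auto simp: scalar_prod_def atLeast0LessThan)
    also have "\<dots> = (\<Sum>a<d. v i a * w $ a)"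
      using that i by (intro sum.cong refl) (simp add: A_def)
    finally show ?thesis using w(3) i by simp
  qed
  define s where "s = (\<Sum>a<d. (w $ a)\<^sup>2)"
  have "s > 0"
  proof -
    obtain a where "a < d" "w $ a \<noteq> 0"
    proof (rule ccontr)
      assume "\<not> thesis"
      then have "w = 0\<^sub>v d" using that w(1) by (intro eq_vecI) auto
      then show False using w(2) by simp
    qed
    then show ?thesis unfolding s_def by (intro sum_pos2[of _ a]) auto
  qed
  define v' where "v' = v(i0 := (\<lambda>a. w $ a / sqrt s))"
  have v'I: "v' i = v i" if "i \<in> I" for i using that i0 by (auto simp: v'_def)
  have v'0: "v' i0 = (\<lambda>a. w $ a / sqrt s)" by (simp add: v'_def)
  have mixed: "(\<Sum>a<d. v i a * (w $ a / sqrt s)) = 0" if "i \<in> I" for i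
    using orth[OF that] by (simp add: sum_divide_distrib[symmetric])
  have unit: "(\<Sum>a<d. (w $ a / sqrt s) * (w $ a / sqrt s)) = 1"
    using \<open>s > 0\<close> by (simp add: s_def sum_divide_distrib[symmetric] power2_eq_square)
  have ON: "(\<Sum>a<d. v' i a * v' j a) = (if i = j then 1 else 0)" if ij: "i \<in> insert i0 I" "j \<in> insert i0 I" for i j
  proof -
    consider "i \<in> I" "j \<in> I" | "i = i0" "j \<in> I" | "i \<in> I" "j = i0" | "i = i0" "j = i0"
      using ij by blast
    then show ?thesis
    proof cases
      case 1
      then show ?thesis using Suc.prems(2) by (simp add: v'I)
    next
      case 2
      then have "i \<noteq> j" using i0 by auto
      have "(\<Sum>a<d. v' i a * v' j a) = (\<Sum>a<d. v j a * (w $ a / sqrt s))"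
        unfolding 2(1) v'0 v'I[OF 2(2)] by (simp only: mult.commute)
      then show ?thesis using mixed[OF 2(2)] \<open>i \<noteq> j\<close> by simp
    next
      case 3
      then have "i \<noteq> j" using i0 by auto
      then show ?thesis unfolding 3(2) v'0 v'I[OF 3(1)] using mixed[OF 3(1)] 3(2) by simp
    next
      case 4
      then show ?thesis unfolding 4 v'0 using unit by simp
    qed
  qed
  have "{..<d} - insert i0 I = ({..<d} - I) - {i0}" by auto
  then have "c = card ({..<d} - insert i0 I)" using Suc.hyps(2) i0 by simp
  from Suc.hyps(1)[OF this, of v'] ON Suc.prems(1) i0(1)
  obtain Om where "orth_mat d Om" "\<forall>i\<in>insert i0 I. \<forall>a<d. Om $$ (i, a) = v' i a" by auto
  then show ?case using v'I by auto
qed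

text \<open>A single permutation survives in the Leibniz expansion, the one matching row
  \<open>r i\<close> with column \<open>c i\<close>. The submatrix sorts both index sets, so the
  sign of that permutation depends on the enumerations; the absolute value discards it.\<close>

lemma minor_generalised_permutation:
  fixes m :: nat
  assumes A: "A \<in> carrier_mat d d" and r: "inj_on r {..<m}" "r ` {..<m} \<subseteq> {0..<d}"
    and c: "inj_on c {..<m}" "c ` {..<m} \<subseteq> {0..<d}"
    and zero: "\<And>i j. i < m \<Longrightarrow> j < m \<Longrightarrow> i \<noteq> j \<Longrightarrow> A $$ (r i, c j) = 0"
  shows "\<bar>minor A (r ` {..<m}) (c ` {..<m})\<bar> = (\<Prod>i<m. \<bar>A $$ (r i, c i)\<bar>)"
proof -
  let ?R = "r ` {..<m}" and ?S = "c ` {..<m}"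
  let ?Rs = "sorted_list_of_set ?R" and ?Ss = "sorted_list_of_set ?S"
  \<comment> \<open>The column matched with row \<rho>; read along the sorted rows it yields the
    surviving permutation \<open>p0\<close>.\<close>
  define f where "f \<rho> = c (inv_into {..<m} r \<rho>)" for \<rho>
  have fr: "f (r i) = c i" if "i < m" for i using that r(1) by (simp add: f_def)
  have card: "card ?R = m" "card ?S = m" using r(1) c(1) by (simp_all add: card_image)
  have len: "length ?Rs = m" "length ?Ss = m" using card by simp_all
  have bij: "bij_betw (\<lambda>p. permute_list p ?Ss) {p. p permutes {..<m}} {xs. length xs = m \<and> set xs = set ?Ss}"
    by (rule bij_betw_permute_list) (use len in auto)
  have "set (map f ?Rs) = set ?Ss"
    using fr by (auto simp: image_image)
  then have "map f ?Rs \<in> (\<lambda>p. permute_list p ?Ss) ` {p. p permutes {..<m}}"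
    unfolding bij_betw_imp_surj_on[OF bij] using len by simp
  then obtain p0 where p0: "p0 permutes {..<m}" "permute_list p0 ?Ss = map f ?Rs"
    by (elim imageE) auto
  have p0i: "?Ss ! p0 l = f (?Rs ! l)" if "l < m" for l
    using that permute_list_nth[of p0 ?Ss l] p0 len by (metis nth_map)
  let ?t = "\<lambda>p. of_int (sign p) * (\<Prod>l<m. A $$ (?Rs ! l, ?Ss ! p l))"
  have "?t p = 0" if p: "p permutes {..<m}" "p \<noteq> p0" for p
  proof -
    have "permute_list p ?Ss \<noteq> permute_list p0 ?Ss"
      using inj_onD[OF bij_betw_imp_inj_on[OF bij], of p p0] p p0(1) by blast
    then obtain l where "l < m" "permute_list p ?Ss ! l \<noteq> permute_list p0 ?Ss ! l"
      using nth_equalityI[of "permute_list p ?Ss" "permute_list p0 ?Ss"] len by auto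
    then have l: "l < m" "?Ss ! p l \<noteq> ?Ss ! p0 l"
      using permute_list_nth[of p ?Ss l] permute_list_nth[of p0 ?Ss l] p(1) p0(1) len by simp_all
    obtain i where i: "i < m" "?Rs ! l = r i"
      using l(1) len nth_mem[of l ?Rs] by auto
    have "p l < m" using l p(1) permutes_in_image[OF p(1), of l] by simp
    then obtain j where j: "j < m" "?Ss ! p l = c j"
      using len nth_mem[of "p l" ?Ss] by auto
    have "i \<noteq> j" using l(2) p0i[OF l(1)] i j fr by auto
    then have "A $$ (?Rs ! l, ?Ss ! p l) = 0" using zero i j by simp
    then have "(\<Prod>l<m. A $$ (?Rs ! l, ?Ss ! p l)) = 0" using l(1) by (intro prod_zero) auto
    then show ?thesis by simp
  qed
  then have "(\<Sum>p | p permutes {..<m}. ?t p) = (\<Sum>p\<in>{p0}. ?t p)"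
    using p0(1) by (intro sum.mono_neutral_right) (auto simp: finite_permutations)
  then have "minor A ?R ?S = ?t p0"
    using minor_eq_sum_permutes[OF A r(2) c(2)] card by simp
  then have "\<bar>minor A ?R ?S\<bar> = (\<Prod>l<m. \<bar>A $$ (?Rs ! l, f (?Rs ! l))\<bar>)"
    by (simp add: abs_mult abs_prod p0i sign_def)
  also have "\<dots> = (\<Prod>x\<leftarrow>?Rs. \<bar>A $$ (x, f x)\<bar>)"
    using len by (simp add: prod.list_conv_set_nth atLeast0LessThan)
  also have "\<dots> = (\<Prod>x\<in>?R. \<bar>A $$ (x, f x)\<bar>)"
    by (subst prod.distinct_set_conv_list[symmetric]) auto
  also have "\<dots> = (\<Prod>i<m. \<bar>A $$ (r i, c i)\<bar>)"
    using r(1) fr by (subst prod.reindex) auto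
  finally show ?thesis .
qed

section \<open>The column grid\<close>

lemma add_mod_inj:
  assumes "(v + s) mod p = (v' + s) mod p" "v < p" "v' < (p :: nat)"
  shows "v = v'"
proof -
  obtain q q' where "v + s + p * q = v' + s + p * q'"
    using assms(1) nat_mod_eq_iff by blast
  then have "(v + p * q) mod p = (v' + p * q') mod p" by simp
  then show ?thesis using assms(2,3) by simp
qed

text \<open>Columns are read as lines of length p, the line of x being \<open>x div p\<close>. The
  line is rotated cyclically by its own amount g, and the resulting place within the line is the
  block; so a complete line meets every block exactly once.\<close>

definition shift_block :: "nat \<Rightarrow> (nat \<Rightarrow> nat) \<Rightarrow> nat \<Rightarrow> nat" where
  "shift_block p g x = (x mod p + g (x div p)) mod p"

text \<open>The lower bound on n provides enough pairs of rows for all pairs of blocks and makes the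
  first two levels complete. The upper bound leaves fewer than 8 p^2 columns, hence at most 8
  levels.\<close>

locale column_grid =
  fixes n a p :: nat and g :: "nat \<Rightarrow> nat"
  assumes p: "p = 2 ^ a" and pp_le: "p * p \<le> n" and pp_gt: "n < 4 * (p * p)"
begin

text \<open>Digits of x in base p: the lowest one becomes \<open>blk\<close> through the shift,
  \<open>pos\<close> is the second one and selects the Hadamard column, and \<open>lev\<close> is
  everything above. The members of a fibre have different levels.\<close>

definition pos :: "nat \<Rightarrow> nat" where "pos x = x div p mod p"

abbreviation blk :: "nat \<Rightarrow> nat" where "blk \<equiv> shift_block p g"

definition lev :: "nat \<Rightarrow> nat" where "lev x = x div (p * p)"

definition fibre :: "nat \<Rightarrow> nat \<Rightarrow> nat set" where
  "fibre b t = {x. x < 2 * n \<and> blk x = b \<and> pos x = t}"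

lemma p_pos: "p > 0" by (simp add: p)

lemma pos_less [simp]: "pos x < p" and blk_less [simp]: "blk x < p"
  using p_pos by (simp_all add: pos_def shift_block_def)

lemma lev_less: "x < 2 * n \<Longrightarrow> lev x < 8"
  using pp_gt p_pos unfolding lev_def by (intro div_less_iff_less_mult[THEN iffD2]) auto

lemma finite_fibre [simp]: "finite (fibre b t)"
  by (simp add: fibre_def)

text \<open>Level and position determine the line, and on one line the rotation is
  injective.\<close>

lemma column_eqI:
  assumes "blk x = blk y" "pos x = pos y" "lev x = lev y"
  shows "x = y"
proof -
  have u: "x div p = y div p"
  proof -
    have "x div p div p = y div p div p" using assms(3) by (simp add: lev_def div_mult2_eq)
    then show ?thesis using assms(2) unfolding pos_def by (metis div_mod_decomp)
  qed
  then have "x mod p = y mod p"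
    using add_mod_inj[of "x mod p" "g (x div p)" p "y mod p"] assms(1) p_pos by (simp add: shift_block_def)
  with u show ?thesis by (metis div_mod_decomp)
qed

lemma inj_lev: "inj_on lev (fibre b t)"
  by (rule inj_onI) (auto simp: fibre_def intro: column_eqI)

lemma card_fibre_le: "card (fibre b t) \<le> 8"
proof -
  have "card (lev ` fibre b t) \<le> card {..<8 :: nat}"
    by (intro card_mono) (auto simp: fibre_def lev_less)
  then show ?thesis by (simp add: card_image[OF inj_lev])
qed

lemma column_exists:
  assumes "b < p" "t < p"
  obtains x where "x div p = t + p * l" "blk x = b" "pos x = t" "lev x = l" "x < (l + 1) * (p * p)"
proof -
  define u where "u = t + p * l"
  \<comment> \<open>The rotation of line u undone: the inner difference is \<open>- g u\<close>
    modulo p, kept nonnegative.\<close>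
  define v where "v = (b + (p - g u mod p)) mod p"
  define x where "x = u * p + v"
  have v: "v < p" using p_pos by (simp add: v_def)
  then have dm: "x div p = u" "x mod p = v" by (simp_all add: x_def)
  have "g u mod p \<le> p" using p_pos by (simp add: less_imp_le)
  then have "blk x = b"
  proof -
    have "(v + g u) mod p = (b + (p - g u mod p) + g u mod p) mod p"
      unfolding v_def by (simp only: mod_add_left_eq mod_add_right_eq)
    also have "b + (p - g u mod p) + g u mod p = b + p" using \<open>g u mod p \<le> p\<close> by simp
    finally show ?thesis using assms(1) by (simp add: shift_block_def dm)
  qed
  moreover have "pos x = t" using assms(2) by (simp add: pos_def dm u_def)
  moreover have "lev x = l" using assms(2) p_pos by (simp add: lev_def div_mult2_eq dm u_def)
  moreover have "x < (l + 1) * (p * p)"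
  proof -
    have "u + 1 \<le> (l + 1) * p" using assms(2) by (simp add: u_def algebra_simps)
    then have "(u + 1) * p \<le> (l + 1) * p * p" by (rule mult_le_mono1)
    then show ?thesis using v by (simp add: x_def algebra_simps)
  qed
  ultimately show ?thesis using that[of x] dm(1) u_def by simp
qed

text \<open>Levels 0 and 1 fill the first 2 p^2 columns, all present because p^2 \<le> n. Two
  different levels in every fibre are what makes its variance positive.\<close>

lemma fibre_two_levels:
  assumes "b < p" "t < p"
  obtains x y where "x \<in> fibre b t" "y \<in> fibre b t" "lev x = 0" "lev y = 1"
proof -
  obtain x where x: "blk x = b" "pos x = t" "lev x = 0" "x < (0 + 1) * (p * p)"
    using column_exists[OF assms] by metis
  obtain y where y: "blk y = b" "pos y = t" "lev y = 1" "y < (1 + 1) * (p * p)"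
    using column_exists[OF assms] by metis
  show ?thesis
    by (rule that[of x y]) (use x y pp_le in \<open>auto simp: fibre_def\<close>)
qed

lemma card_fibre_pos: "b < p \<Longrightarrow> t < p \<Longrightarrow> card (fibre b t) > 0"
  using fibre_two_levels by (metis card_gt_0_iff empty_iff finite_fibre)

text \<open>\<open>avg\<close> and \<open>var\<close> serve to standardise the level on each fibre:
  \<open>phi\<close> sums to 0 there, hence is orthogonal to rows constant on fibres, has unit norm,
  and still tells the columns of a fibre apart.\<close>

definition avg :: "nat \<Rightarrow> nat \<Rightarrow> real" where
  "avg b t = (\<Sum>y\<in>fibre b t. real (lev y)) / card (fibre b t)"

definition var :: "nat \<Rightarrow> nat \<Rightarrow> real" where
  "var b t = (\<Sum>y\<in>fibre b t. (real (lev y) - avg b t)\<^sup>2)"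

definition phi :: "nat \<Rightarrow> real" where
  "phi x = (real (lev x) - avg (blk x) (pos x)) / sqrt (var (blk x) (pos x))"

lemma phi_fibre: "x \<in> fibre b t \<Longrightarrow> phi x = (real (lev x) - avg b t) / sqrt (var b t)"
  by (simp add: phi_def fibre_def)

lemma var_pos:
  assumes "b < p" "t < p"
  shows "var b t > 0"
proof -
  obtain x y where xy: "x \<in> fibre b t" "y \<in> fibre b t" "lev x = 0" "lev y = 1"
    using fibre_two_levels[OF assms] .
  show ?thesis
  \<comment> \<open>Both levels 0 and 1 occur, so at least one of them differs from the
    average.\<close>
  proof (cases "avg b t = 0")
    case True
    then show ?thesis unfolding var_def using xy by (intro sum_pos2[of _ y]) auto
  next
    case False
    then show ?thesis unfolding var_def using xy by (intro sum_pos2[of _ x]) auto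
  qed
qed

lemma sum_phi:
  assumes "b < p" "t < p"
  shows "(\<Sum>x\<in>fibre b t. phi x) = 0"
proof -
  have "(\<Sum>x\<in>fibre b t. phi x) = (\<Sum>x\<in>fibre b t. (real (lev x) - avg b t)) / sqrt (var b t)"
    unfolding sum_divide_distrib by (intro sum.cong refl phi_fibre)
  also have "(\<Sum>x\<in>fibre b t. (real (lev x) - avg b t)) = 0"
    using card_fibre_pos[OF assms] by (simp add: sum_subtractf avg_def)
  finally show ?thesis by simp
qed

lemma sum_phi_square:
  assumes "b < p" "t < p"
  shows "(\<Sum>x\<in>fibre b t. phi x * phi x) = 1"
proof -
  have "(\<Sum>x\<in>fibre b t. phi x * phi x) = (\<Sum>x\<in>fibre b t. (real (lev x) - avg b t)\<^sup>2 / var b t)"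
    using var_pos[OF assms] by (intro sum.cong refl) (simp add: phi_fibre power2_eq_square)
  also have "\<dots> = 1"
    unfolding sum_divide_distrib[symmetric] var_def[symmetric] using var_pos[OF assms] by simp
  finally show ?thesis .
qed

text \<open>At most 8 columns, each deviating by at most 8 from the average: 512 = 8 * 64.\<close>

lemma var_le:
  assumes "b < p" "t < p"
  shows "var b t \<le> 512"
proof -
  let ?c = "card (fibre b t)"
  have lev: "real (lev y) \<le> 8" if "y \<in> fibre b t" for y
    using lev_less[of y] that by (auto simp: fibre_def)
  have "(\<Sum>y\<in>fibre b t. real (lev y)) \<le> real ?c * 8"
    using sum_bounded_above[of "fibre b t" "\<lambda>y. real (lev y)" 8] lev by simp
  then have avg: "0 \<le> avg b t" "avg b t \<le> 8"
    using card_fibre_pos[OF assms] by (simp_all add: avg_def sum_nonneg field_simps)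
  have sq: "(real (lev y) - avg b t)\<^sup>2 \<le> 64" if "y \<in> fibre b t" for y
  proof -
    have "\<bar>real (lev y) - avg b t\<bar> \<le> 8" using lev[OF that] avg by (auto simp: abs_le_iff)
    then have "\<bar>real (lev y) - avg b t\<bar>\<^sup>2 \<le> 8\<^sup>2" by (intro power_mono) auto
    then show ?thesis by simp
  qed
  have "var b t \<le> real ?c * 64"
    unfolding var_def by (intro sum_bounded_above sq)
  also have "\<dots> \<le> 512" using card_fibre_le[of b t] by simp
  finally show ?thesis .
qed

lemma phi_diff:
  assumes "x \<in> fibre b t" "y \<in> fibre b t" "x \<noteq> y" "b < p" "t < p"
  shows "1 / sqrt 512 \<le> \<bar>phi x - phi y\<bar>"
proof -
  have "lev x \<noteq> lev y" using inj_lev assms by (meson inj_onD)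
  then have one: "1 \<le> \<bar>real (lev x) - real (lev y)\<bar>" by linarith
  have "phi x - phi y = (real (lev x) - real (lev y)) / sqrt (var b t)"
    using assms by (simp add: phi_fibre diff_divide_distrib)
  then have "\<bar>phi x - phi y\<bar> = \<bar>real (lev x) - real (lev y)\<bar> / sqrt (var b t)"
    using var_pos[OF assms(4,5)] by simp
  also have "\<dots> \<ge> 1 / sqrt 512"
    using one var_pos[OF assms(4,5)] var_le[OF assms(4,5)] by (intro frac_le) auto
  finally show ?thesis .
qed

text \<open>With the fibre size under the root, every Hadamard column receives the total weight 1/p
  on its fibre, however many columns the fibre has. Inner products within a block thus reduce to
  those of \<open>had\<close>.\<close>

definition base :: "nat \<Rightarrow> nat \<Rightarrow> nat \<Rightarrow> real" where
  "base b i x = (if blk x = b then had a i (pos x) / sqrt (p * card (fibre b (pos x))) else 0)"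

definition ext :: "nat \<Rightarrow> nat \<Rightarrow> real" where
  "ext b x = (if blk x = b then phi x / sqrt p else 0)"

lemma sum_block:
  "(\<Sum>x<2 * n. if blk x = b then h x else 0) = (\<Sum>t<p. \<Sum>x\<in>fibre b t. h x :: real)"
proof -
  have "(\<Sum>t<p. \<Sum>x\<in>fibre b t. h x) = (\<Sum>t<p. \<Sum>x\<in>{x\<in>{x. x < 2 * n \<and> blk x = b}. pos x = t}. h x)"
    by (simp add: fibre_def conj_assoc)
  also have "\<dots> = (\<Sum>x | x < 2 * n \<and> blk x = b. h x)"
    by (rule sum.group) auto
  also have "\<dots> = (\<Sum>x<2 * n. if blk x = b then h x else 0)"
    by (subst sum.inter_filter[symmetric]) (auto intro: sum.cong)
  finally show ?thesis by simp
qed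

section \<open>Orthonormality of the prescribed rows\<close>

lemma base_base:
  assumes "b < p" "i < p" "i' < p"
  shows "(\<Sum>x<2 * n. base b i x * base b' i' x) = (if b = b' \<and> i = i' then 1 else 0)"
proof (cases "b = b'")
  case True
  have "(\<Sum>x<2 * n. base b i x * base b' i' x) = (\<Sum>x<2 * n. if blk x = b then
      (had a i (pos x) * had a i' (pos x)) / (p * card (fibre b (pos x))) else 0)"
    unfolding True[symmetric] by (intro sum.cong refl) (simp add: base_def)
  also have "\<dots> = (\<Sum>t<p. \<Sum>x\<in>fibre b t. (had a i (pos x) * had a i' (pos x)) / (p * card (fibre b (pos x))))"
    by (rule sum_block)
  also have "\<dots> = (\<Sum>t<p. (had a i t * had a i' t) / p)"
  proof (intro sum.cong refl)
    fix t assume t: "t \<in> {..<p}"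
    have "(\<Sum>x\<in>fibre b t. (had a i (pos x) * had a i' (pos x)) / (p * card (fibre b (pos x))))
        = (\<Sum>x\<in>fibre b t. (had a i t * had a i' t) / (p * card (fibre b t)))"
      by (intro sum.cong refl) (simp add: fibre_def)
    also have "\<dots> = (had a i t * had a i' t) / p"
    proof -
      have "fibre b t \<noteq> {}" using card_fibre_pos[OF assms(1), of t] t by auto
      then show ?thesis by simp
    qed
    finally show "(\<Sum>x\<in>fibre b t. (had a i (pos x) * had a i' (pos x)) / (p * card (fibre b (pos x))))
        = (had a i t * had a i' t) / p" .
  qed
  also have "\<dots> = (\<Sum>t<p. had a i t * had a i' t) / p"
    by (simp add: sum_divide_distrib)
  also have "\<dots> = (if i = i' then 1 else 0)"
    using had_orth[of i a i'] assms(2,3) by (simp add: p)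
  finally show ?thesis using True by simp
next
  case False
  then show ?thesis by (auto simp: base_def intro!: sum.neutral)
qed

lemma base_ext:
  assumes "b < p"
  shows "(\<Sum>x<2 * n. base b i x * ext b' x) = 0"
proof (cases "b = b'")
  case True
  have "(\<Sum>x<2 * n. base b i x * ext b' x) = (\<Sum>x<2 * n. if blk x = b then
      had a i (pos x) / sqrt (p * card (fibre b (pos x))) * (phi x / sqrt p) else 0)"
    unfolding True[symmetric] by (intro sum.cong refl) (simp add: base_def ext_def)
  also have "\<dots> = (\<Sum>t<p. \<Sum>x\<in>fibre b t. had a i (pos x) / sqrt (p * card (fibre b (pos x))) * (phi x / sqrt p))"
    by (rule sum_block)
  also have "\<dots> = (\<Sum>t<p. had a i t / sqrt (p * card (fibre b t)) * ((\<Sum>x\<in>fibre b t. phi x) / sqrt p))"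
    unfolding sum_distrib_left sum_divide_distrib
    by (intro sum.cong refl) (simp add: fibre_def)
  also have "\<dots> = 0"
    using assms by (intro sum.neutral) (simp add: sum_phi)
  finally show ?thesis .
next
  case False
  then show ?thesis by (auto simp: base_def ext_def intro!: sum.neutral)
qed

lemma ext_ext:
  assumes "b < p"
  shows "(\<Sum>x<2 * n. ext b x * ext b' x) = (if b = b' then 1 else 0)"
proof (cases "b = b'")
  case True
  have "(\<Sum>x<2 * n. ext b x * ext b' x) = (\<Sum>x<2 * n. if blk x = b then phi x * phi x / p else 0)"
    unfolding True[symmetric] by (intro sum.cong refl) (simp add: ext_def)
  also have "\<dots> = (\<Sum>t<p. \<Sum>x\<in>fibre b t. phi x * phi x / p)"
    by (rule sum_block)
  also have "\<dots> = (\<Sum>t<p. 1 / p)"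
    using assms by (intro sum.cong refl) (simp add: sum_phi_square sum_divide_distrib[symmetric])
  also have "\<dots> = 1" using p_pos by simp
  finally show ?thesis using True by simp
next
  case False
  then show ?thesis by (auto simp: ext_def intro!: sum.neutral)
qed

section \<open>Assignment of rows to pairs of blocks\<close>

text \<open>The pair of rows number b p + i, for b \<le> i, carries the i-th row of block b together with
  the b-th row of block i; on the diagonal the second row is replaced by the one that
  separates the columns of a fibre.\<close>
definition key :: "nat \<Rightarrow> nat \<times> nat \<times> bool" where
  "key \<rho> = (let b = \<rho> div 2 div p; i = \<rho> div 2 mod p in
     if even \<rho> then (b, i, False) else if b = i then (b, 0, True) else (i, b, False))"

text \<open>Left inverse of \<open>key\<close> on the active rows, introduced to prove injectivity:
  comparing block and Hadamard index tells which of the two rows of a pair is meant.\<close>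

definition dec :: "nat \<times> nat \<times> bool \<Rightarrow> nat" where
  "dec = (\<lambda>(x, y, f). if f then 2 * (x * p + x) + 1 else if x \<le> y then 2 * (x * p + y) else 2 * (y * p + x) + 1)"

definition fam :: "nat \<times> nat \<times> bool \<Rightarrow> nat \<Rightarrow> real" where
  "fam = (\<lambda>(b, i, f). if f then ext b else base b i)"

text \<open>The rows whose entries are prescribed, namely those of the pairs b p + i with b \<le> i
  < p. All other rows are left to the orthonormal completion.\<close>

definition active :: "nat set" where
  "active = {\<rho>. \<rho> div 2 < p * p \<and> \<rho> div 2 div p \<le> \<rho> div 2 mod p}"

lemma active_subset: "active \<subseteq> {..<2 * n}"
  using pp_le by (auto simp: active_def)

lemma inj_key: "inj_on key active"
proof (rule inj_on_inverseI[of _ dec])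
  fix \<rho> assume \<rho>: "\<rho> \<in> active"
  define b i where "b = \<rho> div 2 div p" and "i = \<rho> div 2 mod p"
  have bi: "b \<le> i" "b * p + i = \<rho> div 2" using \<rho> by (auto simp: active_def b_def i_def)
  show "dec (key \<rho>) = \<rho>"
  proof (cases "even \<rho>")
    case True
    then have "dec (key \<rho>) = 2 * (b * p + i)"
      using bi(1) by (simp add: key_def dec_def Let_def b_def i_def)
    then show ?thesis using bi(2) True by simp
  next
    case False
    then have "dec (key \<rho>) = 2 * (b * p + i) + 1"
      using bi(1) unfolding key_def dec_def Let_def b_def[symmetric] i_def[symmetric] by auto
    then show ?thesis using bi(2) False by simp
  qed
qed

lemma fam_orthonormal:
  assumes "\<rho> \<in> active" "\<sigma> \<in> active"
  shows "(\<Sum>x<2 * n. fam (key \<rho>) x * fam (key \<sigma>) x) = (if \<rho> = \<sigma> then 1 else 0)"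
proof -
  \<comment> \<open>An \<open>ext\<close> row always has middle coordinate 0, so different keys
    stand for different, hence orthogonal, rows.\<close>
  have valid: "\<exists>b i f. key \<rho> = (b, i, f) \<and> b < p \<and> i < p \<and> (f \<longrightarrow> i = 0)" if "\<rho> \<in> active" for \<rho>
  proof -
    have "\<rho> div 2 div p < p" "\<rho> div 2 mod p < p"
      using that p_pos by (auto simp: active_def div_less_iff_less_mult)
    then have "fst (key \<rho>) < p \<and> fst (snd (key \<rho>)) < p \<and> (snd (snd (key \<rho>)) \<longrightarrow> fst (snd (key \<rho>)) = 0)"
      using p_pos by (auto simp: key_def Let_def)
    then show ?thesis by (cases "key \<rho>") auto
  qed
  obtain b i f where k1: "key \<rho> = (b, i, f)" "b < p" "i < p" "f \<longrightarrow> i = 0"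
    using valid[OF assms(1)] by blast
  obtain b' i' f' where k2: "key \<sigma> = (b', i', f')" "b' < p" "i' < p" "f' \<longrightarrow> i' = 0"
    using valid[OF assms(2)] by blast
  have ext_base: "(\<Sum>x<2 * n. ext b x * base b' i' x) = 0"
    using base_ext[OF k2(2), of i' b] by (simp add: mult.commute)
  have "(\<Sum>x<2 * n. fam (key \<rho>) x * fam (key \<sigma>) x) = (if key \<rho> = key \<sigma> then 1 else 0)"
    using k1 k2 base_base[OF k1(2,3) k2(3)] base_ext[OF k1(2)] ext_ext[OF k1(2)] ext_base
    by (cases f; cases f') (auto simp: fam_def)
  also have "key \<rho> = key \<sigma> \<longleftrightarrow> \<rho> = \<sigma>"
    using inj_key assms by (meson inj_onD)
  finally show ?thesis .
qed

lemma div_mod_index: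
  assumes "b \<le> i" "i < p"
  shows "(b * p + i) div p = b" "(b * p + i) mod p = i" "b * p + i < p * p"
proof -
  show "(b * p + i) div p = b" "(b * p + i) mod p = i" using assms by simp_all
  have "(b + 1) * p \<le> p * p" using assms by (intro mult_le_mono1) simp
  then show "b * p + i < p * p" using assms by simp
qed

lemma design_exists:
  "\<exists>Om. orth_mat (2 * n) Om \<and>
    (\<forall>b i x. b < i \<longrightarrow> i < p \<longrightarrow> x < 2 * n \<longrightarrow>
      Om $$ (2 * (b * p + i), x) = base b i x \<and> Om $$ (2 * (b * p + i) + 1, x) = base i b x) \<and>
    (\<forall>b x. b < p \<longrightarrow> x < 2 * n \<longrightarrow>
      Om $$ (2 * (b * p + b), x) = base b b x \<and> Om $$ (2 * (b * p + b) + 1, x) = ext b x)"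
proof -
  obtain Om where Om: "orth_mat (2 * n) Om" "\<forall>\<rho>\<in>active. \<forall>x<2 * n. Om $$ (\<rho>, x) = fam (key \<rho>) x"
    using orthonormal_rows_completion[OF active_subset fam_orthonormal] by blast
  have act: "2 * (b * p + i) \<in> active" "2 * (b * p + i) + 1 \<in> active" if "b \<le> i" "i < p" for b i
    using div_mod_index[OF that] that by (simp_all add: active_def)
  have "Om $$ (2 * (b * p + i), x) = base b i x" if "b \<le> i" "i < p" "x < 2 * n" for b i x
    using Om(2) act[OF that(1,2)] div_mod_index[OF that(1,2)] that(3)
    by (simp add: fam_def key_def Let_def)
  moreover have "Om $$ (2 * (b * p + i) + 1, x) = base i b x" if "b < i" "i < p" "x < 2 * n" for b i x
  proof -
    have "Om $$ (2 * (b * p + i) + 1, x) = fam (key (2 * (b * p + i) + 1)) x"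
      using Om(2) act[of b i] that by auto
    also have "\<dots> = base i b x"
      using div_mod_index[of b i] that by (simp add: fam_def key_def Let_def)
    finally show ?thesis .
  qed
  moreover have "Om $$ (2 * (b * p + b) + 1, x) = ext b x" if "b < p" "x < 2 * n" for b x
  proof -
    have "Om $$ (2 * (b * p + b) + 1, x) = fam (key (2 * (b * p + b) + 1)) x"
      using Om(2) act[of b b] that by auto
    also have "\<dots> = ext b x"
      using div_mod_index[of b b] that by (simp add: fam_def key_def Let_def)
    finally show ?thesis .
  qed
  ultimately show ?thesis using Om(1) by (intro exI[of _ Om]) auto
qed

end

section \<open>Minors of the grid matrices\<close>

context column_grid
begin

lemma base_abs_ge:
  assumes "x < 2 * n" "blk x = b"
  shows "1 / sqrt (8 * p) \<le> \<bar>base b i x\<bar>"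
proof -
  have b: "b < p" using assms(2) by auto
  have "card (fibre b (pos x)) > 0" using card_fibre_pos[OF b] by simp
  then have "0 < real p * card (fibre b (pos x))" using p_pos by simp
  moreover have "real p * card (fibre b (pos x)) \<le> 8 * p"
  proof -
    have "real (card (fibre b (pos x))) \<le> 8" using card_fibre_le[of b "pos x"] by simp
    from mult_left_mono[OF this, of "real p"] show ?thesis by (simp add: mult.commute)
  qed
  ultimately have "1 / sqrt (8 * p) \<le> 1 / sqrt (real p * card (fibre b (pos x)))"
    by (intro divide_left_mono mult_pos_pos) (auto simp: p_pos)
  then show ?thesis using assms(2) by (simp add: base_def abs_mult)
qed

text \<open>Columns from pairwise distinct blocks, listed by increasing block and grouped two by two,
  select one pair of rows per group; each of these rows vanishes on all but one of the columns.\<close>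
lemma minor_distinct_blocks:
  assumes Om: "Om \<in> carrier_mat (2 * n) (2 * n)"
    and rows: "\<And>b i x. b < i \<Longrightarrow> i < p \<Longrightarrow> x < 2 * n \<Longrightarrow>
      Om $$ (2 * (b * p + i), x) = base b i x \<and> Om $$ (2 * (b * p + i) + 1, x) = base i b x"
    and S: "S \<subseteq> {0..<2 * n}" "card S = 2 * k" "inj_on blk S"
  shows "\<exists>R\<in>D2k n k. (1 / (8 * p)) ^ k \<le> \<bar>minor Om R S\<bar>"
proof -
  define B where "B = blk ` S"
  define bs where "bs = sorted_list_of_set B"
  define e where "e m = inv_into S blk (bs ! m)" for m
  \<comment> \<open>The number of the row pair shared by two consecutive blocks of the sorted list.
    Sorting puts the smaller block first, which is the off-diagonal case in which the pair carries
    one row of each block.\<close>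
  define j where "j i = bs ! (2 * i) * p + bs ! (2 * i + 1)" for i
  define \<rho> where "\<rho> m = 2 * j (m div 2) + m mod 2" for m
  have fin: "finite B" using S(1) finite_subset by (auto simp: B_def)
  have len: "length bs = 2 * k" using S(2,3) by (simp add: bs_def B_def card_image)
  have bsB: "bs ! m \<in> B" if "m < 2 * k" for m
    using that len fin nth_mem[of m bs] by (simp add: bs_def)
  have bsp: "bs ! m < p" if "m < 2 * k" for m
    using bsB[OF that] by (auto simp: B_def)
  have bs_mono: "bs ! l < bs ! m" if "l < m" "m < 2 * k" for l m
    using that len strict_sorted_list_of_set[of B] by (simp add: bs_def sorted_wrt_nth_less)
  have e: "e m \<in> S" "blk (e m) = bs ! m" if "m < 2 * k" for m
    using bsB[OF that] by (auto simp: e_def B_def inv_into_into f_inv_into_f)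
  have e_inj: "inj_on e {..<2 * k}"
  proof (rule inj_onI)
    fix l m assume "l \<in> {..<2 * k}" "m \<in> {..<2 * k}" "e l = e m"
    then have "bs ! l = bs ! m" "l < 2 * k" "m < 2 * k" using e(2) by (auto, metis)
    then show "l = m" using bs_mono by (metis less_irrefl nat_neq_iff)
  qed
  have e_img: "e ` {..<2 * k} = S"
    using e(1) e_inj S(1,2) by (intro card_subset_eq) (auto simp: card_image intro: finite_subset)
  have lohi: "bs ! (2 * i) < bs ! (2 * i + 1)" "bs ! (2 * i + 1) < p" if "i < k" for i
    using bs_mono[of "2 * i" "2 * i + 1"] bsp[of "2 * i + 1"] that by auto
  have j_less: "j i < n" if "i < k" for i
    using div_mod_index(3)[OF less_imp_le[OF lohi(1)[OF that]] lohi(2)[OF that]] pp_le by (simp add: j_def)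
  have j_div: "j i div p = bs ! (2 * i)" if "i < k" for i
    using div_mod_index(1)[OF less_imp_le[OF lohi(1)[OF that]] lohi(2)[OF that]] by (simp add: j_def)
  \<comment> \<open>Dividing by p recovers the lower block of the group, and different groups have
    different lower blocks.\<close>
  have j_inj: "inj_on j {..<k}"
  proof (rule inj_onI)
    fix i i' assume "i \<in> {..<k}" "i' \<in> {..<k}" "j i = j i'"
    then have "bs ! (2 * i) = bs ! (2 * i')" "i < k" "i' < k" using j_div by (auto, metis)
    then show "i = i'" using bs_mono[of "2 * i" "2 * i'"] bs_mono[of "2 * i'" "2 * i"]
      by (cases i i' rule: linorder_cases) auto
  qed
  have \<rho>_inj: "inj_on \<rho> {..<2 * k}"
  proof (rule inj_onI)
    fix l m assume lm: "l \<in> {..<2 * k}" "m \<in> {..<2 * k}" "\<rho> l = \<rho> m"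
    have "\<rho> l div 2 = j (l div 2)" "\<rho> m div 2 = j (m div 2)" "\<rho> l mod 2 = l mod 2" "\<rho> m mod 2 = m mod 2"
      by (simp_all add: \<rho>_def)
    then have "j (l div 2) = j (m div 2)" "l mod 2 = m mod 2" using lm(3) by simp_all
    moreover have "l div 2 \<in> {..<k}" "m div 2 \<in> {..<k}" using lm by auto
    ultimately have "l div 2 = m div 2" using j_inj by (meson inj_onD)
    with \<open>l mod 2 = m mod 2\<close> show "l = m" by (metis div_mod_decomp)
  qed
  have \<rho>_img: "\<rho> ` {..<2 * k} = (\<Union>i<k. {2 * j i, 2 * j i + 1})"
  proof (intro equalityI subsetI)
    fix r assume "r \<in> \<rho> ` {..<2 * k}"
    then obtain m where m: "m < 2 * k" "r = \<rho> m" by auto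
    then have "m div 2 < k" by auto
    moreover have "m mod 2 = 0 \<or> m mod 2 = 1" by presburger
    ultimately show "r \<in> (\<Union>i<k. {2 * j i, 2 * j i + 1})" using m by (auto simp: \<rho>_def)
  next
    fix r assume "r \<in> (\<Union>i<k. {2 * j i, 2 * j i + 1})"
    then obtain i where i: "i < k" "r = 2 * j i \<or> r = 2 * j i + 1" by auto
    then have "r = \<rho> (2 * i) \<or> r = \<rho> (2 * i + 1)" by (auto simp: \<rho>_def)
    then show "r \<in> \<rho> ` {..<2 * k}" using i(1) by auto
  qed
  have \<rho>_sub: "\<rho> ` {..<2 * k} \<subseteq> {0..<2 * n}"
    using j_less unfolding \<rho>_img by fastforce
  have R: "\<rho> ` {..<2 * k} \<in> D2k n k"
  proof -
    define T where "T = (\<lambda>i. {2 * j i, 2 * j i + 1}) ` {..<k}"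
    have "inj_on (\<lambda>i. {2 * j i, 2 * j i + 1}) {..<k}"
    proof (rule inj_onI)
      fix i i' assume i: "i \<in> {..<k}" "i' \<in> {..<k}" "{2 * j i, 2 * j i + 1} = {2 * j i', 2 * j i' + 1}"
      then have "j i = j i'" by (auto simp: doubleton_eq_iff)
      then show "i = i'" using j_inj i by (meson inj_onD)
    qed
    then have "card T = k" by (simp add: T_def card_image)
    moreover have "T \<subseteq> D2 n" using j_less by (auto simp: T_def D2_def)
    moreover have "\<rho> ` {..<2 * k} = \<Union>T" by (simp add: \<rho>_img T_def)
    ultimately show ?thesis unfolding D2k_def by blast
  qed
  \<comment> \<open>The first row of a pair lives on the lower block, the second on the upper one.
    Which Hadamard row it carries is immaterial, as only the modulus of its entries enters.\<close>
  have entry: "\<exists>i. \<forall>x<2 * n. Om $$ (\<rho> m, x) = base (bs ! m) i x" if "m < 2 * k" for m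
  proof -
    have h: "m div 2 < k" using that by auto
    note r = rows[OF lohi[OF h], folded j_def]
    show ?thesis
    proof (cases "even m")
      case True
      then have "2 * (m div 2) = m" "\<rho> m = 2 * j (m div 2)" by (auto simp: \<rho>_def)
      then show ?thesis using r by (metis)
    next
      case False
      then have "2 * (m div 2) + 1 = m" "\<rho> m = 2 * j (m div 2) + 1" by (auto simp: \<rho>_def mod_2_eq_odd)
      then show ?thesis using r by (metis)
    qed
  qed
  have e_lt: "e m < 2 * n" if "m < 2 * k" for m using e(1)[OF that] S(1) by auto
  have "\<bar>minor Om (\<rho> ` {..<2 * k}) (e ` {..<2 * k})\<bar> = (\<Prod>m<2 * k. \<bar>Om $$ (\<rho> m, e m)\<bar>)"
  proof (rule minor_generalised_permutation[OF Om \<rho>_inj \<rho>_sub e_inj])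
    show "e ` {..<2 * k} \<subseteq> {0..<2 * n}" using e_img S(1) by simp
    fix l m assume lm: "l < 2 * k" "m < 2 * k" "l \<noteq> m"
    then have "blk (e m) \<noteq> bs ! l"
      using e(2) bs_mono[of l m] bs_mono[of m l] by (cases l m rule: linorder_cases) auto
    then show "Om $$ (\<rho> l, e m) = 0" using entry[OF lm(1)] e_lt[OF lm(2)] by (auto simp: base_def)
  qed
  also have "\<dots> \<ge> (\<Prod>m<2 * k. 1 / sqrt (8 * p))"
  proof (rule prod_mono, rule conjI)
    fix m assume m: "m \<in> {..<2 * k}"
    then obtain i where "Om $$ (\<rho> m, e m) = base (bs ! m) i (e m)" using entry e_lt by blast
    then show "1 / sqrt (8 * p) \<le> \<bar>Om $$ (\<rho> m, e m)\<bar>"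
      using base_abs_ge[OF e_lt e(2), of m] m by simp
  qed simp
  also have "(\<Prod>m<2 * k. 1 / sqrt (8 * p)) = (1 / (8 * p)) ^ k"
    by (simp add: power_mult power_divide)
  finally show ?thesis using R e_img by blast
qed

text \<open>Two columns of a fibre agree in the Hadamard row of the diagonal pair, so the minor is
  that common entry times the difference of their \<open>ext\<close> entries, which different levels
  keep away from 0. The constant is sqrt(8 * 512) = 64.\<close>

lemma minor_same_fibre:
  assumes Om: "Om \<in> carrier_mat (2 * n) (2 * n)"
    and rows: "\<And>b x. b < p \<Longrightarrow> x < 2 * n \<Longrightarrow>
      Om $$ (2 * (b * p + b), x) = base b b x \<and> Om $$ (2 * (b * p + b) + 1, x) = ext b x"
    and xy: "x < 2 * n" "y < 2 * n" "x \<noteq> y" "blk x = blk y" "pos x = pos y"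
  shows "\<exists>R\<in>D2k n 1. 1 / (64 * p) \<le> \<bar>minor Om R {x, y}\<bar>"
proof -
  define b t where "b = blk x" and "t = pos x"
  have bt: "b < p" "t < p" by (simp_all add: b_def t_def)
  have fib: "x \<in> fibre b t" "y \<in> fibre b t" using xy by (auto simp: fibre_def b_def t_def)
  define r where "r = 2 * (b * p + b)"
  have r: "r + 1 < 2 * n" using div_mod_index(3)[OF order_refl bt(1)] pp_le by (simp add: r_def)
  have "{r, r + 1} \<in> D2 n" using div_mod_index(3)[OF order_refl bt(1)] pp_le
    unfolding D2_def r_def by (intro CollectI exI[of _ "b * p + b"]) simp
  then have R: "{r, r + 1} \<in> D2k n 1" unfolding D2k_def by (intro CollectI exI[of _ "{{r, r + 1}}"]) simp
  have bb: "base b b y = base b b x" using xy by (simp add: base_def b_def)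
  have m: "minor Om {r, r + 1} {u, v} = base b b x * (ext b v - ext b u)"
    if "u < v" "{u, v} = {x, y}" for u v
  proof -
    have uv: "u < 2 * n" "v < 2 * n" "base b b u = base b b x" "base b b v = base b b x"
      using that(2) xy bb by (auto simp: doubleton_eq_iff)
    have "minor Om {r, r + 1} {u, v}
        = Om $$ (r, u) * Om $$ (r + 1, v) - Om $$ (r, v) * Om $$ (r + 1, u)"
      by (rule minor_pair[OF Om]) (use that uv r in auto)
    then show ?thesis
      using rows[OF bt(1) uv(1)] rows[OF bt(1) uv(2)] uv(3,4) by (simp add: r_def algebra_simps)
  qed
  have "\<bar>minor Om {r, r + 1} {x, y}\<bar> = \<bar>base b b x\<bar> * \<bar>ext b x - ext b y\<bar>"
    using m[of x y] m[of y x] xy(3) by (cases "x < y") (auto simp: abs_mult abs_minus_commute insert_commute)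
  also have "\<bar>ext b x - ext b y\<bar> = \<bar>phi x - phi y\<bar> / sqrt p"
    using xy by (simp add: ext_def b_def diff_divide_distrib[symmetric])
  also have "1 / sqrt (8 * p) * (1 / sqrt 512 / sqrt p) \<le> \<bar>base b b x\<bar> * (\<bar>phi x - phi y\<bar> / sqrt p)"
    using base_abs_ge[OF xy(1), of b b] phi_diff[OF fib xy(3) bt]
    by (intro mult_mono divide_right_mono) (auto simp: b_def)
  also have "1 / sqrt (8 * p) * (1 / sqrt 512 / sqrt p) = 1 / (64 * p)"
  proof -
    have "8 * real p * (512 * real p) = (64 * real p)\<^sup>2" by (simp add: power2_eq_square)
    then have "sqrt (8 * real p * (512 * real p)) = 64 * p" by (simp only: real_sqrt_abs)
    then have "sqrt (8 * p) * (sqrt 512 * sqrt p) = 64 * p"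
      by (simp only: of_nat_mult of_nat_numeral real_sqrt_mult)
    then show ?thesis by (simp only: divide_divide_eq_left times_divide_times_eq mult_1_left)
  qed
  finally show ?thesis using R by blast
qed

lemma design_minors:
  "\<exists>Om. orth_mat (2 * n) Om \<and>
    (\<forall>k S. S \<subseteq> {0..<2 * n} \<longrightarrow> card S = 2 * k \<longrightarrow> inj_on blk S \<longrightarrow>
      (\<exists>R\<in>D2k n k. (1 / (64 * p)) ^ k \<le> \<bar>minor Om R S\<bar>)) \<and>
    (\<forall>x y. x < 2 * n \<longrightarrow> y < 2 * n \<longrightarrow> x \<noteq> y \<longrightarrow> blk x = blk y \<longrightarrow> pos x = pos y \<longrightarrow>
      (\<exists>R\<in>D2k n 1. 1 / (64 * p) \<le> \<bar>minor Om R {x, y}\<bar>))"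
proof -
  obtain Om where Om: "orth_mat (2 * n) Om"
    and rows: "\<forall>b i x. b < i \<longrightarrow> i < p \<longrightarrow> x < 2 * n \<longrightarrow>
      Om $$ (2 * (b * p + i), x) = base b i x \<and> Om $$ (2 * (b * p + i) + 1, x) = base i b x"
    and diag: "\<forall>b x. b < p \<longrightarrow> x < 2 * n \<longrightarrow>
      Om $$ (2 * (b * p + b), x) = base b b x \<and> Om $$ (2 * (b * p + b) + 1, x) = ext b x"
    using design_exists by blast
  have c: "Om \<in> carrier_mat (2 * n) (2 * n)" using Om by (simp add: orth_mat_def)
  have "\<exists>R\<in>D2k n k. (1 / (64 * p)) ^ k \<le> \<bar>minor Om R S\<bar>"
    if S: "S \<subseteq> {0..<2 * n}" "card S = 2 * k" "inj_on blk S" for k S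
  proof -
    obtain R where "R \<in> D2k n k" "(1 / (8 * p)) ^ k \<le> \<bar>minor Om R S\<bar>"
      using minor_distinct_blocks[OF c _ S] rows by blast
    \<comment> \<open>Weakened to the constant of the same-fibre case, so that one bound covers
      both.\<close>
    moreover have "(1 / (64 * real p)) ^ k \<le> (1 / (8 * p)) ^ k"
      using p_pos by (intro power_mono divide_left_mono) auto
    ultimately show ?thesis by force
  qed
  moreover have "\<exists>R\<in>D2k n 1. 1 / (64 * p) \<le> \<bar>minor Om R {x, y}\<bar>"
    if "x < 2 * n" "y < 2 * n" "x \<noteq> y" "blk x = blk y" "pos x = pos y" for x y
    using minor_same_fibre[OF c _ that] diag by blast
  ultimately show ?thesis using Om by (intro exI[of _ Om]) blast
qed

end

section \<open>Separating shifts\<close>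

text \<open>Two columns of one line never share a block. On different lines a collision determines g
  on the line of x from g on the line of y; altering that one value in all p ways injects p copies
  of the colliding shifts into G.\<close>

lemma card_collision:
  assumes p: "p > 0" and xy: "x \<noteq> y" "x div p < m" "y div p < m"
  defines "G \<equiv> {..<m} \<rightarrow>\<^sub>E {..<p}"
  shows "p * card {g \<in> G. shift_block p g x = shift_block p g y} \<le> card G"
proof -
  let ?C = "{g \<in> G. shift_block p g x = shift_block p g y}" and ?u = "x div p" and ?v = "y div p"
  have finG: "finite G" by (simp add: G_def finite_PiE)
  have less: "g i < p" if "g \<in> G" "i < m" for g i using that by (auto simp: G_def)
  show ?thesis
  proof (cases "?u = ?v")
    case True
    have "x mod p = y mod p" if "g \<in> ?C" for g
      using add_mod_inj[of "x mod p" "g ?u" p "y mod p"] that True p by (simp add: shift_block_def)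
    moreover have "x mod p \<noteq> y mod p" using True xy(1) by (metis div_mod_decomp)
    ultimately have C: "?C = {}" by blast
    show ?thesis unfolding C by simp
  next
    case False
    define h where "h = (\<lambda>(g, c). g(?u := (g ?u + c) mod p))"
    have "inj_on h (?C \<times> {..<p})"
    proof (rule inj_onI)
      fix z z' assume z: "z \<in> ?C \<times> {..<p}" "z' \<in> ?C \<times> {..<p}" "h z = h z'"
      obtain g c g' c' where zz: "z = (g, c)" "z' = (g', c')" by (cases z, cases z') blast
      have g: "g \<in> G" "shift_block p g x = shift_block p g y" and g': "g' \<in> G" "shift_block p g' x = shift_block p g' y"
        and c: "c < p" "c' < p" and eq: "h (g, c) = h (g', c')"
        using z unfolding zz by auto
      have off: "g i = g' i" if "i \<noteq> ?u" for i
        using fun_cong[OF eq, of i] that by (simp add: h_def)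
      have at: "(g ?u + c) mod p = (g' ?u + c') mod p"
        using fun_cong[OF eq, of ?u] by (simp add: h_def)
      \<comment> \<open>\<open>h\<close> leaves the line of y alone, so the collision equations of g
        and g' have the same side for y, and this recovers the altered value.\<close>
      have "(g ?u + x mod p) mod p = (g' ?u + x mod p) mod p"
        using g(2) g'(2) off[of ?v] False by (simp add: shift_block_def add.commute)
      then have u: "g ?u = g' ?u" using add_mod_inj less g(1) g'(1) xy(2) by blast
      then have "g = g'" using off by (intro ext) (metis)
      moreover have "c = c'"
        using add_mod_inj[of c "g ?u" p c'] at c u by (simp add: add.commute)
      ultimately show "z = z'" by (simp add: zz)
    qed
    moreover have "h ` (?C \<times> {..<p}) \<subseteq> G"
    proof (rule image_subsetI)
      fix z assume "z \<in> ?C \<times> {..<p}"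
      then obtain g c where z: "z = (g, c)" "g \<in> G" by blast
      have "g(?u := (g ?u + c) mod p) \<in> insert ?u {..<m} \<rightarrow>\<^sub>E {..<p}"
        using z(2) p unfolding G_def by (intro PiE_fun_upd) auto
      then show "h z \<in> G" using xy(2) by (simp add: z(1) h_def G_def insert_absorb)
    qed
    ultimately have "card (?C \<times> {..<p}) \<le> card G"
      using finG by (rule card_inj_on_le)
    then show ?thesis by (simp add: card_cartesian_product mult.commute)
  qed
qed

text \<open>Union bound over the ordered pairs of distinct columns, of which there are at most
  \<open>(card S)\<^sup>2\<close>.\<close>

lemma card_non_injective:
  assumes p: "p > 0" and S: "finite S" "\<And>x. x \<in> S \<Longrightarrow> x div p < m"
  defines "G \<equiv> {..<m} \<rightarrow>\<^sub>E {..<p}"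
  shows "p * card {g \<in> G. \<not> inj_on (shift_block p g) S} \<le> (card S)\<^sup>2 * card G"
proof -
  define P where "P = {(x, y) \<in> S \<times> S. x \<noteq> y}"
  let ?C = "\<lambda>q. {g \<in> G. shift_block p g (fst q) = shift_block p g (snd q)}"
  have fin: "finite G" "finite P" using S by (auto simp: G_def P_def finite_PiE intro: finite_subset[of _ "S \<times> S"])
  have "{g \<in> G. \<not> inj_on (shift_block p g) S} \<subseteq> (\<Union>q\<in>P. ?C q)"
    by (force simp: inj_on_def P_def)
  then have "card {g \<in> G. \<not> inj_on (shift_block p g) S} \<le> card (\<Union>q\<in>P. ?C q)"
    using fin by (intro card_mono) auto
  also have "\<dots> \<le> (\<Sum>q\<in>P. card (?C q))"
    using fin by (intro card_UN_le)
  finally have "p * card {g \<in> G. \<not> inj_on (shift_block p g) S} \<le> (\<Sum>q\<in>P. p * card (?C q))"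
    by (simp add: sum_distrib_left[symmetric])
  also have "\<dots> \<le> (\<Sum>q\<in>P. card G)"
  proof (rule sum_mono)
    fix q assume "q \<in> P"
    then have "fst q \<noteq> snd q" "fst q \<in> S" "snd q \<in> S" by (auto simp: P_def)
    then show "p * card (?C q) \<le> card G"
      using card_collision[OF p, of "fst q" "snd q" m] S(2) by (simp add: G_def)
  qed
  also have "\<dots> = card P * card G" by simp
  also have "card P \<le> (card S)\<^sup>2"
    using card_mono[of "S \<times> S" P] S(1) by (auto simp: P_def card_cartesian_product power2_eq_square)
  finally show ?thesis by (simp add: mult_le_mono1)
qed

text \<open>Double counting of the failing pairs (g, S), each with weight p so as to stay within the
  natural numbers: averaged over g, the failing fraction of F is at most s^2/p, so some g does not
  exceed it.\<close>

lemma averaging: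
  assumes p: "p > 0" and F: "finite F" "\<And>S. S \<in> F \<Longrightarrow> finite S \<and> card S = s \<and> (\<forall>x\<in>S. x div p < m)"
  shows "\<exists>g. p * card {S \<in> F. \<not> inj_on (shift_block p g) S} \<le> s\<^sup>2 * card F"
proof (rule ccontr)
  define G where "G = ({..<m} \<rightarrow>\<^sub>E {..<p})"
  let ?B = "\<lambda>g S. if inj_on (shift_block p g) S then 0 else p"
  have fin: "finite G" by (simp add: G_def finite_PiE)
  have ne: "G \<noteq> {}" using p by (auto simp: G_def PiE_eq_empty_iff)
  assume "\<not> ?thesis"
  then have gt: "s\<^sup>2 * card F < p * card {S \<in> F. \<not> inj_on (shift_block p g) S}" for g
    by (simp add: not_le)
  have row: "(\<Sum>S\<in>F. ?B g S) = p * card {S \<in> F. \<not> inj_on (shift_block p g) S}" for g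
    using F(1) by (subst sum.If_cases) (simp_all add: Int_def mult.commute)
  have col: "(\<Sum>g\<in>G. ?B g S) = p * card {g \<in> G. \<not> inj_on (shift_block p g) S}" for S
    using fin by (subst sum.If_cases) (simp_all add: Int_def mult.commute)
  have "card G * (s\<^sup>2 * card F) = (\<Sum>g\<in>G. s\<^sup>2 * card F)" by simp
  also have "\<dots> < (\<Sum>g\<in>G. \<Sum>S\<in>F. ?B g S)"
    unfolding row using fin ne gt by (intro sum_strict_mono) auto
  also have "\<dots> = (\<Sum>S\<in>F. \<Sum>g\<in>G. ?B g S)" by (rule sum.swap)
  also have "\<dots> \<le> (\<Sum>S\<in>F. s\<^sup>2 * card G)"
  proof (rule sum_mono)
    fix S assume "S \<in> F"
    then show "(\<Sum>g\<in>G. ?B g S) \<le> s\<^sup>2 * card G"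
      unfolding col using card_non_injective[OF p, of S m] F(2)[of S] by (simp add: G_def)
  qed
  also have "\<dots> = card G * (s\<^sup>2 * card F)" by simp
  finally show False by simp
qed

text \<open>A greedy substitute for independent random shifts: each new shift is chosen for the sets
  that all earlier ones failed to separate, so every round multiplies the bound on the remaining
  fraction by s^2/p.\<close>

lemma iterated_averaging:
  assumes p: "p > 0" and F: "finite F" "\<And>S. S \<in> F \<Longrightarrow> finite S \<and> card S = s \<and> (\<forall>x\<in>S. x div p < m)"
  shows "\<exists>gs. p ^ N * card {S \<in> F. \<forall>r<N. \<not> inj_on (shift_block p (gs r)) S} \<le> (s\<^sup>2) ^ N * card F"
proof (induction N)
  case (Suc N)
  then obtain gs where gs: "p ^ N * card {S \<in> F. \<forall>r<N. \<not> inj_on (shift_block p (gs r)) S} \<le> (s\<^sup>2) ^ N * card F"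
    by blast
  let ?F = "{S \<in> F. \<forall>r<N. \<not> inj_on (shift_block p (gs r)) S}"
  have "\<exists>g. p * card {S \<in> ?F. \<not> inj_on (shift_block p g) S} \<le> s\<^sup>2 * card ?F"
    by (rule averaging[OF p, of _ s m]) (use F in auto)
  then obtain g where g: "p * card {S \<in> ?F. \<not> inj_on (shift_block p g) S} \<le> s\<^sup>2 * card ?F" ..
  have "{S \<in> F. \<forall>r<Suc N. \<not> inj_on (shift_block p ((gs(N := g)) r)) S} = {S \<in> ?F. \<not> inj_on (shift_block p g) S}"
    by (auto simp: less_Suc_eq)
  then have "p ^ Suc N * card {S \<in> F. \<forall>r<Suc N. \<not> inj_on (shift_block p ((gs(N := g)) r)) S}
      = p ^ N * (p * card {S \<in> ?F. \<not> inj_on (shift_block p g) S})"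
    by simp
  also have "\<dots> \<le> p ^ N * (s\<^sup>2 * card ?F)" using g by (rule mult_le_mono2)
  also have "\<dots> = s\<^sup>2 * (p ^ N * card ?F)" by simp
  also have "\<dots> \<le> s\<^sup>2 * ((s\<^sup>2) ^ N * card F)" using gs by (rule mult_le_mono2)
  finally show ?case by (intro exI[of _ "gs(N := g)"]) simp
qed simp

text \<open>Each shift fails on a fraction of order 1/p of the column sets, and there are at most
  \<open>(8 p\<^sup>2)\<^sup>2\<^sup>k\<close> such sets, so more than 4k shifts leave no column set unseparated.\<close>
lemma separating_shifts:
  assumes N: "N > 4 * k" and n: "n < 4 * (p * p)" and p: "p > ((2 * k)\<^sup>2) ^ N * 64 ^ k"
  shows "\<exists>gs. \<forall>S\<in>Sm n (2 * k). \<exists>r<N. inj_on (shift_block p (gs r)) S"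
proof -
  have p0: "p > 0" using p by simp
  have fin: "finite (Sm n (2 * k))" by (rule finite_subset[of _ "Pow {0..<2 * n}"]) (auto simp: Sm_def)
  have "finite S \<and> card S = 2 * k \<and> (\<forall>x\<in>S. x div p < 8 * p)" if "S \<in> Sm n (2 * k)" for S
    using that n p0 finite_subset[of S "{0..<2 * n}"]
    by (fastforce simp: Sm_def div_less_iff_less_mult)
  from iterated_averaging[OF p0 fin this, of N]
  obtain gs where gs: "p ^ N * card {S \<in> Sm n (2 * k). \<forall>r<N. \<not> inj_on (shift_block p (gs r)) S}
      \<le> ((2 * k)\<^sup>2) ^ N * card (Sm n (2 * k))"
    by blast
  have "card (Sm n (2 * k)) = (2 * n) choose (2 * k)"
    unfolding Sm_def using n_subsets[of "{0..<2 * n}" "2 * k"] by simp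
  also have "\<dots> \<le> (2 * n) ^ (2 * k)"
  proof (cases "2 * k \<le> 2 * n")
    case True
    then show ?thesis by (rule binomial_le_pow)
  qed (simp add: binomial_eq_0)
  also have "\<dots> \<le> (8 * (p * p)) ^ (2 * k)" using n by (intro power_mono) auto
  also have "\<dots> = 64 ^ k * p ^ (4 * k)" by (simp add: power_mult power_mult_distrib power2_eq_square power4_eq_xxxx)
  finally have card: "card (Sm n (2 * k)) \<le> 64 ^ k * p ^ (4 * k)" .
  let ?bad = "{S \<in> Sm n (2 * k). \<forall>r<N. \<not> inj_on (shift_block p (gs r)) S}"
  have "?bad = {}"
  proof (rule ccontr)
    assume "?bad \<noteq> {}"
    then have "1 \<le> card ?bad" using fin by (simp add: card_gt_0_iff Suc_leI)
    then have "p ^ N \<le> p ^ N * card ?bad" by simp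
    also have "\<dots> \<le> ((2 * k)\<^sup>2) ^ N * (64 ^ k * p ^ (4 * k))"
      using gs card by (meson le_trans mult_le_mono2)
    \<comment> \<open>The threshold on p is the constant collected so far, so one extra factor p
      beats it; N \<ge> 4k + 1 then gives the contradiction.\<close>
    also have "\<dots> < p * p ^ (4 * k)" using p p0 by (simp add: mult.assoc[symmetric])
    also have "\<dots> = p ^ (4 * k + 1)" by simp
    also have "\<dots> \<le> p ^ N" using N p0 by (intro power_increasing) auto
    finally show False by simp
  qed
  then show ?thesis by blast
qed

section \<open>Conclusion\<close>

text \<open>The properties of one grid matrix, stated outside the locale: the locale fixes a single
  g, whereas the family needs several shifts with a common p.\<close>

definition separates :: "nat \<Rightarrow> nat \<Rightarrow> (nat \<Rightarrow> nat) \<Rightarrow> real mat \<Rightarrow> bool" where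
  "separates n p g Om \<longleftrightarrow> orth_mat (2 * n) Om \<and>
    (\<forall>k S. S \<subseteq> {0..<2 * n} \<longrightarrow> card S = 2 * k \<longrightarrow> inj_on (shift_block p g) S \<longrightarrow>
      (\<exists>R\<in>D2k n k. (1 / (64 * real p)) ^ k \<le> \<bar>minor Om R S\<bar>)) \<and>
    (\<forall>x y. x < 2 * n \<longrightarrow> y < 2 * n \<longrightarrow> x \<noteq> y \<longrightarrow> shift_block p g x = shift_block p g y \<longrightarrow>
      x div p mod p = y div p mod p \<longrightarrow> (\<exists>R\<in>D2k n 1. 1 / (64 * real p) \<le> \<bar>minor Om R {x, y}\<bar>))"

lemma separatesD:
  assumes "separates n p g Om"
  shows "orth_mat (2 * n) Om"
    and "S \<subseteq> {0..<2 * n} \<Longrightarrow> card S = 2 * k \<Longrightarrow> inj_on (shift_block p g) S \<Longrightarrow>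
      \<exists>R\<in>D2k n k. (1 / (64 * real p)) ^ k \<le> \<bar>minor Om R S\<bar>"
    and "x < 2 * n \<Longrightarrow> y < 2 * n \<Longrightarrow> x \<noteq> y \<Longrightarrow> shift_block p g x = shift_block p g y \<Longrightarrow>
      x div p mod p = y div p mod p \<Longrightarrow> \<exists>R\<in>D2k n 1. 1 / (64 * real p) \<le> \<bar>minor Om R {x, y}\<bar>"
  using assms unfolding separates_def by blast+

lemma separates_exists:
  assumes "p = 2 ^ a" "p * p \<le> n" "n < 4 * (p * p)"
  shows "\<exists>Om. \<forall>r. separates n p (gs r) (Om r)"
proof (rule exI, rule allI)
  fix r
  interpret column_grid n a p "gs r"
    using assms by unfold_locales
  have "\<exists>M. separates n p (gs r) M"
    using design_minors unfolding separates_def pos_def by (simp only: of_nat_mult of_nat_numeral)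
  then show "separates n p (gs r) (SOME M. separates n p (gs r) M)"
    by (rule someI_ex)
qed

lemma dyadic_square:
  assumes "n \<ge> 1"
  obtains a where "2 ^ a * 2 ^ a \<le> n" "n < 4 * (2 ^ a * 2 ^ a :: nat)"
proof -
  obtain a where "4 ^ a \<le> n" "n < 4 ^ (a + 1)"
    using ex_power_ivl1[of 4 n] assms by auto
  moreover have "(4 :: nat) ^ a = 2 ^ a * 2 ^ a" by (simp flip: power_mult_distrib)
  ultimately show ?thesis using that[of a] by simp
qed

text \<open>Only p \<le> sqrt n enters, since a smaller p merely improves the bound on the
  minors.\<close>

lemma powr_le_block:
  assumes "p > 0" "p * p \<le> n"
  shows "(1 / 64) ^ k * real n powr (- real k / 2) \<le> (1 / (64 * real p)) ^ k"
proof -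
  have n: "n > 0" using assms by (cases n) auto
  have "real p * real p \<le> real n" using assms(2) by (simp flip: of_nat_mult)
  then have le: "real p \<le> sqrt n" by (intro real_le_rsqrt) (simp add: power2_eq_square)
  have "real n powr (- real k / 2) = 1 / (real n powr (1 / 2)) powr k"
    by (simp add: powr_powr powr_minus_divide)
  also have "\<dots> = 1 / sqrt n ^ k"
    using n by (simp add: powr_half_sqrt powr_realpow)
  finally have "(1 / 64) ^ k * real n powr (- real k / 2) = (1 / (64 * sqrt n)) ^ k"
    by (simp add: power_divide power_mult_distrib)
  also have "\<dots> \<le> (1 / (64 * real p)) ^ k"
    using le assms(1) n by (intro power_mono divide_left_mono mult_pos_pos) auto
  finally show ?thesis .
qed

text \<open>Columns in the same block for the shifts 0 and id lie in the same fibre of the grid, where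
  the separating row takes over; so two matrices suffice for column pairs.\<close>
lemma orthogonal_family:
  assumes kN: "(k \<ge> 1 \<and> N > 4 * k) \<or> (k = 1 \<and> N = 2)" and n: "n \<ge> 1"
    and large: "n \<ge> 4 * (((2 * k)\<^sup>2) ^ N * 64 ^ k)\<^sup>2"
  shows "\<exists>Om. (\<forall>r < N. orth_mat (2 * n) (Om r)) \<and>
     (\<forall>S \<in> Sm n (2 * k). \<exists>r < N. \<exists>R \<in> D2k n k.
        (1 / 64) ^ k * real n powr (- real k / 2) \<le> \<bar>minor (Om r) R S\<bar>)"
proof -
  obtain a where a: "2 ^ a * 2 ^ a \<le> n" "n < 4 * (2 ^ a * 2 ^ a)"
    using dyadic_square[OF n] .
  define p :: nat where "p = 2 ^ a"
  have pn: "p * p \<le> n" "n < 4 * (p * p)" and p0: "p > 0" using a by (simp_all add: p_def)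
  note bound = powr_le_block[OF p0 pn(1), of k]
  from kN show ?thesis
  proof (elim disjE conjE)
    assume N: "N > 4 * k"
    \<comment> \<open>Writing C for this constant, n \<ge> 4 C^2 and n < 4 p^2 force p > C.\<close>
    have "p > ((2 * k)\<^sup>2) ^ N * 64 ^ k"
    proof (rule ccontr)
      assume "\<not> ?thesis"
      then have "p * p \<le> (((2 * k)\<^sup>2) ^ N * 64 ^ k)\<^sup>2"
        unfolding power2_eq_square[of "((2 * k)\<^sup>2) ^ N * 64 ^ k"] by (intro mult_le_mono) simp_all
      then show False using pn(2) large by linarith
    qed
    then obtain gs where gs: "\<forall>S\<in>Sm n (2 * k). \<exists>r<N. inj_on (shift_block p (gs r)) S"
      using separating_shifts[OF N pn(2)] by blast
    obtain Om where Om: "separates n p (gs r) (Om r)" for r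
      using separates_exists[OF p_def pn, of gs] by blast
    have "\<exists>r<N. \<exists>R\<in>D2k n k. (1 / 64) ^ k * real n powr (- real k / 2) \<le> \<bar>minor (Om r) R S\<bar>"
      if S: "S \<in> Sm n (2 * k)" for S
    proof -
      obtain r where r: "r < N" "inj_on (shift_block p (gs r)) S" using gs S by blast
      then obtain R where "R \<in> D2k n k" "(1 / (64 * real p)) ^ k \<le> \<bar>minor (Om r) R S\<bar>"
        using separatesD(2)[OF Om, of S k r] S by (auto simp: Sm_def)
      moreover from this(2) bound have "(1 / 64) ^ k * real n powr (- real k / 2) \<le> \<bar>minor (Om r) R S\<bar>"
        by simp
      ultimately show ?thesis using r(1) by blast
    qed
    then show ?thesis using separatesD(1)[OF Om] by blast
  next
    assume kN: "k = 1" "N = 2"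
    \<comment> \<open>The blocks become \<open>x mod p\<close> for the first shift and
      \<open>(x mod p + x div p) mod p\<close> for the second. Agreement in both fixes
      \<open>x mod p\<close> and then \<open>x div p mod p\<close>.\<close>
    define gs :: "nat \<Rightarrow> nat \<Rightarrow> nat" where "gs r = (if r = 0 then (\<lambda>_. 0) else (\<lambda>u. u))" for r
    obtain Om where Om: "separates n p (gs r) (Om r)" for r
      using separates_exists[OF p_def pn, of gs] by blast
    have two: "\<exists>r<N. \<exists>R\<in>D2k n k. (1 / (64 * real p)) ^ k \<le> \<bar>minor (Om r) R S\<bar>" if S: "S \<in> Sm n (2 * k)" for S
    proof -
      have S2: "S \<subseteq> {0..<2 * n}" "card S = 2 * 1" using S kN by (auto simp: Sm_def)
      then obtain x y where xy: "S = {x, y}" "x \<noteq> y" by (metis card_2_iff mult_1_right)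
      show ?thesis
      proof (cases "\<exists>r<2. inj_on (shift_block p (gs r)) S")
        case True
        then obtain r where "r < 2" "inj_on (shift_block p (gs r)) S" by blast
        then show ?thesis using separatesD(2)[OF Om S2] kN by blast
      next
        case False
        then have "\<not> inj_on (shift_block p (gs 0)) S" "\<not> inj_on (shift_block p (gs 1)) S" by auto
        then have eq: "shift_block p (gs 0) x = shift_block p (gs 0) y" "shift_block p (gs 1) x = shift_block p (gs 1) y"
          using xy by auto
        have v: "x mod p = y mod p" using eq(1) by (simp add: shift_block_def gs_def)
        have "(x mod p + x div p) mod p = (y mod p + y div p) mod p"
          using eq(2) unfolding shift_block_def gs_def by (simp only: one_neq_zero if_False)
        then have "(x div p + x mod p) mod p = (y div p + x mod p) mod p"
          unfolding v by (simp only: add.commute)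
        then have "(x div p mod p + x mod p) mod p = (y div p mod p + x mod p) mod p"
          by (simp only: mod_add_left_eq)
        then have "x div p mod p = y div p mod p"
          by (rule add_mod_inj) (simp_all add: p0)
        \<comment> \<open>The two columns share a fibre of the first grid, so its diagonal pair of
          rows separates them.\<close>
        then have "\<exists>R\<in>D2k n 1. 1 / (64 * real p) \<le> \<bar>minor (Om 0) R {x, y}\<bar>"
          using separatesD(3)[OF Om] eq(1) xy S2(1) by simp
        then show ?thesis using kN xy(1) by (intro exI[of _ 0]) simp
      qed
    qed
    have "\<exists>r<N. \<exists>R\<in>D2k n k. (1 / 64) ^ k * real n powr (- real k / 2) \<le> \<bar>minor (Om r) R S\<bar>"
      if S: "S \<in> Sm n (2 * k)" for S
    proof -
      obtain r R where "r < N" "R \<in> D2k n k" "(1 / (64 * real p)) ^ k \<le> \<bar>minor (Om r) R S\<bar>"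
        using two[OF S] by blast
      moreover from this(3) bound have "(1 / 64) ^ k * real n powr (- real k / 2) \<le> \<bar>minor (Om r) R S\<bar>"
        by simp
      ultimately show ?thesis by blast
    qed
    then show ?thesis using separatesD(1)[OF Om] by blast
  qed
qed

theorem theorem1:
  fixes k N :: nat
  assumes "(k \<ge> 1 \<and> N > 4 * k) \<or> (k = 1 \<and> N = 2)"
  shows "\<exists>c > 0. \<exists>c' > 0. \<exists>n0 :: nat. \<forall>n \<ge> n0. \<exists>Om :: nat \<Rightarrow> real mat.
     (\<forall>r < N. orth_mat (2 * n) (Om r)) \<and>
     (\<forall>S \<in> Sm n (2 * k). \<exists>r < N. \<exists>R \<in> D2k n k.
        \<bar>minor (Om r) R S\<bar> \<ge> c * real n powr (- real k / 2)) \<and>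
     (\<forall>\<gamma>. majorana n \<gamma> \<longrightarrow>
        jointly_measures (2 ^ n) (LambdaN N n) (Gmix N n \<gamma> Om) (Sm n (2 * k)) {1, -1}
          (Mobs n \<gamma> (c' * real n powr (- real k / 2))))"
proof -
  \<comment> \<open>One factor 1/64 for each of the k pairs of rows.\<close>
  define c :: real where "c = (1 / 64) ^ k"
  have c: "c > 0" by (simp add: c_def)
  have N: "N \<ge> 1" using assms by auto
  have main: "\<exists>Om :: nat \<Rightarrow> real mat.
     (\<forall>r < N. orth_mat (2 * n) (Om r)) \<and>
     (\<forall>S \<in> Sm n (2 * k). \<exists>r < N. \<exists>R \<in> D2k n k.
        \<bar>minor (Om r) R S\<bar> \<ge> c * real n powr (- real k / 2)) \<and>
     (\<forall>\<gamma>. majorana n \<gamma> \<longrightarrow>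
        jointly_measures (2 ^ n) (LambdaN N n) (Gmix N n \<gamma> Om) (Sm n (2 * k)) {1, -1}
          (Mobs n \<gamma> (c / N * real n powr (- real k / 2))))"
    if n: "n \<ge> max 1 (4 * (((2 * k)\<^sup>2) ^ N * 64 ^ k)\<^sup>2)" for n
  proof -
    have n1: "n \<ge> 1" "n \<ge> 4 * (((2 * k)\<^sup>2) ^ N * 64 ^ k)\<^sup>2" using n by simp_all
    obtain Om where Om: "\<forall>r < N. orth_mat (2 * n) (Om r)"
      and minors: "\<forall>S \<in> Sm n (2 * k). \<exists>r < N. \<exists>R \<in> D2k n k. c * real n powr (- real k / 2) \<le> \<bar>minor (Om r) R S\<bar>"
      using orthogonal_family[OF assms n1] unfolding c_def by blast
    have "jointly_measures (2 ^ n) (LambdaN N n) (Gmix N n \<gamma> Om) (Sm n (2 * k)) {1, -1}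
          (Mobs n \<gamma> (c / N * real n powr (- real k / 2)))" if \<gamma>: "majorana n \<gamma>" for \<gamma>
    proof -
      interpret majorana_system n \<gamma> by unfold_locales (rule \<gamma>)
      have "jointly_measures (2 ^ n) (LambdaN N n) (Gmix N n \<gamma> Om) (Sm n (2 * k)) {1, -1}
          (Mobs n \<gamma> (c * real n powr (- real k / 2) / N))"
        using Om minors n1(1) N c by (intro parent_jointly_measures) auto
      then show ?thesis by simp
    qed
    then show ?thesis using Om minors by blast
  qed
  show ?thesis
  proof (intro exI conjI)
    \<comment> \<open>The sharpness constant is c / N, since outcomes of the other matrices
      contribute unbiased guesses only.\<close>
    show "c > 0" "c / N > 0" using c N by simp_all
    show "\<forall>n \<ge> max 1 (4 * (((2 * k)\<^sup>2) ^ N * 64 ^ k)\<^sup>2). \<exists>Om :: nat \<Rightarrow> real mat.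
       (\<forall>r < N. orth_mat (2 * n) (Om r)) \<and>
       (\<forall>S \<in> Sm n (2 * k). \<exists>r < N. \<exists>R \<in> D2k n k.
          \<bar>minor (Om r) R S\<bar> \<ge> c * real n powr (- real k / 2)) \<and>
       (\<forall>\<gamma>. majorana n \<gamma> \<longrightarrow>
          jointly_measures (2 ^ n) (LambdaN N n) (Gmix N n \<gamma> Om) (Sm n (2 * k)) {1, -1}
            (Mobs n \<gamma> (c / N * real n powr (- real k / 2))))"
      using main by blast
  qed
qed

end
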